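(* Let $d,m$ be positive integers with $m>d/2$ and let $\Phi=\Phi_{m,d}$ be the Matérn kernel. If $f\in L^{2m,1}$, then there exists a constant $\widetilde{C}_f$, depending only on $f,d,m$, such that the interpolant $I_hf$ to $f$ on $h\mathbb{Z}^d$ satisfies $$\|f-I_hf\|_\infty\le\widetilde{C}_f\,h^{2m},\qquad h\in(0,1].$$
   Context: $\|\cdot\|$ is the Euclidean norm on $\mathbb{R}^d$ and $\|\cdot\|_\infty$ the norm of $L_\infty(\mathbb{R}^d)$. The Matérn kernel is $\Phi(x)=\Phi_{m,d}(x)=\|x\|^{m-d/2}K_{m-d/2}(\|x\|)$, $x\in\mathbb{R}^d$ (value at $0$ by continuity), where $K_\nu$ is the modified Bessel function of the third kind (Macdonald function) of order $\nu$. It is continuous and decays exponentially. For $h>0$, $\Phi_h(x):=\Phi(hx)$ and $$\mathcal{S}^h(\Phi_h)=\Big\{\sum_{j\in\mathbb{Z}^d}c_j\,\Phi(\cdot-hj):\ c\in\ell_\infty(\mathbb{Z}^d)\Big\}.$$ The Lagrange function $\chi_h$ is the unique element of $\mathcal{S}^h(\Phi_h)$ with $\chi_h(hj)=\delta_{j0}$ for all $j\in\mathbb{Z}^d$; explicitly, $\chi_h(x)=\sum_{k\in\mathbb{Z}^d}a_k^h\,\Phi(x-hk)$, where $\{a_k^h\}_{k\in\mathbb{Z}^d}\in\ell_1$ is the sequence of Fourier coefficients of $1/\sigma_m(\cdot,h)$, with $\sigma_m(t,h):=\sum_{k\in\mathbb{Z}^d}\Phi_h(k)e^{ik\cdot t}>0$,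 $t\in\mathbb{R}^d$. For $h\in(0,1]$ and a bounded function $f$ on $\mathbb{R}^d$, $$I_hf(x)=\sum_{j\in\mathbb{Z}^d}f(hj)\,\chi_h(x-hj),\quad x\in\mathbb{R}^d.$$ $L^{2m,1}$ is the space of all $f\in L_1(\mathbb{R}^d)$ such that $(1+\|\cdot\|^2)^m\widehat{f}\in L_1(\mathbb{R}^d)$, where $\widehat{f}$ is the Fourier transform of $f$; such $f$ is identified with its bounded continuous representative, so that the values $f(hj)$ make sense. *)

theory Defs
  imports "HOL-Probability.Essential_Supremum"
begin

text \<open>
  The Macdonald function (modified Bessel function of the third kind) for real order and
  positive real argument.
\<close>

definition macdonald_K :: "real \<Rightarrow> real \<Rightarrow> real" where
  "macdonald_K \<nu> r = (LBINT t:{0..}. exp (- r * cosh t) * cosh (\<nu> * t))"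

definition matern_profile :: "real \<Rightarrow> real \<Rightarrow> real" where
  "matern_profile \<nu> r = r powr \<nu> * macdonald_K \<nu> r"

definition matern :: "nat \<Rightarrow> real ^ 'd \<Rightarrow> real" where
  "matern m x =
    (let \<nu> = real m - real CARD('d) / 2
     in if x = 0 then Lim (at_right 0) (matern_profile \<nu>) else matern_profile \<nu> (norm x))"

definition grid_point :: "real \<Rightarrow> int ^ 'd \<Rightarrow> real ^ 'd" where
  "grid_point h j = (\<chi> i. h * of_int (j $ i))"

text \<open>
  The space \<open>S\<^sup>h(\<Phi>\<^sub>h)\<close>, with \<open>\<Phi>\<^sub>h = \<Phi>(h \<cdot>)\<close>, consists of the functions
  \<open>\<Sum>\<^sub>j c\<^sub>j \<Phi>\<^sub>h(\<cdot>/h - j) = \<Sum>\<^sub>j c\<^sub>j \<Phi>(\<cdot> - hj)\<close> with bounded coefficients. Since \<open>\<Phi>\<close> decays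
  exponentially, the series converge absolutely at every point.
\<close>

definition matern_space :: "nat \<Rightarrow> real \<Rightarrow> (real ^ 'd \<Rightarrow> complex) set" where
  "matern_space m h =
    {(\<lambda>x. \<Sum>\<^sub>\<infinity>j. c j * of_real (matern m (x - grid_point h j))) | c :: int ^ 'd \<Rightarrow> complex.
      bounded (range c)}"

definition lagrange_fun :: "nat \<Rightarrow> real \<Rightarrow> real ^ 'd \<Rightarrow> complex" where
  "lagrange_fun m h =
    (THE L. L \<in> matern_space m h \<and>
      (\<forall>j. L (grid_point h j) = (if j = 0 then 1 else 0)))"

definition interpolant :: "nat \<Rightarrow> real \<Rightarrow> (real ^ 'd \<Rightarrow> complex) \<Rightarrow> real ^ 'd \<Rightarrow> complex" where
  "interpolant m h f x =
    (\<Sum>\<^sub>\<infinity>j. f (grid_point h j) * lagrange_fun m h (x - grid_point h j))"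

definition fourier_transform :: "(real ^ 'd \<Rightarrow> complex) \<Rightarrow> real ^ 'd \<Rightarrow> complex" where
  "fourier_transform f \<omega> = (LINT x|lborel. f x * exp (- \<i> * of_real (\<omega> \<bullet> x)))"

text \<open>
  A class in \<open>L\<^sup>2\<^sup>m\<^sup>,\<^sup>1\<close> has an integrable Fourier transform, hence exactly one continuous
  representative, which is bounded by Fourier inversion. The set below consists of these
  representatives; boundedness need not be required. The space does not depend on the
  normalisation of the Fourier transform.
\<close>

definition L2m1 :: "nat \<Rightarrow> (real ^ 'd \<Rightarrow> complex) set" where
  "L2m1 m =
    {f. continuous_on UNIV f \<and> integrable lborel f \<and>
      integrable lborel (\<lambda>\<omega>. of_real ((1 + (norm \<omega>)\<^sup>2) ^ m) * fourier_transform f \<omega>)}"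

text \<open>
  \<open>esssup\<close> is infinite for non-measurable functions, so a finite bound on
  this norm entails measurability of the modulus.
\<close>

definition Linf_norm :: "(real ^ 'd \<Rightarrow> complex) \<Rightarrow> ereal" where
  "Linf_norm g = esssup lborel (\<lambda>x. ereal (norm (g x)))"

end

theory Submission
  imports Defs "HOL-Probability.Probability"
begin

text \<open>
  By Fourier inversion \<open>f\<close> is a superposition of the exponentials \<open>e\<^sub>\<omega>(x) = exp (i \<omega> \<bullet> x)\<close> with density
  proportional to the Fourier transform of \<open>f\<close>, so it suffices to bound \<open>e\<^sub>\<omega> - I\<^sub>h e\<^sub>\<omega>\<close> by a constant
  times \<open>h\<^sup>2\<^sup>m (1 + |\<omega>|\<^sup>2)\<^sup>m\<close>, uniformly in \<open>x\<close>, \<open>\<omega>\<close> and \<open>h\<close>. The Lagrange function comes from a summable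
  convolution inverse of the samples \<open>\<Phi>(h k)\<close>, whence \<open>I\<^sub>h e\<^sub>\<omega>(x) = P(x) / P(0)\<close> with
  \<open>P(x) = \<Sum>\<^sub>n \<Phi>(x - h n) e\<^sub>\<omega>(h n)\<close>. Poisson summation, which for the Gaussian mixture \<open>\<Phi>\<close> reduces to
  one-dimensional Gaussians, gives \<open>P(x) = A \<Sum>\<^sub>k g(\<omega>\<^sub>k) e\<^sub>\<omega>\<^sub>k(x)\<close> with \<open>\<omega>\<^sub>k = \<omega> + 2 \<pi> k / h\<close> and
  \<open>g(\<xi>) = (1 + |\<xi>|\<^sup>2)\<^sup>-\<^sup>m\<close>. Hence \<open>|e\<^sub>\<omega> - I\<^sub>h e\<^sub>\<omega>|\<close> is at most \<open>2 \<Sum>\<^sub>k\<^sub>\<noteq>\<^sub>0 g(\<omega>\<^sub>k) / \<Sum>\<^sub>k g(\<omega>\<^sub>k)\<close>. For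
  \<open>|\<omega>\<^sub>i| \<le> \<pi> / h\<close> the numerator is \<open>O(h\<^sup>2\<^sup>m)\<close> because \<open>2 m > d\<close>, and the denominator is at least \<open>g(\<omega>)\<close>;
  for all other \<open>\<omega>\<close> the quotient is at most \<open>2 \<le> 2 h\<^sup>2\<^sup>m |\<omega>|\<^sup>2\<^sup>m\<close>.
\<close>

section \<open>Sums and integrals of products\<close>

text \<open>The weight in \<open>L2m1\<close> is the reciprocal of g: the factor (1 +
  |\<omega>|^2)^m = 1 / g(\<omega>) is the price of dividing by the alias sum, while h^(2m) is the
  decay of g at aliases whose distance from 0 is of order 1 / h. Fubini over the grid needs absolute
  summability of the translates of the Lagrange function, hence a summable inverse of the samples
  and not just some interpolant. Gaussians decay fast together with their transforms, so Poisson
  summation is proved for them, and passing to the kernel, whose transform is barely summable for m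
  near d / 2, costs only an exchange of sum and integral. \<open>lagrange_fun\<close> is a definite
  description over bounded coefficients, which need not have a Fourier series, so its uniqueness
  rests on associativity of convolution. The constants from Wiener's lemma depend on h and serve
  existence and summability only; the rate comes from the explicit quotient of alias sums.\<close>

lemma norm_summable_iff_integrable_count:
  fixes f :: "'i \<Rightarrow> complex"
  shows "(\<lambda>i. norm (f i)) summable_on A \<longleftrightarrow> integrable (count_space A) f"
  using abs_summable_equivalent[of f A] by (simp add: abs_summable_on_def)

text \<open>Without summability both sides are the default 0: over the complex numbers unconditional
  and absolute summability coincide, so the sum diverges exactly where the integral fails to
  exist.\<close>

lemma infsum_eq_integral_count:
  fixes f :: "'i \<Rightarrow> complex"
  shows "infsum f A = integral\<^sup>L (count_space A) f"
proof (cases "(\<lambda>i. norm (f i)) summable_on A")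
  case True
  then show ?thesis
    using infsetsum_infsum[of f A] abs_summable_equivalent[of f A] by (simp add: infsetsum_def)
next
  case False
  then have "\<not> f summable_on A"
    using summable_on_iff_abs_summable_on_complex by blast
  with False show ?thesis
    by (simp add: infsum_not_exists not_integrable_integral_eq flip: norm_summable_iff_integrable_count)
qed

text \<open>Fubini for the product of a counting measure with \<open>M\<close>. Countability of the
  index type provides joint measurability and sigma-finiteness of the counting factor.\<close>

lemma
  fixes f :: "'i::countable \<Rightarrow> 'a \<Rightarrow> complex"
  assumes "sigma_finite_measure M"
    and int: "\<And>i. integrable M (f i)"
    and sum: "(\<lambda>i. LINT x|M. norm (f i x)) summable_on UNIV"
  shows integrable_infsum: "integrable M (\<lambda>x. \<Sum>\<^sub>\<infinity>i. f i x)"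
    and integral_infsum_swap: "(LINT x|M. (\<Sum>\<^sub>\<infinity>i. f i x)) = (\<Sum>\<^sub>\<infinity>i. LINT x|M. f i x)"
proof -
  interpret M: sigma_finite_measure M by fact
  interpret C: sigma_finite_measure "count_space (UNIV :: 'i set)"
    by (rule sigma_finite_measure_count_space)
  interpret pair_sigma_finite "count_space (UNIV :: 'i set)" M ..
  have m: "case_prod f \<in> borel_measurable (count_space UNIV \<Otimes>\<^sub>M M)"
    by (rule measurable_pair_measure_countable1) (use int in auto)
  have "(\<lambda>i. norm (complex_of_real (LINT x|M. norm (f i x)))) summable_on UNIV"
    using sum by simp
  then have "integrable (count_space UNIV) (\<lambda>i. LINT x|M. norm (f i x))"
    using norm_summable_iff_integrable_count[of "\<lambda>i. complex_of_real (LINT x|M. norm (f i x))" UNIV]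
    by (simp add: complex_of_real_integrable_eq)
  then have I: "integrable (count_space UNIV \<Otimes>\<^sub>M M) (case_prod f)"
    by (intro Fubini_integrable m) (use int in auto)
  show "integrable M (\<lambda>x. \<Sum>\<^sub>\<infinity>i. f i x)"
    using integrable_snd[OF I] by (simp add: infsum_eq_integral_count)
  show "(LINT x|M. (\<Sum>\<^sub>\<infinity>i. f i x)) = (\<Sum>\<^sub>\<infinity>i. LINT x|M. f i x)"
    using Fubini_integral[OF I] by (simp add: infsum_eq_integral_count)
qed

text \<open>As an integral over the counting measure the sum depends measurably on the parameter; at
  points of divergence both take the value 0.\<close>

lemma borel_measurable_infsum:
  fixes f :: "'i::countable \<Rightarrow> 'a \<Rightarrow> complex"
  assumes "\<And>i. f i \<in> borel_measurable M"
  shows "(\<lambda>x. \<Sum>\<^sub>\<infinity>i. f i x) \<in> borel_measurable M"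
proof -
  interpret C: sigma_finite_measure "count_space (UNIV :: 'i set)"
    by (rule sigma_finite_measure_count_space)
  have "case_prod f \<in> borel_measurable (count_space UNIV \<Otimes>\<^sub>M M)"
    by (rule measurable_pair_measure_countable1) (use assms in auto)
  then have "(\<lambda>(x, i). f i x) \<in> borel_measurable (M \<Otimes>\<^sub>M count_space UNIV)"
    by (subst (asm) measurable_pair_swap_iff) (simp add: case_prod_unfold)
  from C.borel_measurable_lebesgue_integral[OF this] show ?thesis
    by (simp add: infsum_eq_integral_count)
qed

section \<open>Factorisation over the coordinates\<close>

lemma
  fixes g :: "'d::finite \<Rightarrow> real \<Rightarrow> complex"
  assumes g: "\<And>i. integrable lborel (g i)"
  shows integral_prod_vec: "(LINT x|lborel. (\<Prod>i\<in>UNIV. g i ((x :: real ^ 'd) $ i))) = (\<Prod>i\<in>UNIV. LINT t|lborel. g i t)"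
    and integrable_prod_vec: "integrable lborel (\<lambda>x :: real ^ 'd. \<Prod>i\<in>UNIV. g i (x $ i))"
proof -
  interpret product_sigma_finite "\<lambda>_::real ^ 'd. lborel :: real measure" ..
  \<comment> \<open>The product formula for Lebesgue measure indexes coordinates by basis vectors,
    so the factors are transported along \<open>axis\<close>.\<close>
  define F where "F b = g (THE i. b = axis i 1)" for b :: "real ^ 'd"
  have F: "F (axis i 1) = g i" for i
    unfolding F_def by (rule arg_cong[of _ _ g]) (auto simp: axis_eq_axis)
  have inj: "inj (\<lambda>i::'d. axis i (1::real))"
    by (auto simp: inj_on_def axis_eq_axis)
  have B: "(Basis :: (real ^ 'd) set) = range (\<lambda>i. axis i 1)"
    by (auto simp: Basis_vec_def)
  have PB: "(\<Prod>b\<in>Basis. H b) = (\<Prod>i\<in>UNIV. H (axis i 1))" for H :: "real ^ 'd \<Rightarrow> complex"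
    unfolding B by (subst prod.reindex[OF inj]) simp
  have Fint: "b \<in> Basis \<Longrightarrow> integrable lborel (F b)" for b
    unfolding B using F g by auto
  have gm[measurable]: "g i \<in> borel_measurable borel" for i
    using g[of i] by (simp add: borel_measurable_integrable)
  have "(\<lambda>x :: real ^ 'd. \<Prod>i\<in>UNIV. g i (x $ i)) \<in> borel_measurable borel"
    by measurable
  moreover have sumb: "(\<Sum>b\<in>Basis. f b *\<^sub>R b) $ i = f (axis i 1)" for f :: "real ^ 'd \<Rightarrow> real" and i
  proof -
    have "(\<Sum>b\<in>Basis. f b *\<^sub>R b) \<bullet> axis i 1 = f (axis i 1)"
      by (rule inner_sum_left_Basis) (auto simp: B)
    then show ?thesis by (simp add: inner_axis)
  qed
  moreover have basis_meas: "(\<lambda>f. \<Sum>b\<in>Basis. f b *\<^sub>R b) \<in> measurable (\<Pi>\<^sub>M b\<in>(Basis :: (real ^ 'd) set). lborel) borel"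
    by measurable
  ultimately show "(LINT x|lborel. (\<Prod>i\<in>UNIV. g i ((x :: real ^ 'd) $ i))) = (\<Prod>i\<in>UNIV. LINT t|lborel. g i t)"
    and "integrable lborel (\<lambda>x :: real ^ 'd. \<Prod>i\<in>UNIV. g i (x $ i))"
    using product_integral_prod[OF finite_Basis Fint, of "\<lambda>b. b"] product_integrable_prod[OF finite_Basis Fint, of "\<lambda>b. b"]
    by (simp_all only: lborel_eq[where 'a="real ^ 'd"] integral_distr integrable_distr_eq PB F sumb
        measurable_lborel1 basis_meas)
qed

lemma bij_vec_nth: "bij (vec_nth :: 'a ^ 'd \<Rightarrow> 'd::finite \<Rightarrow> 'a)"
proof (rule bijI')
  fix y :: "'d \<Rightarrow> 'a"
  show "\<exists>x. y = vec_nth x"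
    by (rule exI[of _ "vec_lambda y"]) (simp add: fun_eq_iff)
qed (simp add: vec_eq_iff fun_eq_iff)

lemma
  fixes g :: "'d::finite \<Rightarrow> int \<Rightarrow> complex"
  assumes g: "\<And>i. (\<lambda>n. norm (g i n)) summable_on UNIV"
  shows summable_prod_vec: "(\<lambda>k :: int ^ 'd. norm (\<Prod>i\<in>UNIV. g i (k $ i))) summable_on UNIV"
    and infsum_prod_vec: "(\<Sum>\<^sub>\<infinity>k :: int ^ 'd. \<Prod>i\<in>UNIV. g i (k $ i)) = (\<Prod>i\<in>UNIV. \<Sum>\<^sub>\<infinity>n. g i n)"
proof -
  have g': "Infinite_Set_Sum.abs_summable_on (g i) UNIV" for i
    using g abs_summable_equivalent by blast
  have "Infinite_Set_Sum.abs_summable_on (\<lambda>k. \<Prod>i\<in>UNIV. g i (k i)) (PiE UNIV (\<lambda>_. UNIV))"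
    by (rule abs_summable_on_prod_PiE) (use g' in auto)
  then have "(\<lambda>k. norm (\<Prod>i\<in>UNIV. g i (k i))) summable_on (PiE UNIV (\<lambda>_. UNIV))"
    by (rule abs_summable_equivalent[THEN iffD2])
  then have "(\<lambda>k. norm (\<Prod>i\<in>UNIV. g i (k i))) summable_on UNIV"
    by (simp add: PiE_UNIV_domain)
  then show "(\<lambda>k :: int ^ 'd. norm (\<Prod>i\<in>UNIV. g i (k $ i))) summable_on UNIV"
    using summable_on_reindex_bij_betw[OF bij_vec_nth, of "\<lambda>k. norm (\<Prod>i\<in>UNIV. g i (k i))"] by simp
  have "(\<Sum>\<^sub>\<infinity>k \<in> PiE UNIV (\<lambda>_. UNIV). \<Prod>i\<in>UNIV. g i (k i)) = (\<Prod>i\<in>UNIV. \<Sum>\<^sub>\<infinity>n. g i n)"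
    by (rule infsum_prod_PiE_abs) (use g in auto)
  then show "(\<Sum>\<^sub>\<infinity>k :: int ^ 'd. \<Prod>i\<in>UNIV. g i (k $ i)) = (\<Prod>i\<in>UNIV. \<Sum>\<^sub>\<infinity>n. g i n)"
    using infsum_reindex_bij_betw[OF bij_vec_nth, of "\<lambda>k. \<Prod>i\<in>UNIV. g i (k i)"] by simp
qed

section \<open>Poisson summation\<close>

lemma integral_cis_unit_interval:
  fixes k :: int
  shows "(LINT s:{-1/2..<1/2}|lborel. cis (2 * pi * of_int k * s)) = (if k = 0 then 1 else 0)"
proof -
  have [measurable]: "(\<lambda>s. cis (2 * pi * of_int k * s)) \<in> borel_measurable borel"
    by (intro borel_measurable_continuous_onI continuous_intros)
  \<comment> \<open>Translates of the half-open interval tile the line, which periodisation needs;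
    the fundamental theorem of calculus wants the closed interval, and the endpoint is a null
    set.\<close>
  have eq: "(LINT s:{-1/2..<1/2}|lborel. cis (2 * pi * of_int k * s)) =
      (LINT s|lborel. indicator {-1/2..1/2} s *\<^sub>R cis (2 * pi * of_int k * s))"
    unfolding set_lebesgue_integral_def
  proof (rule integral_cong_AE)
    show "AE s in lborel. indicat_real {-1/2..<1/2} s *\<^sub>R cis (2 * pi * of_int k * s) =
        indicat_real {-1/2..1/2} s *\<^sub>R cis (2 * pi * of_int k * s)"
      using AE_lborel_singleton[of "1/2 :: real"] by eventually_elim (auto simp: indicator_def)
  qed measurable
  show ?thesis
  proof (cases "k = 0")
    case True
    then show ?thesis unfolding eq by simp
  next
    case False
    define F where "F s = cis (2 * pi * of_int k * s) / (\<i> * of_real (2 * pi * of_int k))" for s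
    have der: "(F has_vector_derivative cis (2 * pi * of_int k * s)) (at s within {-1/2..1/2})" for s
    proof -
      let ?c = "\<i> * of_real (2 * pi * of_int k) :: complex"
      have "((\<lambda>z. exp (?c * z) / ?c) has_field_derivative exp (?c * of_real s)) (at (of_real s))"
        using False by (auto intro!: derivative_eq_intros)
      from has_vector_derivative_real_field[OF this] show ?thesis
        by (simp add: F_def[abs_def] cis_conv_exp mult_ac)
    qed
    have "(LINT s|lborel. indicator {-1/2..1/2} s *\<^sub>R cis (2 * pi * of_int k * s)) = F (1/2) - F (-1/2)"
      by (rule integral_FTC_Icc[OF _ der]) (auto intro!: continuous_intros)
    also have "F (1/2) = F (-1/2)"
    proof -
      have "cis (pi * of_int k) = cis (- (pi * of_int k) + 2 * pi * of_int k)"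
        by (simp add: algebra_simps)
      also have "\<dots> = cis (- (pi * of_int k)) * cis (2 * pi * of_int k)"
        by (simp only: cis_mult)
      also have "cis (2 * pi * of_int k) = 1"
        by (rule cis_multiple_2pi) auto
      finally show ?thesis by (simp add: F_def mult_ac)
    qed
    finally show ?thesis using False eq by simp
  qed
qed

text \<open>All frequencies are integers, so a function whose Fourier coefficients vanish integrates
  to 0 against this power.\<close>

lemma cos_power_even_eq_sum_cis:
  fixes n :: nat and s :: real
  shows "complex_of_real (cos (pi * s) ^ (2 * n)) =
    (\<Sum>j\<le>2*n. of_nat ((2 * n) choose j) / 4 ^ n * cis (2 * pi * of_int (int j - int n) * s))"
proof -
  have "complex_of_real (cos (pi * s)) = (cis (pi * s) + cis (- (pi * s))) / 2"
    by (simp add: complex_eq_iff)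
  then have "complex_of_real (cos (pi * s) ^ (2 * n)) = ((cis (pi * s) + cis (- (pi * s))) / 2) ^ (2 * n)"
    by (simp only: of_real_power)
  also have "\<dots> = (cis (pi * s) + cis (- (pi * s))) ^ (2 * n) / 4 ^ n"
    by (simp only: power_divide) (simp add: power_mult)
  also have "(cis (pi * s) + cis (- (pi * s))) ^ (2 * n) =
      (\<Sum>j\<le>2*n. of_nat ((2 * n) choose j) * cis (pi * s) ^ j * cis (- (pi * s)) ^ (2 * n - j))"
    by (rule binomial_ring)
  also have "\<dots> / 4 ^ n = (\<Sum>j\<le>2*n. of_nat ((2 * n) choose j) / 4 ^ n * cis (2 * pi * of_int (int j - int n) * s))"
    unfolding sum_divide_distrib
  proof (intro sum.cong refl)
    fix j assume j: "j \<in> {..2 * n}"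
    have "cis (pi * s) ^ j * cis (- (pi * s)) ^ (2 * n - j) = cis (real j * (pi * s) + real (2 * n - j) * - (pi * s))"
      by (simp only: Complex.DeMoivre cis_mult)
    also have "real j * (pi * s) + real (2 * n - j) * - (pi * s) = 2 * pi * of_int (int j - int n) * s"
      using j by (simp add: of_nat_diff algebra_simps)
    finally show "of_nat ((2 * n) choose j) * cis (pi * s) ^ j * cis (- (pi * s)) ^ (2 * n - j) / 4 ^ n =
        of_nat ((2 * n) choose j) / 4 ^ n * cis (2 * pi * of_int (int j - int n) * s)"
      by (simp add: mult.assoc)
  qed
  finally show ?thesis .
qed

text \<open>
  Testing against the trigonometric polynomials \<open>cos (\<pi> s)\<^sup>2\<^sup>n\<close>, which concentrate at \<open>0\<close>.
\<close>

lemma fourier_coeff_zero_imp_zero: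
  fixes F :: "real \<Rightarrow> complex"
  assumes cont: "continuous_on {-1/2..1/2} F"
    and zero: "\<And>k::int. (LINT s:{-1/2..<1/2}|lborel. F s * cis (2 * pi * of_int k * s)) = 0"
  shows "F 0 = 0"
proof (rule ccontr)
  assume F0: "F 0 \<noteq> 0"
  define S :: "real set" where "S = {-1/2..<1/2}"
  have S[measurable]: "S \<in> sets lborel" by (simp add: S_def)
  have SI: "set_integrable lborel S G" if "continuous_on {-1/2..1/2} G" for G :: "real \<Rightarrow> 'b :: {banach, second_countable_topology}"
    by (rule set_integrable_subset[OF borel_integrable_atLeastAtMost'[OF that]]) (auto simp: S_def)
  define w where "w n s = cos (pi * s) ^ (2 * n)" for n :: nat and s
  have w0: "w n s \<ge> 0" for n s by (simp add: w_def power_mult)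
  have Fw: "(LINT s:S|lborel. F s * of_real (w n s)) = 0" for n
  proof -
    have "(LINT s:S|lborel. F s * of_real (w n s)) =
      (LINT s:S|lborel. \<Sum>j\<le>2*n. of_nat ((2 * n) choose j) / 4 ^ n * (F s * cis (2 * pi * of_int (int j - int n) * s)))"
      unfolding w_def cos_power_even_eq_sum_cis by (simp add: sum_distrib_left mult_ac)
    also have "\<dots> = (\<Sum>j\<le>2*n. LINT s:S|lborel. of_nat ((2 * n) choose j) / 4 ^ n * (F s * cis (2 * pi * of_int (int j - int n) * s)))"
      unfolding set_lebesgue_integral_def scaleR_sum_right
      by (rule Bochner_Integration.integral_sum, unfold set_integrable_def[symmetric]) (intro SI continuous_intros cont)
    also have "\<dots> = 0"
      by (simp only: S_def set_integral_mult_right zero mult_zero_right sum.neutral_const)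
    finally show ?thesis .
  qed
  obtain B where B: "\<And>s. s \<in> {-1/2..1/2} \<Longrightarrow> norm (F s) \<le> B"
    using compact_imp_bounded[OF compact_continuous_image[OF cont compact_Icc]]
    unfolding bounded_iff by blast
  have B0: "B \<ge> 0" using order_trans[OF norm_ge_zero B[of 0]] by simp
  define e where "e = norm (F 0) / 2"
  have e: "e > 0" using F0 by (simp add: e_def)
  obtain d where d: "d > 0" "\<And>s. s \<in> {-1/2..1/2} \<Longrightarrow> dist s 0 < d \<Longrightarrow> dist (F s) (F 0) < e"
    using cont e unfolding continuous_on_iff by (metis atLeastAtMost_iff neg_le_0_iff_le half_gt_zero_iff less_eq_real_def zero_less_one minus_divide_left)
  \<comment> \<open>The cap 1/2 keeps the window inside the period, where cos (\<pi> s) is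
    nonnegative and decreasing in |s|.\<close>
  define D where "D = min d (1/2)"
  have D: "0 < D" "D \<le> 1/2" "D \<le> d" using d by (auto simp: D_def)
  \<comment> \<open>Off the window |s| < D the weight is at most r^n, and on |s| \<le> D / 2 it is
    at least R^n. As r < R, the mass near 0 exceeds everything outside the window
    exponentially.\<close>
  define r where "r = cos (pi * D) ^ 2"
  define R where "R = cos (pi * (D/2)) ^ 2"
  have cosmono: "cos (pi * b) \<le> cos (pi * a)" if "0 \<le> a" "a \<le> b" "b \<le> 1/2" for a b
    using that by (intro cos_monotone_0_pi_le) auto
  have cosnn: "0 \<le> cos (pi * a)" if "0 \<le> a" "a \<le> 1/2" for a
    using that by (intro cos_ge_zero) (auto simp: field_simps intro: order_trans[of _ 0])
  have rR: "r < R"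
    unfolding r_def R_def
    by (rule power_strict_mono) (use D in \<open>auto intro!: cos_monotone_0_pi cosnn\<close>)
  have r0: "0 \<le> r" by (simp add: r_def)
  have cabs: "cos (pi * s) = cos (pi * \<bar>s\<bar>)" for s
    by (cases "s \<ge> 0") auto
  have wle: "w n s \<le> r ^ n" if "s \<in> {-1/2..1/2}" "D \<le> \<bar>s\<bar>" for n s
    unfolding w_def r_def power_mult[symmetric] cabs[of s]
    by (rule power_mono) (use that D in \<open>auto intro!: cosmono cosnn\<close>)
  have wge: "R ^ n \<le> w n s" if "\<bar>s\<bar> \<le> D/2" for n s
    unfolding w_def R_def power_mult[symmetric] cabs[of s]
    by (rule power_mono[OF cosmono cosnn]) (use that D in auto)
  define I where "I n = (LINT s:S|lborel. w n s)" for n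
  have wI: "set_integrable lborel S (w n)" for n
    unfolding w_def by (intro SI continuous_intros)
  have lower: "D * R ^ n \<le> I n" for n
  proof -
    have "D * R ^ n = (LINT s:{-D/2..D/2}|lborel. R ^ n)"
      using D by (simp add: set_lebesgue_integral_def)
    also have "\<dots> \<le> I n"
      unfolding I_def set_lebesgue_integral_def
    proof (rule integral_mono, unfold set_integrable_def[symmetric])
      show "set_integrable lborel {-D/2..D/2} (\<lambda>s. R ^ n)"
        by (intro borel_integrable_atLeastAtMost' continuous_intros)
      show "set_integrable lborel S (w n)"
        by (rule wI)
    qed (use w0 wge D in \<open>auto simp: S_def indicator_def\<close>)
    finally show ?thesis .
  qed
  \<comment> \<open>By \<open>Fw\<close>, F 0 times the total mass is the integral of (F 0 - F s) w.
    In the window this is at most \<open>e\<close> = |F 0| / 2 times the mass, elsewhere at most 2 B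
    r^n.\<close>
  have upper: "norm (F 0) * I n \<le> e * I n + 2 * B * r ^ n" for n
  proof -
    have "norm (F 0) * I n = norm (F 0 * of_real (I n))"
      using w0 by (simp add: norm_mult I_def set_lebesgue_integral_def abs_of_nonneg)
    also have "F 0 * of_real (I n) = (LINT s:S|lborel. F 0 * of_real (w n s)) - (LINT s:S|lborel. F s * of_real (w n s))"
      unfolding Fw by (simp add: I_def set_integral_complex_of_real)
    also have "\<dots> = (LINT s:S|lborel. F 0 * of_real (w n s) - F s * of_real (w n s))"
      by (rule set_integral_diff(2)[symmetric]) (unfold w_def, auto intro!: SI continuous_intros cont)
    also have "norm \<dots> \<le> (LINT s:S|lborel. e * w n s + 2 * B * r ^ n)"
      unfolding set_lebesgue_integral_def
    proof (rule order_trans[OF integral_norm_bound integral_mono])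
      have "integrable lborel (\<lambda>x. indicat_real S x *\<^sub>R (F 0 * complex_of_real (w n x) - F x * complex_of_real (w n x)))"
        unfolding set_integrable_def[symmetric] w_def by (intro SI continuous_intros cont)
      then show "integrable lborel (\<lambda>x. norm (indicat_real S x *\<^sub>R (F 0 * complex_of_real (w n x) - F x * complex_of_real (w n x))))"
        by (rule integrable_norm)
      show "integrable lborel (\<lambda>x. indicat_real S x *\<^sub>R (e * w n x + 2 * B * r ^ n))"
        unfolding set_integrable_def[symmetric] w_def by (intro SI continuous_intros)
      fix s
      show "norm (indicat_real S s *\<^sub>R (F 0 * complex_of_real (w n s) - F s * complex_of_real (w n s)))
          \<le> indicat_real S s *\<^sub>R (e * w n s + 2 * B * r ^ n)"
      proof (cases "s \<in> S")
        case True
        then have s: "s \<in> {-1/2..1/2}" by (auto simp: S_def)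
        have "norm (F 0 * of_real (w n s) - F s * of_real (w n s)) = dist (F s) (F 0) * w n s"
          using w0 by (simp add: dist_norm norm_mult norm_minus_commute flip: left_diff_distrib)
        also have "\<dots> \<le> e * w n s + 2 * B * r ^ n"
        proof (cases "\<bar>s\<bar> < D")
          case True
          then have "dist (F s) (F 0) \<le> e"
            using d(2)[OF s] D by (auto simp: less_imp_le)
          then have "dist (F s) (F 0) * w n s \<le> e * w n s"
            using w0 by (intro mult_right_mono)
          then show ?thesis using B0 r0 by (smt (verit) mult_nonneg_nonneg zero_le_power)
        next
          case False
          have "dist (F s) (F 0) \<le> 2 * B"
            using B[OF s] B[of 0] norm_triangle_ineq4[of "F s" "F 0"] by (auto simp: dist_norm)
          then have "dist (F s) (F 0) * w n s \<le> 2 * B * r ^ n"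
            using wle[OF s, of n] False w0 B0 by (intro mult_mono) auto
          then show ?thesis using e w0[of n s] by (smt (verit) mult_nonneg_nonneg)
        qed
        finally show ?thesis using True by simp
      qed simp
    qed
    also have "\<dots> = e * I n + 2 * B * r ^ n"
    proof -
      have "(LINT s:S|lborel. e * w n s + 2 * B * r ^ n) = (LINT s:S|lborel. e * w n s) + (LINT s:S|lborel. 2 * B * r ^ n)"
        by (rule set_integral_add(2)) (unfold w_def, auto intro!: SI continuous_intros)
      then show ?thesis by (simp add: I_def) (simp add: set_lebesgue_integral_def S_def)
    qed
    finally show ?thesis .
  qed
  have R0: "R > 0" using rR r0 by linarith
  have "e * D \<le> 2 * B * (r / R) ^ n" for n
  proof -
    have "norm (F 0) = 2 * e" by (simp add: e_def)
    then have "e * I n \<le> 2 * B * r ^ n" using upper[of n] by (simp add: algebra_simps)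
    moreover have "e * (D * R ^ n) \<le> e * I n" using lower e by (intro mult_left_mono) auto
    ultimately have "e * D * R ^ n \<le> 2 * B * r ^ n" by simp
    then show ?thesis using R0 by (simp add: power_divide field_simps)
  qed
  moreover have "(\<lambda>n. 2 * B * (r / R) ^ n) \<longlonglongrightarrow> 2 * B * 0"
    by (intro tendsto_intros LIMSEQ_realpow_zero) (use r0 rR R0 in auto)
  ultimately have "e * D \<le> 2 * B * 0"
    by (intro LIMSEQ_le_const) auto
  then show False using e D by (simp add: mult_le_0_iff)
qed

lemma summable_on_int_nonneg:
  fixes f :: "int \<Rightarrow> real"
  assumes "summable (\<lambda>n. f (int n))" "summable (\<lambda>n. f (- int n))" "\<And>k. f k \<ge> 0"
  shows "f summable_on UNIV"
proof -
  have "f summable_on range int"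
    using assms by (subst summable_on_reindex) (auto simp: o_def intro!: summable_nonneg_imp_summable_on)
  moreover have "f summable_on range (\<lambda>n. - int n)"
    using assms by (subst summable_on_reindex) (auto simp: o_def inj_on_def intro!: summable_nonneg_imp_summable_on)
  ultimately have "f summable_on (range int \<union> range (\<lambda>n. - int n))"
    by (rule summable_on_union)
  also have "range int \<union> range (\<lambda>n. - int n) = UNIV"
  proof -
    have "k \<in> range int \<union> range (\<lambda>n. - int n)" for k
      by (cases k rule: int_cases2) auto
    then show ?thesis by blast
  qed
  finally show ?thesis .
qed

lemma summable_on_int_powr:
  fixes a :: real
  assumes "a > 1/2"
  shows "(\<lambda>n::int. (1 + (of_int n)\<^sup>2) powr (- a)) summable_on UNIV"
proof -
  have "summable (\<lambda>n. (1 + (real n)\<^sup>2) powr (- a))"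
  proof (rule summable_comparison_test_ev)
    show "summable (\<lambda>n. real n powr (- 2 * a))"
      using assms by (simp add: summable_real_powr_iff)
    show "\<forall>\<^sub>F n in sequentially. norm ((1 + (real n)\<^sup>2) powr (- a)) \<le> real n powr (- 2 * a)"
    proof (rule eventually_sequentiallyI[of 1])
      fix n :: nat assume "n \<ge> 1"
      have "real n powr (- 2 * a) = ((real n)\<^sup>2) powr (- a)"
        using powr_powr[of "real n" 2 "- a"] \<open>n \<ge> 1\<close> by simp
      then show "norm ((1 + (real n)\<^sup>2) powr (- a)) \<le> real n powr (- 2 * a)"
        using \<open>n \<ge> 1\<close> assms by (auto intro!: powr_mono2')
    qed
  qed
  then show ?thesis
    by (intro summable_on_int_nonneg) auto
qed

lemma cis_2pi_int_shift: "cis (2 * pi * of_int k * (s + of_int n)) = cis (2 * pi * of_int k * s)"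
proof -
  have "cis (2 * pi * of_int k * (s + of_int n)) = cis (2 * pi * of_int k * s) * cis (2 * pi * of_int (k * n))"
    by (simp add: cis_mult algebra_simps)
  also have "cis (2 * pi * of_int (k * n)) = 1"
    by (rule cis_multiple_2pi) auto
  finally show ?thesis by simp
qed

text \<open>Translation preserves nonmeasurability, and then both integrals are the default 0. The
  equation thus holds for every function and can serve as a rewrite rule.\<close>

lemma lborel_integral_add_right:
  fixes f :: "'a :: euclidean_space \<Rightarrow> 'b :: {banach, second_countable_topology}"
  shows "(LINT x|lborel. f (x + t)) = (LINT x|lborel. f x)"
proof -
  have shift: "distr lborel lborel (\<lambda>x. x + t) = (lborel :: 'a measure)"
    using lborel_distr_plus[of t] by (simp add: add.commute cong: distr_cong)
  show ?thesis
  proof (cases "f \<in> borel_measurable borel")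
    case True
    then show ?thesis
      using integral_distr[of "\<lambda>x. x + t" lborel lborel f] by (simp add: shift)
  next
    case False
    have "\<not> (\<lambda>x. f (x + t)) \<in> borel_measurable borel"
    proof
      assume "(\<lambda>x. f (x + t)) \<in> borel_measurable borel"
      from measurable_compose[OF _ this, of "\<lambda>x. x - t" borel] have "f \<in> borel_measurable borel" by simp
      with False show False by contradiction
    qed
    with False show ?thesis
      by (metis borel_measurable_integrable measurable_lborel2 not_integrable_integral_eq)
  qed
qed

text \<open>Every real y lies in exactly one translate of the half-open unit interval, the one with
  index floor (y + 1/2). The pieces of \<open>g\<close> on the translates may be summed under the
  integral because the integrals of their norms add up to at most that of |g|.\<close>

lemma integral_unit_interval_periodization:
  fixes g :: "real \<Rightarrow> complex"
  assumes g: "integrable lborel g"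
  shows "(LINT s:{-1/2..<1/2}|lborel. (\<Sum>\<^sub>\<infinity>n::int. g (s + of_int n))) = (LINT y|lborel. g y)"
proof -
  define S :: "real set" where "S = {-1/2..<1/2}"
  have S[measurable]: "S \<in> sets borel" by (simp add: S_def)
  define G where "G n y = indicator S (y - of_int n) *\<^sub>R g y" for n :: int and y
  have Gint: "integrable lborel (G n)" for n
    unfolding G_def by (rule Bochner_Integration.integrable_bound[OF g], use g in \<open>auto simp: indicator_def\<close>)
  have Gshift: "integrable lborel (\<lambda>s. G n (s + of_int n))" for n
    using lborel_integrable_real_affine[OF Gint, of 1 n "of_int n"] by (simp add: add.commute)
  have part: "(y - of_int n \<in> S) = (n = \<lfloor>y + 1/2\<rfloor>)" for y n
    unfolding S_def by (auto simp: floor_eq_iff) linarith+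
  have Gsum: "G n y = (if n = \<lfloor>y + 1/2\<rfloor> then g y else 0)" for n y
    by (simp add: G_def part indicator_def)
  have hs: "(\<Sum>\<^sub>\<infinity>n. G n y) = g y" for y
  proof -
    have "((\<lambda>n. G n y) has_sum (\<Sum>n\<in>{\<lfloor>y + 1/2\<rfloor>}. G n y)) UNIV"
      by (rule has_sum_finite_neutralI[of "{\<lfloor>y + 1/2\<rfloor>}"]) (auto simp: Gsum)
    then show ?thesis by (simp add: infsumI Gsum)
  qed
  have bound: "(\<Sum>n\<in>X. LINT y|lborel. norm (G n y)) \<le> (LINT y|lborel. norm (g y))" if "finite X" for X
  proof -
    have "(\<Sum>n\<in>X. LINT y|lborel. norm (G n y)) = (LINT y|lborel. (\<Sum>n\<in>X. norm (G n y)))"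
      by (rule Bochner_Integration.integral_sum[symmetric]) (use Gint in auto)
    also have "\<dots> \<le> (LINT y|lborel. norm (g y))"
    proof (rule integral_mono)
      fix y
      have "(\<Sum>n\<in>X. norm (G n y)) = (\<Sum>n\<in>X. if n = \<lfloor>y + 1/2\<rfloor> then norm (g y) else 0)"
        by (rule sum.cong) (auto simp: Gsum)
      also have "\<dots> \<le> norm (g y)" using that by simp
      finally show "(\<Sum>n\<in>X. norm (G n y)) \<le> norm (g y)" .
    qed (use Gint g in auto)
    finally show ?thesis .
  qed
  have summ: "(\<lambda>n. LINT y|lborel. norm (G n y)) summable_on UNIV"
    by (rule nonneg_bdd_above_summable_on) (use bound in \<open>auto intro!: bdd_aboveI2\<close>)
  have "(LINT y|lborel. g y) = (LINT y|lborel. (\<Sum>\<^sub>\<infinity>n. G n y))"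
    by (simp add: hs)
  also have "\<dots> = (\<Sum>\<^sub>\<infinity>n. LINT y|lborel. G n y)"
    by (rule integral_infsum_swap) (use Gint summ sigma_finite_lborel in auto)
  also have "\<dots> = (\<Sum>\<^sub>\<infinity>n. LINT s|lborel. G n (s + of_int n))"
    by (simp add: lborel_integral_add_right)
  also have "\<dots> = (LINT s|lborel. (\<Sum>\<^sub>\<infinity>n. G n (s + of_int n)))"
    by (rule integral_infsum_swap[symmetric])
      (use Gshift summ sigma_finite_lborel lborel_integral_add_right[of "\<lambda>y. norm (G _ y)"] in auto)
  also have "(\<lambda>s. \<Sum>\<^sub>\<infinity>n. G n (s + of_int n)) = (\<lambda>s. indicator S s *\<^sub>R (\<Sum>\<^sub>\<infinity>n. g (s + of_int n)))"
    by (auto simp: G_def indicator_def)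
  finally show ?thesis by (simp add: set_lebesgue_integral_def S_def)
qed

text \<open>The periodisation \<open>L\<close> of p and the Fourier series \<open>R\<close> with
  coefficients q have the same Fourier coefficients. Both are continuous by uniform convergence,
  from the quadratic decay of p and the summability of q respectively, so they agree at 0.\<close>

theorem poisson_summation:
  fixes p :: "real \<Rightarrow> complex" and q :: "int \<Rightarrow> complex"
  assumes p: "continuous_on UNIV p" "\<And>y. norm (p y) \<le> C / (1 + y\<^sup>2)" "integrable lborel p"
    and q: "\<And>k. q k = (LINT y|lborel. p y * cis (- 2 * pi * of_int k * y))"
    and qs: "(\<lambda>k. norm (q k)) summable_on UNIV"
  shows "(\<Sum>\<^sub>\<infinity>n. p (of_int n)) = (\<Sum>\<^sub>\<infinity>k. q k)"
proof -
  define L where "L s = (\<Sum>\<^sub>\<infinity>n::int. p (s + of_int n))" for s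
  define R where "R s = (\<Sum>\<^sub>\<infinity>k. q k * cis (2 * pi * of_int k * s))" for s
  have C0: "C \<ge> 0" using p(2)[of 0] norm_ge_zero[of "p 0"] by (simp del: norm_ge_zero)
  have pb: "norm (p (s + of_int n)) \<le> 4 * C * (1 + (of_int n)\<^sup>2) powr (- 1)" if s: "s \<in> {-1/2..1/2}" for s and n :: int
  proof -
    have "1 + (of_int n)\<^sup>2 \<le> 4 * (1 + (s + of_int n)\<^sup>2)"
    proof -
      have "4 * (1 + (s + of_int n)\<^sup>2) - (1 + (of_int n)\<^sup>2) = (2 * s + of_int n) ^ 2 * 2 + (of_int n)\<^sup>2 + 3 - 4 * s\<^sup>2"
        by (simp add: power2_eq_square algebra_simps)
      moreover have "s\<^sup>2 \<le> 1/4" using s power2_le_iff_abs_le[of "1/2" s] by (auto simp: power_divide)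
      ultimately show ?thesis
        using zero_le_power2[of "2 * s + of_int n"] zero_le_power2[of "real_of_int n"]
        by linarith
    qed
    then have "C / (1 + (s + of_int n)\<^sup>2) \<le> C / ((1 + (of_int n)\<^sup>2) / 4)"
      using C0 by (intro divide_left_mono mult_pos_pos) (auto intro!: add_pos_nonneg)
    also have "\<dots> = 4 * C * (1 + (of_int n)\<^sup>2) powr (- 1)"
      by (simp add: powr_minus field_simps add_pos_nonneg)
    finally show ?thesis using p(2)[of "s + of_int n"] by linarith
  qed
  have dom: "(\<lambda>n::int. 4 * C * (1 + (of_int n)\<^sup>2) powr (- 1)) summable_on UNIV"
    by (intro summable_on_cmult_right summable_on_int_powr) simp
  have Lc: "continuous_on {-1/2..1/2} L"
    unfolding L_def
  proof (rule uniform_limit_theorem[OF _ Weierstrass_m_test_general[OF pb dom]])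
    show "\<forall>\<^sub>F X in finite_subsets_at_top UNIV. continuous_on {-1/2..1/2} (\<lambda>s. \<Sum>n\<in>X. p (s + of_int n))"
      by (intro always_eventually allI continuous_intros continuous_on_compose2[OF p(1)]) auto
  qed auto
  have Rc: "continuous_on {-1/2..1/2} R"
    unfolding R_def
  proof (rule uniform_limit_theorem[OF _ Weierstrass_m_test_general[OF _ qs]])
    show "\<forall>\<^sub>F X in finite_subsets_at_top UNIV. continuous_on {-1/2..1/2} (\<lambda>s. \<Sum>k\<in>X. q k * cis (2 * pi * of_int k * s))"
      by (intro always_eventually allI continuous_intros)
  qed (auto simp: norm_mult)
  have SI: "set_integrable lborel {-1/2..<1/2} G" if "continuous_on {-1/2..1/2} G" for G :: "real \<Rightarrow> complex"
    by (rule set_integrable_subset[OF borel_integrable_atLeastAtMost'[OF that]]) auto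
  have "L 0 - R 0 = 0"
  proof (rule fourier_coeff_zero_imp_zero[where F = "\<lambda>s. L s - R s"])
    show "continuous_on {-1/2..1/2} (\<lambda>s. L s - R s)"
      by (intro continuous_intros Lc Rc)
    fix l :: int
    have "(LINT s:{-1/2..<1/2}|lborel. (L s - R s) * cis (2 * pi * of_int l * s)) =
        (LINT s:{-1/2..<1/2}|lborel. L s * cis (2 * pi * of_int l * s)) -
        (LINT s:{-1/2..<1/2}|lborel. R s * cis (2 * pi * of_int l * s))"
      unfolding left_diff_distrib
      by (rule set_integral_diff(2)) (intro SI continuous_intros Lc Rc)+
    also have "(LINT s:{-1/2..<1/2}|lborel. L s * cis (2 * pi * of_int l * s)) = q (- l)"
    proof -
      have int: "integrable lborel (\<lambda>y. p y * cis (2 * pi * of_int l * y))"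
        by (rule Bochner_Integration.integrable_bound[OF p(3)])
          (auto simp: norm_mult intro!: borel_measurable_continuous_onI continuous_intros p(1))
      \<comment> \<open>The character has period 1 and can be moved inside the sum, so the product
        is again a periodisation.\<close>
      have "L s * cis (2 * pi * of_int l * s) = (\<Sum>\<^sub>\<infinity>n::int. p (s + of_int n) * cis (2 * pi * of_int l * (s + of_int n)))" for s
        unfolding L_def cis_2pi_int_shift by (rule infsum_cmult_left'[symmetric])
      then show ?thesis
        using integral_unit_interval_periodization[OF int] by (simp add: q mult_ac)
    qed
    also have "(LINT s:{-1/2..<1/2}|lborel. R s * cis (2 * pi * of_int l * s)) = q (- l)"
    proof -
      let ?f = "\<lambda>k s. indicator {-1/2..<1/2} s *\<^sub>R (q k * cis (2 * pi * of_int (k + l) * s))"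
      have fint: "integrable lborel (?f k)" for k
        unfolding set_integrable_def[symmetric] by (intro SI continuous_intros)
      have nf: "(LINT s|lborel. norm (?f k s)) = norm (q k)" for k
        by (simp add: norm_mult)
      have "(LINT s:{-1/2..<1/2}|lborel. R s * cis (2 * pi * of_int l * s)) = (LINT s|lborel. (\<Sum>\<^sub>\<infinity>k. ?f k s))"
        unfolding set_lebesgue_integral_def
      proof (rule Bochner_Integration.integral_cong)
        fix s
        have "R s * cis (2 * pi * of_int l * s) = (\<Sum>\<^sub>\<infinity>k. q k * cis (2 * pi * of_int k * s) * cis (2 * pi * of_int l * s))"
          unfolding R_def by (rule infsum_cmult_left'[symmetric])
        also have "\<dots> = (\<Sum>\<^sub>\<infinity>k. q k * cis (2 * pi * of_int (k + l) * s))"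
          by (simp add: cis_mult mult.assoc algebra_simps)
        finally show "indicator {-1/2..<1/2} s *\<^sub>R (R s * cis (2 * pi * of_int l * s)) = (\<Sum>\<^sub>\<infinity>k. ?f k s)"
          by (auto simp: indicator_def)
      qed simp
      also have "\<dots> = (\<Sum>\<^sub>\<infinity>k. LINT s|lborel. ?f k s)"
        by (rule integral_infsum_swap) (use fint nf qs sigma_finite_lborel in auto)
      also have "\<dots> = (\<Sum>\<^sub>\<infinity>k. if k = - l then q k else 0)"
      proof (rule infsum_cong)
        fix k
        have "(LINT s|lborel. ?f k s) = (LINT s:{-1/2..<1/2}|lborel. q k * cis (2 * pi * of_int (k + l) * s))"
          by (simp only: set_lebesgue_integral_def)
        also have "\<dots> = q k * (if k + l = 0 then 1 else 0)"
          unfolding integral_cis_unit_interval[symmetric] by (rule set_integral_mult_right)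
        finally show "(LINT s|lborel. ?f k s) = (if k = - l then q k else 0)"
          by (auto simp: add_eq_0_iff)
      qed
      also have "\<dots> = (\<Sum>k\<in>{-l}. if k = - l then q k else 0)"
        by (intro infsumI has_sum_finite_neutralI[of "{-l}"]) auto
      finally show ?thesis by simp
    qed
    finally show "(LINT s:{-1/2..<1/2}|lborel. (L s - R s) * cis (2 * pi * of_int l * s)) = 0"
      by simp
  qed
  then show ?thesis by (simp add: L_def R_def)
qed

section \<open>Gaussians\<close>

lemma cis_sum: "cis (sum f A) = (\<Prod>i\<in>A. cis (f i))"
  by (induction A rule: infinite_finite_induct) (auto simp flip: cis_mult)

lemma norm_vec_power2: "(norm (x :: real ^ 'd))\<^sup>2 = (\<Sum>i\<in>UNIV. (x $ i)\<^sup>2)"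
  unfolding power2_norm_eq_inner inner_vec_def by (simp add: power2_eq_square)

text \<open>Rescaling by \<open>c\<close> = sqrt (2 a) turns a y^2 into (c y)^2 / 2 and reduces the
  claim to the characteristic function of the standard normal distribution.\<close>

lemma
  fixes a \<xi> :: real
  assumes a: "a > 0"
  shows integrable_gauss_cis: "integrable lborel (\<lambda>y. complex_of_real (exp (- a * y\<^sup>2)) * cis (\<xi> * y))"
    and integral_gauss_cis: "(LINT y|lborel. complex_of_real (exp (- a * y\<^sup>2)) * cis (\<xi> * y)) =
      of_real (sqrt (pi / a) * exp (- \<xi>\<^sup>2 / (4 * a)))"
proof -
  define c where "c = sqrt (2 * a)"
  have c: "c > 0" "c\<^sup>2 = 2 * a" using a by (auto simp: c_def)
  define f where "f x = std_normal_density x *\<^sub>R cis (\<xi> / c * x)" for x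
  have fc: "f (0 + c * y) = of_real (1 / sqrt (2 * pi)) * (complex_of_real (exp (- a * y\<^sup>2)) * cis (\<xi> * y))" for y
    using c by (simp add: f_def std_normal_density_def power_mult_distrib scaleR_conv_of_real mult.assoc)
  have [measurable]: "(\<lambda>x. cis (\<xi> / c * x)) \<in> borel_measurable borel"
    by (intro borel_measurable_continuous_onI continuous_intros) (use c in auto)
  have fint: "integrable lborel f"
  proof -
    have "integrable lborel std_normal_density"
      by (rule integrable_normal_density) simp
    then show ?thesis
    proof (rule Bochner_Integration.integrable_bound)
      show "f \<in> borel_measurable lborel"
        unfolding f_def by measurable
    qed (simp add: f_def)
  qed
  have "integrable lborel (\<lambda>y. of_real (1 / sqrt (2 * pi)) * (complex_of_real (exp (- a * y\<^sup>2)) * cis (\<xi> * y)))"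
    using lborel_integrable_real_affine[OF fint, of c 0] c unfolding fc by simp
  from integrable_mult_right[OF this, of "of_real (sqrt (2 * pi))"]
  show "integrable lborel (\<lambda>y. complex_of_real (exp (- a * y\<^sup>2)) * cis (\<xi> * y))"
    by (simp only: mult.assoc[symmetric] of_real_mult[symmetric]) simp
  have "(LINT x|lborel. f x) = char std_normal_distribution (\<xi> / c)"
    unfolding char_def f_def
    by (subst integral_density) (auto simp: cis_conv_exp)
  also have "\<dots> = of_real (exp (- \<xi>\<^sup>2 / (4 * a)))"
    using c by (simp add: char_std_normal_distribution power_divide)
  finally have "of_real (exp (- \<xi>\<^sup>2 / (4 * a))) = (LINT x|lborel. f x)" ..
  also have "\<dots> = c *\<^sub>R (LINT y|lborel. f (0 + c * y))"
    using lborel_integral_real_affine[of c f 0] c by simp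
  also have "\<dots> = of_real (c / sqrt (2 * pi)) * (LINT y|lborel. complex_of_real (exp (- a * y\<^sup>2)) * cis (\<xi> * y))"
    unfolding fc by (simp add: scaleR_conv_of_real)
  finally have "of_real (sqrt (2 * pi) / c * exp (- \<xi>\<^sup>2 / (4 * a))) = (LINT y|lborel. complex_of_real (exp (- a * y\<^sup>2)) * cis (\<xi> * y))"
    using c by (simp add: field_simps)
  moreover have "sqrt (2 * pi) / c = sqrt (pi / a)"
    by (simp add: c_def real_sqrt_divide real_sqrt_mult)
  ultimately show "(LINT y|lborel. complex_of_real (exp (- a * y\<^sup>2)) * cis (\<xi> * y)) =
      of_real (sqrt (pi / a) * exp (- \<xi>\<^sup>2 / (4 * a)))" by simp
qed

lemma gauss_cis_eq_prod:
  fixes y \<xi> :: "real ^ 'd"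
  shows "complex_of_real (exp (- a * (norm y)\<^sup>2)) * cis (\<xi> \<bullet> y) =
    (\<Prod>i\<in>UNIV. complex_of_real (exp (- a * (y $ i)\<^sup>2)) * cis (\<xi> $ i * y $ i))"
proof -
  have "exp (- a * (norm y)\<^sup>2) = (\<Prod>i\<in>UNIV. exp (- a * (y $ i)\<^sup>2))"
    by (simp add: norm_vec_power2 sum_distrib_left exp_sum sum_negf flip: sum_negf)
  then show ?thesis
    by (simp add: prod.distrib inner_vec_def cis_sum)
qed

lemma
  fixes \<xi> :: "real ^ 'd" and a :: real
  assumes a: "a > 0"
  shows integrable_gauss_cis_vec: "integrable lborel (\<lambda>y. complex_of_real (exp (- a * (norm y)\<^sup>2)) * cis (\<xi> \<bullet> y))"
    and integral_gauss_cis_vec: "(LINT y|lborel. complex_of_real (exp (- a * (norm y)\<^sup>2)) * cis (\<xi> \<bullet> y)) =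
      of_real (sqrt (pi / a) ^ CARD('d) * exp (- (norm \<xi>)\<^sup>2 / (4 * a)))"
proof -
  show "integrable lborel (\<lambda>y. complex_of_real (exp (- a * (norm y)\<^sup>2)) * cis (\<xi> \<bullet> y))"
    unfolding gauss_cis_eq_prod by (rule integrable_prod_vec) (rule integrable_gauss_cis[OF a])
  have "(LINT y|lborel. complex_of_real (exp (- a * (norm y)\<^sup>2)) * cis (\<xi> \<bullet> y)) =
      (\<Prod>i\<in>UNIV. of_real (sqrt (pi / a) * exp (- (\<xi> $ i)\<^sup>2 / (4 * a))))"
    unfolding gauss_cis_eq_prod
    by (subst integral_prod_vec) (simp_all only: integrable_gauss_cis[OF a] integral_gauss_cis[OF a])
  also have "\<dots> = of_real (sqrt (pi / a) ^ CARD('d) * exp (- (norm \<xi>)\<^sup>2 / (4 * a)))"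
    by (simp add: prod.distrib norm_vec_power2 exp_sum sum_divide_distrib flip: sum_negf of_real_prod)
  finally show "(LINT y|lborel. complex_of_real (exp (- a * (norm y)\<^sup>2)) * cis (\<xi> \<bullet> y)) =
      of_real (sqrt (pi / a) ^ CARD('d) * exp (- (norm \<xi>)\<^sup>2 / (4 * a)))" .
qed

text \<open>From exp (- t) \<le> 1 / (1 + t) and (h y)^2 \<le> 2 x^2 + 2 (x - h y)^2. The result has
  the form of the decay hypothesis of \<open>poisson_summation\<close>.\<close>

lemma gauss_le_inverse_square:
  fixes a h x y :: real
  assumes "a > 0" "h > 0"
  shows "exp (- a * (x - h * y)\<^sup>2) \<le> (1 + 2 * x\<^sup>2 / h\<^sup>2 + 2 / (a * h\<^sup>2)) / (1 + y\<^sup>2)"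
proof -
  define z where "z = (x - h * y)\<^sup>2"
  have z: "z \<ge> 0" by (simp add: z_def)
  have "(h * y)\<^sup>2 \<le> 2 * x\<^sup>2 + 2 * z"
    using zero_le_power2[of "2 * x - h * y"] unfolding z_def by (simp add: power2_eq_square algebra_simps)
  then have "y\<^sup>2 \<le> 2 * x\<^sup>2 / h\<^sup>2 + 2 * z / h\<^sup>2"
    using assms by (simp add: field_simps power_mult_distrib)
  moreover have "0 \<le> a * z * (1 + 2 * x\<^sup>2 / h\<^sup>2)" using assms z by simp
  moreover have "0 \<le> 2 / (a * h\<^sup>2)" using assms by simp
  moreover have "(1 + 2 * x\<^sup>2 / h\<^sup>2 + 2 / (a * h\<^sup>2)) * (1 + a * z) =
      1 + 2 * x\<^sup>2 / h\<^sup>2 + 2 * z / h\<^sup>2 + a * z * (1 + 2 * x\<^sup>2 / h\<^sup>2) + 2 / (a * h\<^sup>2)"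
  proof -
    have "(A + B) * (1 + a * z) = A + B * (a * z) + a * z * A + B" for A B
      by (simp add: algebra_simps)
    moreover have "2 / (a * h\<^sup>2) * (a * z) = 2 * z / h\<^sup>2" using assms by simp
    ultimately show ?thesis by simp
  qed
  ultimately have "1 + y\<^sup>2 \<le> (1 + 2 * x\<^sup>2 / h\<^sup>2 + 2 / (a * h\<^sup>2)) * (1 + a * z)"
    by linarith
  moreover have "1 + a * z > 0" "1 + y\<^sup>2 > 0" using assms z by (auto intro!: add_pos_nonneg)
  ultimately have "1 / (1 + a * z) \<le> (1 + 2 * x\<^sup>2 / h\<^sup>2 + 2 / (a * h\<^sup>2)) / (1 + y\<^sup>2)"
    by (simp add: divide_simps mult.commute)
  moreover have "exp (- a * z) \<le> 1 / (1 + a * z)"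
    using exp_ge_add_one_self[of "a * z"] \<open>1 + a * z > 0\<close> by (simp add: exp_minus field_simps)
  ultimately show ?thesis by (simp add: z_def)
qed

lemma summable_on_int_gauss:
  fixes a h x :: real
  assumes "a > 0" "h > 0"
  shows "(\<lambda>n::int. exp (- a * (x - h * of_int n)\<^sup>2)) summable_on UNIV"
proof (rule summable_on_comparison_test)
  show "(\<lambda>n::int. (1 + 2 * x\<^sup>2 / h\<^sup>2 + 2 / (a * h\<^sup>2)) * (1 + (of_int n)\<^sup>2) powr (- 1)) summable_on UNIV"
    by (intro summable_on_cmult_right summable_on_int_powr) simp
qed (use gauss_le_inverse_square[OF assms] in \<open>auto simp: powr_minus divide_inverse add_pos_nonneg\<close>)

text \<open>The left-hand summands are the values at the integers of \<open>p\<close>, a modulated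
  Gaussian centred at x / h; translating by x / h leaves a centred Gaussian and a phase.\<close>

lemma poisson_gauss:
  fixes u h x \<omega> :: real
  assumes u: "u > 0" and h: "h > 0"
  shows "(\<Sum>\<^sub>\<infinity>n::int. complex_of_real (exp (- (x - h * of_int n)\<^sup>2 / (4 * u))) * cis (\<omega> * (h * of_int n))) =
    of_real (sqrt (4 * pi * u) / h) *
    (\<Sum>\<^sub>\<infinity>k::int. complex_of_real (exp (- u * (\<omega> + 2 * pi / h * of_int k)\<^sup>2)) * cis ((\<omega> + 2 * pi / h * of_int k) * x))"
proof -
  define p where "p y = complex_of_real (exp (- (1 / (4 * u)) * (x - h * y)\<^sup>2)) * cis (\<omega> * (h * y))" for y
  define r where "r k = complex_of_real (exp (- u * (\<omega> + 2 * pi / h * of_int k)\<^sup>2)) * cis ((\<omega> + 2 * pi / h * of_int k) * x)" for k :: int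
  define a where "a = h\<^sup>2 / (4 * u)"
  have a: "a > 0" using u h by (simp add: a_def)
  have pc: "continuous_on UNIV p"
    unfolding p_def by (intro continuous_intros)
  have paff: "p (x / h + z) * cis (\<xi> * (x / h + z)) =
      cis ((\<omega> * h + \<xi>) * x / h) * (complex_of_real (exp (- a * z\<^sup>2)) * cis ((\<omega> * h + \<xi>) * z))" for z \<xi>
  proof -
    have "(1 / (4 * u)) * (x - h * (x / h + z))\<^sup>2 = a * z\<^sup>2"
      using h by (simp add: a_def algebra_simps power_mult_distrib)
    moreover have "\<omega> * (h * (x / h + z)) + \<xi> * (x / h + z) = (\<omega> * h + \<xi>) * x / h + (\<omega> * h + \<xi>) * z"
      using h by (simp add: field_simps)
    then have "cis (\<omega> * (h * (x / h + z))) * cis (\<xi> * (x / h + z)) = cis ((\<omega> * h + \<xi>) * x / h) * cis ((\<omega> * h + \<xi>) * z)"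
      by (simp only: cis_mult)
    ultimately show ?thesis
      unfolding p_def by (simp add: mult_ac)
  qed
  have pint: "integrable lborel p"
  proof -
    have "integrable lborel (\<lambda>z. p (x / h + 1 * z))"
      using integrable_mult_right[OF integrable_gauss_cis[OF a, of "\<omega> * h"], of "cis (\<omega> * h * x / h)"] paff[of _ 0] by simp
    then show ?thesis
      using lborel_integrable_real_affine_iff[of 1 p "x / h"] by simp
  qed
  \<comment> \<open>The k-th coefficient has frequency \<omega> h - 2 \<pi> k, hence the index - k
    on the right; the sum over all k absorbs the sign.\<close>
  have q: "(LINT y|lborel. p y * cis (- 2 * pi * of_int k * y)) = of_real (sqrt (4 * pi * u) / h) * r (- k)" for k :: int
  proof -
    let ?w = "\<omega> * h + (- 2 * pi * of_int k)"
    have w: "?w / h = \<omega> + 2 * pi / h * of_int (- k)" using h by (simp add: field_simps)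
    have "(LINT y|lborel. p y * cis (- 2 * pi * of_int k * y)) =
        (LINT z|lborel. p (x / h + z) * cis (- 2 * pi * of_int k * (x / h + z)))"
      using lborel_integral_real_affine[of 1 "\<lambda>y. p y * cis (- 2 * pi * of_int k * y)" "x / h"] by simp
    also have "\<dots> = cis (?w * x / h) * of_real (sqrt (pi / a) * exp (- ?w\<^sup>2 / (4 * a)))"
      unfolding paff by (simp only: integral_mult_right_zero integral_gauss_cis[OF a])
    also have "?w * x / h = (\<omega> + 2 * pi / h * of_int (- k)) * x"
      unfolding w[symmetric] by simp
    also have "- ?w\<^sup>2 / (4 * a) = - u * (\<omega> + 2 * pi / h * of_int (- k))\<^sup>2"
      unfolding w[symmetric] using u h by (simp add: a_def field_simps)
    also have "sqrt (pi / a) = sqrt (4 * pi * u) / h"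
      using u h by (simp add: a_def real_sqrt_divide real_sqrt_mult)
    finally show ?thesis
      unfolding r_def by (simp only: of_real_mult mult_ac)
  qed
  have rs: "(\<lambda>k. norm (r (- k))) summable_on UNIV"
  proof -
    have "norm (r (- k)) = exp (- u * (\<omega> - 2 * pi / h * of_int k)\<^sup>2)" for k
      by (simp add: r_def norm_mult)
    then show ?thesis
      using summable_on_int_gauss[of u "2 * pi / h" \<omega>] u h by simp
  qed
  have "(\<Sum>\<^sub>\<infinity>n::int. p (of_int n)) = (\<Sum>\<^sub>\<infinity>k. of_real (sqrt (4 * pi * u) / h) * r (- k))"
  proof (rule poisson_summation[OF pc _ pint q[symmetric]])
    show "norm (p y) \<le> (1 + 2 * x\<^sup>2 / h\<^sup>2 + 2 / (1 / (4 * u) * h\<^sup>2)) / (1 + y\<^sup>2)" for y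
      using gauss_le_inverse_square[of "1 / (4 * u)" h x y] u h
      by (simp add: p_def norm_mult)
    show "(\<lambda>k. norm (of_real (sqrt (4 * pi * u) / h) * r (- k))) summable_on UNIV"
      unfolding norm_mult by (intro summable_on_cmult_right rs)
  qed
  also have "\<dots> = of_real (sqrt (4 * pi * u) / h) * (\<Sum>\<^sub>\<infinity>k. r (- k))"
    by (rule infsum_cmult_right')
  also have "(\<Sum>\<^sub>\<infinity>k. r (- k)) = (\<Sum>\<^sub>\<infinity>k. r k)"
    by (rule infsum_reindex_bij_betw) (rule bij_uminus)
  finally show ?thesis
    by (simp add: p_def r_def)
qed

lemma grid_point_add: "grid_point h (j + k) = grid_point h j + grid_point h k"
  and grid_point_diff: "grid_point h (j - k) = grid_point h j - grid_point h k"
  and grid_point_minus: "grid_point h (- k) = - grid_point h k"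
  and grid_point_0: "grid_point h 0 = 0"
  by (simp_all add: grid_point_def vec_eq_iff algebra_simps)

lemma poisson_gauss_vec:
  fixes u h :: real and x \<omega> :: "real ^ 'd"
  assumes u: "u > 0" and h: "h > 0"
  shows "(\<Sum>\<^sub>\<infinity>n. complex_of_real (exp (- (norm (x - grid_point h n))\<^sup>2 / (4 * u))) * cis (\<omega> \<bullet> grid_point h n)) =
    of_real ((sqrt (4 * pi * u) / h) ^ CARD('d)) *
    (\<Sum>\<^sub>\<infinity>k. complex_of_real (exp (- u * (norm (\<omega> + grid_point (2 * pi / h) k))\<^sup>2)) *
      cis ((\<omega> + grid_point (2 * pi / h) k) \<bullet> x))"
proof -
  let ?g = "\<lambda>i n. complex_of_real (exp (- (x $ i - h * of_int n)\<^sup>2 / (4 * u))) * cis (\<omega> $ i * (h * of_int n))"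
  let ?r = "\<lambda>i k. complex_of_real (exp (- u * (\<omega> $ i + 2 * pi / h * of_int k)\<^sup>2)) * cis ((\<omega> $ i + 2 * pi / h * of_int k) * x $ i)"
  have gs: "(\<lambda>n::int. norm (?g i n)) summable_on UNIV" for i
    using summable_on_int_gauss[of "1 / (4 * u)" h "x $ i"] u h by (simp add: norm_mult)
  have rs: "(\<lambda>k::int. norm (?r i k)) summable_on UNIV" for i
  proof -
    have "(\<lambda>k::int. exp (- u * (- \<omega> $ i - 2 * pi / h * of_int k)\<^sup>2)) summable_on UNIV"
      by (rule summable_on_int_gauss) (use u h in auto)
    moreover have "(- \<omega> $ i - 2 * pi / h * of_int k)\<^sup>2 = (\<omega> $ i + 2 * pi / h * of_int k)\<^sup>2" for k
      by (simp add: power2_eq_square algebra_simps)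
    ultimately show ?thesis by (simp add: norm_mult)
  qed
  have "complex_of_real (exp (- (norm (x - grid_point h n))\<^sup>2 / (4 * u))) * cis (\<omega> \<bullet> grid_point h n) =
      (\<Prod>i\<in>UNIV. ?g i (n $ i))" for n
    by (simp add: norm_vec_power2 sum_divide_distrib exp_sum inner_vec_def cis_sum prod.distrib grid_point_def flip: sum_negf)
  moreover have "complex_of_real (exp (- u * (norm (\<omega> + grid_point (2 * pi / h) k))\<^sup>2)) *
      cis ((\<omega> + grid_point (2 * pi / h) k) \<bullet> x) = (\<Prod>i\<in>UNIV. ?r i (k $ i))" for k
    by (simp add: norm_vec_power2 sum_distrib_left exp_sum inner_vec_def cis_sum prod.distrib grid_point_def flip: sum_negf)
  ultimately have "?thesis \<longleftrightarrow> (\<Sum>\<^sub>\<infinity>n. \<Prod>i\<in>UNIV. ?g i (n $ i)) =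
      of_real ((sqrt (4 * pi * u) / h) ^ CARD('d)) * (\<Sum>\<^sub>\<infinity>k. \<Prod>i\<in>UNIV. ?r i (k $ i))"
    by simp
  moreover have "(\<Sum>\<^sub>\<infinity>n. \<Prod>i\<in>UNIV. ?g i (n $ i)) =
      of_real ((sqrt (4 * pi * u) / h) ^ CARD('d)) * (\<Sum>\<^sub>\<infinity>k. \<Prod>i\<in>UNIV. ?r i (k $ i))"
    unfolding infsum_prod_vec[OF gs] infsum_prod_vec[OF rs] poisson_gauss[OF u h]
    by (simp only: prod.distrib prod_constant of_real_power)
  ultimately show ?thesis by simp
qed

section \<open>The Matern kernel\<close>

text \<open>Euler's integral after rescaling u. It makes the mixing weights integrable and, for a =
  1 + |\<xi>|^2, produces the power (1 + |\<xi>|^2)^(-m).\<close>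

lemma
  fixes s a :: real
  assumes s: "s > 0" and a: "a > 0"
  shows integrable_Gamma_scaled: "integrable lborel (\<lambda>u. indicator {0<..} u * (u powr (s - 1) * exp (- a * u)))"
    and integral_Gamma_scaled: "(LINT u|lborel. indicator {0<..} u * (u powr (s - 1) * exp (- a * u))) = Gamma s * a powr (- s)"
proof -
  let ?f = "\<lambda>u. indicator {0<..} u * (u powr (s - 1) * exp (- u)) :: real"
  have "indicator {0..} t * t powr (s - 1) / exp t = ?f t" for t
    by (auto simp: indicator_def exp_minus field_simps)
  with Gamma_conv_nn_integral_real[OF s]
  have nn: "(\<integral>\<^sup>+t. ennreal (?f t) \<partial>lborel) = ennreal (Gamma s)" by (simp only:)
  have f0: "?f u \<ge> 0" for u by (simp add: indicator_def)
  have i1: "integrable lborel ?f"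
    by (rule integrableI_nn_integral_finite[OF _ _ nn]) (use f0 in auto)
  have e1: "(LINT t|lborel. ?f t) = Gamma s"
    using nn f0 s by (subst integral_eq_nn_integral) (auto simp: Gamma_real_nonneg less_imp_le)
  have eq: "?f (0 + a * u) = a powr (s - 1) * (indicator {0<..} u * (u powr (s - 1) * exp (- a * u)))" for u
    using a by (auto simp: indicator_def zero_less_mult_iff powr_mult)
  show "integrable lborel (\<lambda>u. indicator {0<..} u * (u powr (s - 1) * exp (- a * u)))"
    using lborel_integrable_real_affine[OF i1, of a 0] a unfolding eq by simp
  have "Gamma s = a * (a powr (s - 1) * (LINT u|lborel. indicator {0<..} u * (u powr (s - 1) * exp (- a * u))))"
    using lborel_integral_real_affine[of a ?f 0] a unfolding eq e1 by simp
  also have "a * (a powr (s - 1) * (LINT u|lborel. indicator {0<..} u * (u powr (s - 1) * exp (- a * u)))) =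
      a powr s * (LINT u|lborel. indicator {0<..} u * (u powr (s - 1) * exp (- a * u)))"
    using a by (simp add: powr_diff)
  finally show "(LINT u|lborel. indicator {0<..} u * (u powr (s - 1) * exp (- a * u))) = Gamma s * a powr (- s)"
    using a by (simp add: powr_minus field_simps)
qed

text \<open>
  The substitution \<open>u = r / 2 * exp t\<close> in the integral for \<open>K\<^sub>\<nu>\<close> turns the Matern kernel into a mixture
  of the Gaussians \<open>exp (- |x|\<^sup>2 / (4 u))\<close> with the following weight.
\<close>

definition matern_weight :: "real \<Rightarrow> real \<Rightarrow> real" where
  "matern_weight \<nu> u = 2 powr (\<nu> - 1) * (indicator {0<..} u * (u powr (\<nu> - 1) * exp (- 1 * u)))"

lemma matern_weight_nonneg: "matern_weight \<nu> u \<ge> 0"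
  by (simp add: matern_weight_def indicator_def)

lemma measurable_matern_weight [measurable]: "matern_weight \<nu> \<in> borel_measurable borel"
  unfolding matern_weight_def[abs_def] by measurable

text \<open>The factor \<open>- 1 * u\<close> in \<open>matern_weight\<close> makes this literally
  the case a = 1 of \<open>integrable_Gamma_scaled\<close>.\<close>

lemma integrable_matern_weight: "\<nu> > 0 \<Longrightarrow> integrable lborel (matern_weight \<nu>)"
  unfolding matern_weight_def[abs_def] by (intro integrable_mult_right integrable_Gamma_scaled) auto

lemma integrable_matern_weight_exp:
  assumes "\<nu> > 0"
  shows "integrable lborel (\<lambda>u. matern_weight \<nu> u * exp (- r\<^sup>2 / (4 * u)))"
proof (rule Bochner_Integration.integrable_bound[OF integrable_matern_weight[OF assms]])
  have "norm (matern_weight \<nu> u * exp (- r\<^sup>2 / (4 * u))) \<le> norm (matern_weight \<nu> u)" for u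
  proof (cases "u > 0")
    case True
    then have "exp (- r\<^sup>2 / (4 * u)) \<le> 1" by simp
    then show ?thesis
      using matern_weight_nonneg[of \<nu> u] by (auto simp: abs_mult intro!: mult_left_le)
  qed (simp add: matern_weight_def)
  then show "AE u in lborel. norm (matern_weight \<nu> u * exp (- r\<^sup>2 / (4 * u))) \<le> norm (matern_weight \<nu> u)"
    by simp
qed measurable

text \<open>Under u = r / 2 exp t one has du = u dt, and u + r^2 / (4 u) becomes r cosh t. This
  yields an integral over the whole line with exp (\<nu> t) in place of cosh (\<nu> t); passing to
  the even part gives twice the half-line integral that defines \<open>macdonald_K\<close>.\<close>

lemma matern_profile_eq_integral:
  assumes \<nu>: "\<nu> > 0" and r: "r > 0"
  shows "matern_profile \<nu> r = (LINT u|lborel. matern_weight \<nu> u * exp (- r\<^sup>2 / (4 * u)))"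
proof -
  define g where "g u = 2 powr (\<nu> - 1) * (u powr (\<nu> - 1) * exp (- u - r\<^sup>2 / (4 * u)))" for u
  define w where "w t = exp (- r * cosh t) * exp (\<nu> * t)" for t :: real
  have gw: "indicator {0<..} u *\<^sub>R g u = matern_weight \<nu> u * exp (- r\<^sup>2 / (4 * u))" for u
    by (simp add: g_def matern_weight_def indicator_def flip: exp_add)
  have gint: "set_integrable lborel {0<..} g"
    unfolding set_integrable_def gw by (rule integrable_matern_weight_exp[OF \<nu>])
  \<comment> \<open>The change of variables theorem works with the completed Lebesgue measure and
    the gauge integral, so integrability is moved there from \<open>lborel\<close> and later
    back.\<close>
  have gabs: "g absolutely_integrable_on {0<..}"
    using gint unfolding set_integrable_def
    by (subst integrable_completion) (auto dest: borel_measurable_integrable)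
  have img: "range (\<lambda>t. r / 2 * exp t) = {0<..}"
  proof -
    have "u \<in> range (\<lambda>t. r / 2 * exp t)" if "u > 0" for u
      using that r by (intro image_eqI[of _ _ "ln (2 * u / r)"]) auto
    then show ?thesis using r by auto
  qed
  have "(\<lambda>t. \<bar>r / 2 * exp t\<bar> * g (r / 2 * exp t)) absolutely_integrable_on UNIV \<and>
      integral UNIV (\<lambda>t. \<bar>r / 2 * exp t\<bar> * g (r / 2 * exp t)) = integral {0<..} g"
  proof (subst has_absolute_integral_change_of_variables_1'[of UNIV "\<lambda>t. r / 2 * exp t" "\<lambda>t. r / 2 * exp t" g])
    show "g absolutely_integrable_on range (\<lambda>t. r / 2 * exp t) \<and> integral (range (\<lambda>t. r / 2 * exp t)) g = integral {0<..} g"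
      unfolding img using gabs by simp
  qed (use r in \<open>auto simp: inj_on_def intro!: derivative_eq_intros\<close>)
  moreover have "\<bar>r / 2 * exp t\<bar> * g (r / 2 * exp t) = r powr \<nu> / 2 * w t" for t
  proof -
    let ?u = "r / 2 * exp t"
    have u: "?u > 0" using r by simp
    have "?u * ?u powr (\<nu> - 1) = ?u powr \<nu>"
      using u r by (simp add: powr_diff)
    also have "\<dots> = r powr \<nu> / 2 powr \<nu> * exp (\<nu> * t)"
      using r by (simp add: powr_mult powr_divide) (simp add: powr_def)
    finally have 1: "?u * ?u powr (\<nu> - 1) = r powr \<nu> / 2 powr \<nu> * exp (\<nu> * t)" .
    have 2: "- ?u - r\<^sup>2 / (4 * ?u) = - r * cosh t"
      using r by (simp add: cosh_def exp_minus field_simps power2_eq_square)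
    have "\<bar>?u\<bar> * g ?u = 2 powr (\<nu> - 1) * (?u * ?u powr (\<nu> - 1)) * exp (- ?u - r\<^sup>2 / (4 * ?u))"
      unfolding g_def abs_of_pos[OF u] by (simp only: mult_ac)
    also have "\<dots> = r powr \<nu> / 2 * w t"
      unfolding 1 2 w_def by (simp add: powr_diff)
    finally show ?thesis .
  qed
  ultimately have wc: "(\<lambda>t. r powr \<nu> / 2 * w t) absolutely_integrable_on UNIV"
    and wi: "integral UNIV (\<lambda>t. r powr \<nu> / 2 * w t) = integral {0<..} g"
    by auto
  have wm[measurable]: "w \<in> borel_measurable borel"
    unfolding w_def by (intro borel_measurable_continuous_onI continuous_intros)
  have wint': "integrable lborel (\<lambda>t. r powr \<nu> / 2 * w t)"
    using wc by (simp add: set_integrable_def integrable_completion)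
  have wint: "integrable lborel w"
    using integrable_mult_right[OF wint', of "2 / r powr \<nu>"] r by simp
  have "integral UNIV (\<lambda>t. r powr \<nu> / 2 * w t) = (LINT t|lborel. r powr \<nu> / 2 * w t)"
    by (rule integral_lborel[OF wint'])
  moreover have "integral {0<..} g = (LINT u|lborel. matern_weight \<nu> u * exp (- r\<^sup>2 / (4 * u)))"
    using set_borel_integral_eq_integral(2)[OF gint] unfolding set_lebesgue_integral_def gw by simp
  ultimately have main: "r powr \<nu> / 2 * (LINT t|lborel. w t) = (LINT u|lborel. matern_weight \<nu> u * exp (- r\<^sup>2 / (4 * u)))"
    using wi r by simp
  define c where "c t = exp (- r * cosh t) * cosh (\<nu> * t)" for t :: real
  \<comment> \<open>cosh averages exp over t and - t, so \<open>c\<close> is the even part of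
    \<open>w\<close> and has the same total integral.\<close>
  have cw: "c t = (w (0 + -1 * t) + w t) / 2" for t
    by (simp add: c_def w_def cosh_def field_simps)
  have wint2: "integrable lborel (\<lambda>t. w (0 + -1 * t))"
    by (rule lborel_integrable_real_affine[OF wint]) simp
  have cint: "integrable lborel c"
    unfolding cw[abs_def] using wint wint2 by simp
  have "(LINT t|lborel. c t) = ((LINT t|lborel. w (0 + -1 * t)) + (LINT t|lborel. w t)) / 2"
    unfolding cw using wint wint2 by simp
  also have "(LINT t|lborel. w (0 + -1 * t)) = (LINT t|lborel. w t)"
    using lborel_integral_real_affine[of "-1" w 0] by simp
  finally have ctot: "(LINT t|lborel. c t) = (LINT t|lborel. w t)" by simp
  have i0: "integrable lborel (\<lambda>t. indicator A t * c t)" if "A \<in> sets borel" for A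
    using integrable_mult_indicator[OF _ cint, of A] that by simp
  have "(LINT t|lborel. c t) = (LINT t|lborel. indicator {0..} t * c t + indicator {..<0} t * c t)"
    by (rule Bochner_Integration.integral_cong) (auto simp: indicator_def)
  also have "\<dots> = (LINT t|lborel. indicator {0..} t * c t) + (LINT t|lborel. indicator {..<0} t * c t)"
    by (rule Bochner_Integration.integral_add) (auto intro!: i0)
  also have "(LINT t|lborel. indicator {..<0} t * c t) = (LINT t|lborel. indicator {0<..} t * c t)"
  proof -
    have "(LINT t|lborel. indicator {..<0} t * c t) = (LINT t|lborel. indicator {..<0} (0 + -1 * t) * c (0 + -1 * t))"
      using lborel_integral_real_affine[of "-1" "\<lambda>t. indicator {..<0} t * c t" 0] by simp
    also have "\<dots> = (LINT t|lborel. indicator {0<..} t * c t)"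
      by (rule Bochner_Integration.integral_cong) (auto simp: indicator_def c_def)
    finally show ?thesis .
  qed
  also have "\<dots> = (LINT t|lborel. indicator {0..} t * c t)"
  proof (rule integral_cong_AE)
    show "AE t in lborel. indicat_real {0<..} t * c t = indicat_real {0..} t * c t"
      using AE_lborel_singleton[of "0 :: real"] by eventually_elim (auto simp: indicator_def)
  qed (use i0[of "{0<..}"] i0[of "{0..}"] in \<open>auto dest: borel_measurable_integrable\<close>)
  finally have "(LINT t|lborel. w t) = 2 * macdonald_K \<nu> r"
    unfolding ctot by (simp add: macdonald_K_def set_lebesgue_integral_def c_def)
  with main show ?thesis
    by (simp add: matern_profile_def)
qed

text \<open>At 0 the kernel is defined as a limit; dominated convergence, with the weight itself as
  majorant, shows that the mixture is right-continuous there.\<close>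

lemma matern_eq_integral:
  fixes x :: "real ^ 'd"
  assumes m: "real m > real CARD('d) / 2"
  shows "matern m x = (LINT u|lborel. matern_weight (real m - real CARD('d) / 2) u * exp (- (norm x)\<^sup>2 / (4 * u)))"
proof -
  define \<nu> where "\<nu> = real m - real CARD('d) / 2"
  have \<nu>: "\<nu> > 0" using m by (simp add: \<nu>_def)
  define K where "K r = (LINT u|lborel. matern_weight \<nu> u * exp (- r\<^sup>2 / (4 * u)))" for r
  have "(K \<longlongrightarrow> K 0) (at_right 0)"
    unfolding tendsto_at_iff_sequentially o_def
  proof (intro allI impI)
    fix X :: "nat \<Rightarrow> real" assume X: "\<forall>i. X i \<in> {0<..} - {0}" "X \<longlonglongrightarrow> 0"
    show "(\<lambda>n. K (X n)) \<longlonglongrightarrow> K 0"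
      unfolding K_def
    proof (rule integral_dominated_convergence[where w = "matern_weight \<nu>"])
      show "integrable lborel (matern_weight \<nu>)" by (rule integrable_matern_weight[OF \<nu>])
      show "AE u in lborel. (\<lambda>n. matern_weight \<nu> u * exp (- (X n)\<^sup>2 / (4 * u))) \<longlonglongrightarrow> matern_weight \<nu> u * exp (- 0\<^sup>2 / (4 * u))"
      proof (rule AE_I2)
        fix u :: real
        show "(\<lambda>n. matern_weight \<nu> u * exp (- (X n)\<^sup>2 / (4 * u))) \<longlonglongrightarrow> matern_weight \<nu> u * exp (- 0\<^sup>2 / (4 * u))"
        proof (cases "u > 0")
          case True
          then show ?thesis by (intro tendsto_intros X(2)) auto
        qed (simp add: matern_weight_def)
      qed
      show "AE u in lborel. norm (matern_weight \<nu> u * exp (- (X n)\<^sup>2 / (4 * u))) \<le> matern_weight \<nu> u" for n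
      proof (rule AE_I2)
        fix u :: real
        show "norm (matern_weight \<nu> u * exp (- (X n)\<^sup>2 / (4 * u))) \<le> matern_weight \<nu> u"
        proof (cases "u > 0")
          case True
          then show ?thesis
            using matern_weight_nonneg[of \<nu> u] by (auto simp: abs_mult intro!: mult_left_le)
        qed (simp add: matern_weight_def)
      qed
    qed measurable
  qed
  then have "(matern_profile \<nu> \<longlongrightarrow> K 0) (at_right 0)"
    by (rule Lim_transform_eventually)
      (auto simp: eventually_at_right_field K_def matern_profile_eq_integral[OF \<nu>] intro!: exI[of _ 1])
  then have "Lim (at_right 0) (matern_profile \<nu>) = K 0"
    by (intro tendsto_Lim) auto
  then show ?thesis
    using matern_profile_eq_integral[OF \<nu>, of "norm x"]
    by (auto simp: matern_def K_def Let_def simp flip: \<nu>_def)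
qed

lemma measurable_matern:
  assumes "real m > real CARD('d) / 2"
  shows "(matern m :: real ^ 'd \<Rightarrow> real) \<in> borel_measurable borel"
proof -
  interpret sigma_finite_measure "lborel :: real measure" by (rule sigma_finite_lborel)
  have "(\<lambda>x :: real ^ 'd. LINT u|lborel. matern_weight (real m - real CARD('d) / 2) u * exp (- (norm x)\<^sup>2 / (4 * u))) \<in> borel_measurable borel"
    by measurable
  then show ?thesis
    by (simp add: matern_eq_integral[OF assms, abs_def])
qed

lemma matern_nonneg:
  fixes x :: "real ^ 'd"
  assumes "real m > real CARD('d) / 2"
  shows "matern m x \<ge> 0"
  unfolding matern_eq_integral[OF assms] by (intro Bochner_Integration.integral_nonneg mult_nonneg_nonneg matern_weight_nonneg) auto

text \<open>
  By the inequality of arithmetic and geometric means, \<open>u / 2 + r\<^sup>2 / (4 u) \<ge> r / 2\<close>.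
\<close>

lemma matern_exp_decay:
  assumes m: "real m > real CARD('d) / 2"
  obtains C where "\<And>x :: real ^ 'd. matern m x \<le> C * exp (- norm x / 2)"
proof
  define \<nu> where "\<nu> = real m - real CARD('d) / 2"
  have \<nu>: "\<nu> > 0" using m by (simp add: \<nu>_def)
  \<comment> \<open>Half of the factor exp (- u) is kept for integrability, the other half is spent
    on the decay in x.\<close>
  let ?W = "\<lambda>u. 2 powr (\<nu> - 1) * (indicator {0<..} u * (u powr (\<nu> - 1) * exp (- (1/2) * u))) :: real"
  fix x :: "real ^ 'd"
  have "matern m x \<le> (LINT u|lborel. ?W u * exp (- norm x / 2))"
    unfolding matern_eq_integral[OF m] \<nu>_def[symmetric]
  proof (rule integral_mono)
    show "integrable lborel (\<lambda>u. matern_weight \<nu> u * exp (- (norm x)\<^sup>2 / (4 * u)))"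
      by (rule integrable_matern_weight_exp[OF \<nu>])
    show "integrable lborel (\<lambda>u. ?W u * exp (- norm x / 2))"
      by (intro integrable_mult_left integrable_mult_right integrable_Gamma_scaled \<nu>) simp
    fix u :: real
    show "matern_weight \<nu> u * exp (- (norm x)\<^sup>2 / (4 * u)) \<le> ?W u * exp (- norm x / 2)"
    proof (cases "u > 0")
      case True
      \<comment> \<open>Multiplying the wanted inequality by 4 u gives 2 u^2 + |x|^2 \<ge> 2 u
        |x|.\<close>
      have "0 \<le> u\<^sup>2 + (u - norm x)\<^sup>2" by simp
      then have "norm x / 2 \<le> u / 2 + (norm x)\<^sup>2 / (4 * u)"
        using True by (simp add: field_simps power2_eq_square)
      then have "exp (- u) * exp (- (norm x)\<^sup>2 / (4 * u)) \<le> exp (- (1/2) * u) * exp (- norm x / 2)"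
        unfolding exp_add[symmetric] by simp
      from mult_left_mono[OF this, of "2 powr (\<nu> - 1) * u powr (\<nu> - 1)"] True show ?thesis
        by (simp add: matern_weight_def mult_ac)
    qed (simp add: matern_weight_def)
  qed
  also have "\<dots> = (LINT u|lborel. ?W u) * exp (- norm x / 2)"
    by simp
  finally show "matern m x \<le> (LINT u|lborel. ?W u) * exp (- norm x / 2)" .
qed

section \<open>Decay and summability over the grid\<close>

definition l1_length :: "int ^ 'd \<Rightarrow> real" where
  "l1_length k = (\<Sum>i\<in>UNIV. \<bar>of_int (k $ i)\<bar>)"

lemma l1_length_triangle: "l1_length k \<le> l1_length j + l1_length (k - j)"
  unfolding l1_length_def sum.distrib[symmetric] by (intro sum_mono) auto

text \<open>This is the reason for measuring indices in the l1 norm: its exponentials factor over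
  the coordinates into geometric series.\<close>

lemma summable_exp_l1_length:
  assumes "\<delta> > 0"
  shows "(\<lambda>k :: int ^ 'd. exp (- \<delta> * l1_length k)) summable_on UNIV"
proof -
  have "summable (\<lambda>n. exp (- \<delta>) ^ n)"
    by (rule summable_geometric) (use assms in auto)
  then have "summable (\<lambda>n. exp (- \<delta> * real n))"
    by (simp add: exp_of_nat_mult[symmetric] mult.commute)
  then have "(\<lambda>n::int. exp (- \<delta> * \<bar>of_int n\<bar>)) summable_on UNIV"
    by (intro summable_on_int_nonneg) auto
  then have "(\<lambda>n::int. norm (complex_of_real (exp (- \<delta> * \<bar>of_int n\<bar>)))) summable_on UNIV"
    by simp
  from summable_prod_vec[of "\<lambda>_ n. complex_of_real (exp (- \<delta> * \<bar>of_int n\<bar>))", OF this]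
  have "(\<lambda>k :: int ^ 'd. norm (\<Prod>i\<in>UNIV. complex_of_real (exp (- \<delta> * \<bar>of_int (k $ i)\<bar>)))) summable_on UNIV" .
  moreover have "norm (\<Prod>i\<in>UNIV. complex_of_real (exp (- \<delta> * \<bar>of_int (k $ i)\<bar>))) = exp (- \<delta> * l1_length k)" for k :: "int ^ 'd"
    by (simp add: l1_length_def sum_distrib_left exp_sum flip: prod_norm sum_negf)
  ultimately show ?thesis by simp
qed

lemma l1_length_le_norm_grid_point:
  fixes k :: "int ^ 'd"
  assumes "h > 0"
  shows "h / real CARD('d) * l1_length k \<le> norm (grid_point h k)"
proof -
  have "h * l1_length k = (\<Sum>i\<in>UNIV. \<bar>grid_point h k $ i\<bar>)"
    using assms by (simp add: l1_length_def grid_point_def sum_distrib_left abs_mult)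
  also have "\<dots> \<le> (\<Sum>i\<in>(UNIV::'d set). norm (grid_point h k))"
    by (intro sum_mono component_le_norm_cart)
  finally show ?thesis by (simp add: field_simps)
qed

lemma matern_grid_decay:
  assumes m: "real m > real CARD('d) / 2" and h: "h > 0"
  obtains C \<delta> where "C \<ge> 0" "\<delta> > 0"
    "\<And>(x :: real ^ 'd) k. matern m (x - grid_point h k) \<le> C * exp (norm x / 2) * exp (- \<delta> * l1_length k)"
proof -
  obtain C where C: "\<And>x :: real ^ 'd. matern m x \<le> C * exp (- norm x / 2)"
    using matern_exp_decay[OF m] by blast
  have C0: "C \<ge> 0" using order_trans[OF matern_nonneg[OF m] C[of 0]] by simp
  show thesis
  proof
    \<comment> \<open>The rate is 1/2, from the decay of the kernel, times h / d, from comparing the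
      Euclidean norm of a grid point with the l1 length of its index.\<close>
    show "C \<ge> 0" "h / (2 * real CARD('d)) > 0" using C0 h by auto
    fix x :: "real ^ 'd" and k :: "int ^ 'd"
    have "norm (grid_point h k) \<le> norm x + norm (x - grid_point h k)"
      using norm_triangle_ineq4[of x "x - grid_point h k"] by simp
    then have "- norm (x - grid_point h k) / 2 \<le> norm x / 2 + - (h / (2 * real CARD('d))) * l1_length k"
      using l1_length_le_norm_grid_point[OF h, of k] by simp
    then have "exp (- norm (x - grid_point h k) / 2) \<le> exp (norm x / 2) * exp (- (h / (2 * real CARD('d))) * l1_length k)"
      unfolding exp_add[symmetric] by simp
    from mult_left_mono[OF this C0] C[of "x - grid_point h k"]
    show "matern m (x - grid_point h k) \<le> C * exp (norm x / 2) * exp (- (h / (2 * real CARD('d))) * l1_length k)"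
      by (simp add: mult.assoc)
  qed
qed

lemma summable_matern_grid:
  fixes x :: "real ^ 'd"
  assumes m: "real m > real CARD('d) / 2" and h: "h > 0"
  shows "(\<lambda>k. matern m (x - grid_point h k)) summable_on UNIV"
proof -
  obtain C \<delta> where C: "C \<ge> 0" "\<delta> > 0"
    "\<And>(x :: real ^ 'd) k. matern m (x - grid_point h k) \<le> C * exp (norm x / 2) * exp (- \<delta> * l1_length k)"
    using matern_grid_decay[OF m h] by blast
  show ?thesis
    by (rule summable_on_comparison_test[OF summable_on_cmult_right[OF summable_exp_l1_length[OF C(2)]] C(3) matern_nonneg[OF m]])
qed

lemma norm_grid_point: "norm (grid_point \<kappa> k) = \<bar>\<kappa>\<bar> * norm (grid_point 1 k)"
proof -
  have "grid_point \<kappa> k = \<kappa> *\<^sub>R grid_point 1 k"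
    by (simp add: grid_point_def vec_eq_iff)
  then show ?thesis by simp
qed

text \<open>Splitting N^m, with N = 1 + |k|^2, into d factors N^(m/d) and using N \<ge> 1 + k_i^2 in
  the i-th one bounds the terms by products of one-dimensional ones. These are summable since m / d
  > 1/2, which is the hypothesis on m.\<close>

lemma summable_inverse_power_grid:
  assumes m: "real m > real CARD('d) / 2"
  shows "(\<lambda>k :: int ^ 'd. 1 / (1 + (norm (grid_point 1 k))\<^sup>2) ^ m) summable_on UNIV"
proof -
  define a where "a = real m / real CARD('d)"
  have a: "a > 1/2" using m by (simp add: a_def field_simps)
  have "(\<lambda>n::int. norm (complex_of_real ((1 + (of_int n)\<^sup>2) powr (- a)))) summable_on UNIV"
    using summable_on_int_powr[OF a] by simp
  from summable_prod_vec[of "\<lambda>_ n. complex_of_real ((1 + (of_int n)\<^sup>2) powr (- a))", OF this]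
  have S: "(\<lambda>k :: int ^ 'd. \<Prod>i\<in>UNIV. (1 + (of_int (k $ i))\<^sup>2) powr (- a)) summable_on UNIV"
    by (simp flip: prod_norm)
  show ?thesis
  proof (rule summable_on_comparison_test[OF S])
    fix k :: "int ^ 'd"
    let ?N = "1 + (norm (grid_point 1 k))\<^sup>2"
    have N: "?N > 0" by (auto intro!: add_pos_nonneg)
    have "(\<Prod>i\<in>UNIV. (1 + (of_int (k $ i))\<^sup>2) powr a) \<le> (\<Prod>i\<in>(UNIV :: 'd set). ?N powr a)"
    proof (rule prod_mono, intro conjI powr_mono2)
      fix i :: 'd
      show "1 + (real_of_int (k $ i))\<^sup>2 \<le> ?N"
        using power_mono[OF component_le_norm_cart[of "grid_point 1 k" i], of 2] by (simp add: grid_point_def)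
    qed (use a in auto)
    also have "\<dots> = ?N powr (a * real CARD('d))"
      using N by (simp add: powr_powr flip: powr_realpow)
    also have "\<dots> = ?N ^ m"
      using N by (simp add: a_def powr_realpow)
    finally have "(\<Prod>i\<in>UNIV. (1 + (of_int (k $ i))\<^sup>2) powr a) \<le> ?N ^ m" .
    moreover have "(\<Prod>i\<in>UNIV. (1 + (real_of_int (k $ i))\<^sup>2) powr a) > 0"
      by (intro prod_pos) (auto intro: add_pos_nonneg simp: add_nonneg_eq_0_iff)
    ultimately have "1 / ?N ^ m \<le> 1 / (\<Prod>i\<in>UNIV. (1 + (of_int (k $ i))\<^sup>2) powr a)"
      by (intro divide_left_mono) (auto intro!: mult_pos_pos zero_less_power N)
    then show "1 / ?N ^ m \<le> (\<Prod>i\<in>UNIV. (1 + (of_int (k $ i))\<^sup>2) powr (- a))"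
      by (simp add: powr_minus prod_inversef inverse_eq_divide prod_dividef)
  qed auto
qed

lemma summable_inverse_power_grid_shift:
  fixes \<omega> :: "real ^ 'd"
  assumes m: "real m > real CARD('d) / 2" and \<kappa>: "\<kappa> > 0"
  shows "(\<lambda>k. 1 / (1 + (norm (\<omega> + grid_point \<kappa> k))\<^sup>2) ^ m) summable_on UNIV"
proof -
  \<comment> \<open>Chosen to give 1 + |k|^2 \<le> C (1 + |\<omega> + \<kappa> k|^2). It grows with
    |\<omega>| and so yields summability only; the uniform bound is
    \<open>alias_tail_le\<close>.\<close>
  define C where "C = 1 + 2 * (1 + (norm \<omega>)\<^sup>2) / \<kappa>\<^sup>2"
  have C: "C > 0" unfolding C_def using \<kappa> by (auto intro!: add_pos_nonneg)
  show ?thesis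
  proof (rule summable_on_comparison_test[OF summable_on_cmult_right[OF summable_inverse_power_grid[OF m], of "C ^ m"]])
    fix k :: "int ^ 'd"
    let ?N = "1 + (norm (grid_point 1 k))\<^sup>2" and ?M = "1 + (norm (\<omega> + grid_point \<kappa> k))\<^sup>2"
    have pos: "?N > 0" "?M > 0" by (auto intro!: add_pos_nonneg)
    have "norm (grid_point \<kappa> k) \<le> norm (\<omega> + grid_point \<kappa> k) + norm \<omega>"
      using norm_triangle_ineq4[of "\<omega> + grid_point \<kappa> k" \<omega>] by simp
    then have "(norm (grid_point \<kappa> k))\<^sup>2 \<le> (norm (\<omega> + grid_point \<kappa> k) + norm \<omega>)\<^sup>2"
      by (intro power_mono) auto
    also have "\<dots> \<le> 2 * (norm (\<omega> + grid_point \<kappa> k))\<^sup>2 + 2 * (norm \<omega>)\<^sup>2"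
      using zero_le_power2[of "norm (\<omega> + grid_point \<kappa> k) - norm \<omega>"] by (simp add: power2_eq_square algebra_simps)
    finally have "(norm (grid_point 1 k))\<^sup>2 \<le> (2 * (norm (\<omega> + grid_point \<kappa> k))\<^sup>2 + 2 * (norm \<omega>)\<^sup>2) / \<kappa>\<^sup>2"
      using \<kappa> by (subst (asm) norm_grid_point) (simp add: power_mult_distrib field_simps)
    moreover have "C * ?M = 1 + (norm (\<omega> + grid_point \<kappa> k))\<^sup>2 + 2 / \<kappa>\<^sup>2 + (2 * (norm (\<omega> + grid_point \<kappa> k))\<^sup>2 + 2 * (norm \<omega>)\<^sup>2) / \<kappa>\<^sup>2
        + 2 * (norm \<omega>)\<^sup>2 * (norm (\<omega> + grid_point \<kappa> k))\<^sup>2 / \<kappa>\<^sup>2"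
      by (simp add: C_def algebra_simps add_divide_distrib)
    moreover have "0 \<le> 2 / \<kappa>\<^sup>2" "0 \<le> 2 * (norm \<omega>)\<^sup>2 * (norm (\<omega> + grid_point \<kappa> k))\<^sup>2 / \<kappa>\<^sup>2" by auto
    ultimately have "?N \<le> C * ?M"
      using zero_le_power2[of "norm (\<omega> + grid_point \<kappa> k)"] by linarith
    then have "?N ^ m \<le> C ^ m * ?M ^ m"
      unfolding power_mult_distrib[symmetric] by (intro power_mono) (use pos in auto)
    then show "1 / ?M ^ m \<le> C ^ m * (1 / ?N ^ m)"
      using pos by (simp add: field_simps zero_less_power)
  qed auto
qed

text \<open>The identity \<open>poisson_gauss_vec\<close> is integrated in u against the mixing
  weight. Its prefactor sqrt (4 \<pi> u)^d contributes u^(d/2), which lifts the exponent \<nu> - 1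
  to m - 1, and the Gamma integral then gives \<Gamma>(m) (1 + |\<omega>_k|^2)^(-m). The exchange
  with the sum rests on the decay of the kernel on the left and on m > d / 2 on the right.\<close>

theorem poisson_matern:
  fixes h :: real and x \<omega> :: "real ^ 'd"
  assumes m: "real m > real CARD('d) / 2" and h: "h > 0"
  defines "A \<equiv> 2 powr (real m - real CARD('d) / 2 - 1) * (sqrt (4 * pi) / h) ^ CARD('d) * Gamma (real m)"
  shows "(\<Sum>\<^sub>\<infinity>n. complex_of_real (matern m (x - grid_point h n)) * cis (\<omega> \<bullet> grid_point h n)) =
    of_real A * (\<Sum>\<^sub>\<infinity>k. of_real (1 / (1 + (norm (\<omega> + grid_point (2 * pi / h) k))\<^sup>2) ^ m) *
      cis ((\<omega> + grid_point (2 * pi / h) k) \<bullet> x))"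
proof -
  define \<nu> where "\<nu> = real m - real CARD('d) / 2"
  have \<nu>: "\<nu> > 0" using m by (simp add: \<nu>_def)
  have m0: "real m > 0" using m by (rule le_less_trans[rotated]) simp
  let ?W = "matern_weight \<nu>"
  let ?\<omega> = "\<lambda>k. \<omega> + grid_point (2 * pi / h) k"
  define A' where "A' = 2 powr (\<nu> - 1) * (sqrt (4 * pi) / h) ^ CARD('d)"
  define E where "E n u = complex_of_real (?W u * exp (- (norm (x - grid_point h n))\<^sup>2 / (4 * u))) * cis (\<omega> \<bullet> grid_point h n)" for n u
  define F where "F k u = complex_of_real (A' * (indicator {0<..} u * (u powr (real m - 1) * exp (- (1 + (norm (?\<omega> k))\<^sup>2) * u)))) * cis (?\<omega> k \<bullet> x)" for k u
  have E_int: "integrable lborel (E n)" for n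
    unfolding E_def by (intro integrable_mult_left integrable_of_real integrable_matern_weight_exp[OF \<nu>])
  have E_norm: "(LINT u|lborel. norm (E n u)) = matern m (x - grid_point h n)" for n
    unfolding matern_eq_integral[OF m] \<nu>_def[symmetric] E_def using matern_weight_nonneg[of \<nu>] by (simp add: norm_mult)
  have E_val: "(LINT u|lborel. E n u) = complex_of_real (matern m (x - grid_point h n)) * cis (\<omega> \<bullet> grid_point h n)" for n
    unfolding matern_eq_integral[OF m] \<nu>_def[symmetric] E_def
    by (simp only: integral_mult_left_zero integral_complex_of_real)
  have pos: "1 + (norm (?\<omega> k))\<^sup>2 > 0" for k by (auto intro!: add_pos_nonneg)
  have A'0: "A' \<ge> 0" using h by (simp add: A'_def)
  have F_int: "integrable lborel (F k)" for k
    unfolding F_def by (intro integrable_mult_left integrable_of_real integrable_mult_right integrable_Gamma_scaled m0 pos)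
  have real_int: "(LINT u|lborel. A' * (indicator {0<..} u * (u powr (real m - 1) * exp (- (1 + (norm (?\<omega> k))\<^sup>2) * u)))) =
      A * (1 / (1 + (norm (?\<omega> k))\<^sup>2) ^ m)" for k
  proof -
    have "(1 + (norm (?\<omega> k))\<^sup>2) powr (- real m) = 1 / (1 + (norm (?\<omega> k))\<^sup>2) ^ m"
      using pos[of k] by (simp only: powr_minus powr_realpow inverse_eq_divide)
    moreover have "A = A' * Gamma (real m)"
      by (simp only: A_def A'_def \<nu>_def)
    ultimately show ?thesis
      by (simp only: integral_mult_right_zero integral_Gamma_scaled[OF m0 pos] mult.assoc)
  qed
  have F_norm: "(LINT u|lborel. norm (F k u)) = A * (1 / (1 + (norm (?\<omega> k))\<^sup>2) ^ m)" for k
  proof -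
    have "norm (F k u) = A' * (indicator {0<..} u * (u powr (real m - 1) * exp (- (1 + (norm (?\<omega> k))\<^sup>2) * u)))" for u
      using A'0 by (simp only: F_def norm_mult norm_cis norm_of_real) (simp add: abs_mult)
    then show ?thesis by (simp only: real_int)
  qed
  have F_val: "(LINT u|lborel. F k u) = of_real (A * (1 / (1 + (norm (?\<omega> k))\<^sup>2) ^ m)) * cis (?\<omega> k \<bullet> x)" for k
    unfolding F_def by (simp only: integral_mult_left_zero integral_complex_of_real real_int)
  \<comment> \<open>Poisson summation for the single Gaussian with parameter u; for u \<le> 0 the
    indicators in both densities make all terms vanish.\<close>
  have EF: "(\<Sum>\<^sub>\<infinity>n. E n u) = (\<Sum>\<^sub>\<infinity>k. F k u)" for u
  proof (cases "u > 0")
    case True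
    have "(\<Sum>\<^sub>\<infinity>n. E n u) = (\<Sum>\<^sub>\<infinity>n. complex_of_real (?W u) * (complex_of_real (exp (- (norm (x - grid_point h n))\<^sup>2 / (4 * u))) * cis (\<omega> \<bullet> grid_point h n)))"
      by (simp add: E_def mult.assoc)
    also have "\<dots> = complex_of_real (?W u) * (of_real ((sqrt (4 * pi * u) / h) ^ CARD('d)) *
        (\<Sum>\<^sub>\<infinity>k. complex_of_real (exp (- u * (norm (?\<omega> k))\<^sup>2)) * cis (?\<omega> k \<bullet> x)))"
      by (simp only: infsum_cmult_right' poisson_gauss_vec[OF True h])
    also have "\<dots> = (\<Sum>\<^sub>\<infinity>k. complex_of_real (?W u) * (of_real ((sqrt (4 * pi * u) / h) ^ CARD('d)) *
        (complex_of_real (exp (- u * (norm (?\<omega> k))\<^sup>2)) * cis (?\<omega> k \<bullet> x))))"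
      by (simp only: infsum_cmult_right')
    also have "\<dots> = (\<Sum>\<^sub>\<infinity>k. F k u)"
    proof (rule infsum_cong)
      fix k
      have e1: "sqrt (4 * pi * u) ^ CARD('d) = sqrt (4 * pi) ^ CARD('d) * u powr (real CARD('d) / 2)"
        using True by (simp add: real_sqrt_mult power_mult_distrib powr_half_sqrt[symmetric] powr_powr flip: powr_realpow)
      have e2: "u powr (\<nu> - 1) * u powr (real CARD('d) / 2) = u powr (real m - 1)"
        by (simp add: \<nu>_def flip: powr_add)
      have e3: "exp (- u) * exp (- u * (norm (?\<omega> k))\<^sup>2) = exp (- (1 + (norm (?\<omega> k))\<^sup>2) * u)"
        by (simp add: algebra_simps flip: exp_add)
      have "?W u * ((sqrt (4 * pi * u) / h) ^ CARD('d) * exp (- u * (norm (?\<omega> k))\<^sup>2)) =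
          A' * ((u powr (\<nu> - 1) * u powr (real CARD('d) / 2)) * (exp (- u) * exp (- u * (norm (?\<omega> k))\<^sup>2)))"
        using True unfolding power_divide e1 by (simp add: matern_weight_def A'_def power_divide mult_ac)
      also note e2
      also note e3
      finally have "?W u * ((sqrt (4 * pi * u) / h) ^ CARD('d) * exp (- u * (norm (?\<omega> k))\<^sup>2)) =
          A' * (u powr (real m - 1) * exp (- (1 + (norm (?\<omega> k))\<^sup>2) * u))" .
      then have "complex_of_real (?W u) * (of_real ((sqrt (4 * pi * u) / h) ^ CARD('d)) * complex_of_real (exp (- u * (norm (?\<omega> k))\<^sup>2))) =
          complex_of_real (A' * (u powr (real m - 1) * exp (- (1 + (norm (?\<omega> k))\<^sup>2) * u)))"
        by (simp only: of_real_mult[symmetric])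
      then show "complex_of_real (?W u) * (of_real ((sqrt (4 * pi * u) / h) ^ CARD('d)) *
          (complex_of_real (exp (- u * (norm (?\<omega> k))\<^sup>2)) * cis (?\<omega> k \<bullet> x))) = F k u"
        using True by (simp add: F_def mult.assoc[symmetric])
    qed
    finally show ?thesis .
  qed (simp add: E_def F_def matern_weight_def)
  have sE: "(\<lambda>n. LINT u|lborel. norm (E n u)) summable_on UNIV"
    unfolding E_norm by (rule summable_matern_grid[OF m h])
  have sF: "(\<lambda>k. LINT u|lborel. norm (F k u)) summable_on UNIV"
    unfolding F_norm by (intro summable_on_cmult_right summable_inverse_power_grid_shift m) (use h in simp)
  have "(\<Sum>\<^sub>\<infinity>n. LINT u|lborel. E n u) = (LINT u|lborel. (\<Sum>\<^sub>\<infinity>n. E n u))"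
    by (rule integral_infsum_swap[symmetric, OF sigma_finite_lborel E_int sE])
  also have "\<dots> = (LINT u|lborel. (\<Sum>\<^sub>\<infinity>k. F k u))"
    by (simp only: EF)
  also have "\<dots> = (\<Sum>\<^sub>\<infinity>k. LINT u|lborel. F k u)"
    by (rule integral_infsum_swap[OF sigma_finite_lborel F_int sF])
  also have "\<dots> = of_real A * (\<Sum>\<^sub>\<infinity>k. of_real (1 / (1 + (norm (?\<omega> k))\<^sup>2) ^ m) * cis (?\<omega> k \<bullet> x))"
    by (simp only: F_val of_real_mult mult.assoc infsum_cmult_right')
  finally show ?thesis
    by (simp only: E_val)
qed

section \<open>Fourier inversion\<close>

lemma integrable_lborel_add_right:
  fixes f :: "'a :: euclidean_space \<Rightarrow> 'b :: {banach, second_countable_topology}"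
  assumes "integrable lborel f"
  shows "integrable lborel (\<lambda>x. f (x + t))"
proof -
  have "distr lborel lborel (\<lambda>x. x + t) = (lborel :: 'a measure)"
    using lborel_distr_plus[of t] by (simp add: add.commute cong: distr_cong)
  with assms show ?thesis
    using integrable_distr_eq[of "\<lambda>x. x + t" lborel lborel f] by (simp add: borel_measurable_integrable)
qed

text \<open>
  Abel summation of the inversion integral with the factor \<open>exp (- |\<omega>|\<^sup>2 / N)\<close>.
\<close>

theorem fourier_inversion:
  fixes f :: "real ^ 'd \<Rightarrow> complex"
  assumes cont: "continuous_on UNIV f" and int: "integrable lborel f"
    and fint: "integrable lborel (fourier_transform f)"
  shows "(LINT \<omega>|lborel. fourier_transform f \<omega> * cis (\<omega> \<bullet> x)) = of_real ((2 * pi) ^ CARD('d)) * f x"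
proof -
  define g where "g a y = exp (- a * (norm y)\<^sup>2)" for a and y :: "real ^ 'd"
  have g_cis_int: "integrable lborel (\<lambda>y. complex_of_real (g a y) * cis (\<xi> \<bullet> y))" if "a > 0" for a \<xi>
    unfolding g_def by (rule integrable_gauss_cis_vec[OF that])
  have g_int: "integrable lborel (g a)" "(LINT y|lborel. g a y) = sqrt (pi / a) ^ CARD('d)" if "a > 0" for a
    using integrable_gauss_cis_vec[OF that, of 0] integral_gauss_cis_vec[OF that, of 0]
    unfolding g_def[abs_def]
    by (simp_all add: complex_of_real_integrable_eq del: of_real_mult of_real_power of_real_exp)
  have g_pos: "g a y \<ge> 0" for a y by (simp add: g_def)
  define S where "S N = sqrt (pi * real N) ^ CARD('d)" for N :: nat
  \<comment> \<open>The kernel that arises from integrating the damped exponential over \<omega>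
    first: a Gaussian around x of total mass (2 \<pi>)^d that concentrates as N grows.\<close>
  define G where "G N y = S N * g (real N / 4) (y - x)" for N y
  have reg: "(LINT \<omega>|lborel. fourier_transform f \<omega> * cis (\<omega> \<bullet> x) * of_real (g (1 / real N) \<omega>)) =
      (LINT y|lborel. f y * of_real (G N y))" if N: "N > 0" for N
  proof -
    let ?k = "\<lambda>y \<omega>. f y * (complex_of_real (g (1 / real N) \<omega>) * cis ((x - y) \<bullet> \<omega>))"
    have I: "integrable (lborel \<Otimes>\<^sub>M lborel) (\<lambda>(y, \<omega>). ?k y \<omega>)"
    proof (rule lborel_pair.Fubini_integrable)
      have [measurable]: "f \<in> borel_measurable borel"
        using int by (simp add: borel_measurable_integrable)
      have "(\<lambda>z :: (real ^ 'd) \<times> (real ^ 'd). complex_of_real (g (1 / real N) (snd z)) * cis ((x - fst z) \<bullet> snd z)) \<in> borel_measurable borel"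
        unfolding g_def by (intro borel_measurable_continuous_onI continuous_intros)
      then have "(\<lambda>z :: (real ^ 'd) \<times> (real ^ 'd). complex_of_real (g (1 / real N) (snd z)) * cis ((x - fst z) \<bullet> snd z)) \<in> borel_measurable (lborel \<Otimes>\<^sub>M lborel)"
        by (simp add: lborel_prod)
      moreover have "(\<lambda>z :: (real ^ 'd) \<times> (real ^ 'd). f (fst z)) \<in> borel_measurable (lborel \<Otimes>\<^sub>M lborel)"
        by measurable
      ultimately show "(\<lambda>(y, \<omega>). ?k y \<omega>) \<in> borel_measurable (lborel \<Otimes>\<^sub>M lborel)"
        unfolding case_prod_unfold by (rule borel_measurable_times[rotated])
      have "(LINT \<omega>|lborel. norm (?k y \<omega>)) = norm (f y) * (LINT \<omega>|lborel. g (1 / real N) \<omega>)" for y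
        using g_pos by (simp add: norm_mult)
      then show "integrable lborel (\<lambda>y. LINT \<omega>|lborel. norm (case (y, \<omega>) of (y, \<omega>) \<Rightarrow> ?k y \<omega>))"
        using int by simp
      show "AE y in lborel. integrable lborel (\<lambda>\<omega>. case (y, \<omega>) of (y, \<omega>) \<Rightarrow> ?k y \<omega>)"
        using g_cis_int[of "1 / real N"] N by (auto intro!: integrable_mult_right)
    qed
    have "fourier_transform f \<omega> * cis (\<omega> \<bullet> x) * of_real (g (1 / real N) \<omega>) = (LINT y|lborel. ?k y \<omega>)" for \<omega>
    proof -
      have "?k y \<omega> = f y * exp (- \<i> * of_real (\<omega> \<bullet> y)) * (cis (\<omega> \<bullet> x) * of_real (g (1 / real N) \<omega>))" for y
      proof -
        have "cis ((x - y) \<bullet> \<omega>) = cis (- (\<omega> \<bullet> y)) * cis (\<omega> \<bullet> x)"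
          by (simp add: cis_mult inner_diff_right inner_commute)
        moreover have "cis (- (\<omega> \<bullet> y)) = exp (- \<i> * of_real (\<omega> \<bullet> y))"
          by (simp add: cis_conv_exp)
        ultimately show ?thesis by (simp add: mult_ac)
      qed
      moreover have "fourier_transform f \<omega> * cis (\<omega> \<bullet> x) * of_real (g (1 / real N) \<omega>) =
          (LINT y|lborel. f y * exp (- \<i> * of_real (\<omega> \<bullet> y)) * (cis (\<omega> \<bullet> x) * of_real (g (1 / real N) \<omega>)))"
        unfolding fourier_transform_def by (subst integral_mult_left_zero) (rule mult.assoc)
      ultimately show ?thesis by (simp only:)
    qed
    then have "(LINT \<omega>|lborel. fourier_transform f \<omega> * cis (\<omega> \<bullet> x) * of_real (g (1 / real N) \<omega>)) =
        (LINT \<omega>|lborel. (LINT y|lborel. ?k y \<omega>))" by (simp only:)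
    also have "\<dots> = (LINT y|lborel. (LINT \<omega>|lborel. ?k y \<omega>))"
      by (rule lborel_pair.Fubini_integral[OF I])
    also have "\<dots> = (LINT y|lborel. f y * of_real (G N y))"
    proof (rule Bochner_Integration.integral_cong)
      fix y
      have "(LINT \<omega>|lborel. ?k y \<omega>) = f y * of_real (sqrt (pi / (1 / real N)) ^ CARD('d) * exp (- (norm (x - y))\<^sup>2 / (4 * (1 / real N))))"
        unfolding g_def using N by (subst integral_mult_right_zero, subst integral_gauss_cis_vec) auto
      then show "(LINT \<omega>|lborel. ?k y \<omega>) = f y * of_real (G N y)"
        using N by (simp add: G_def S_def g_def norm_minus_commute field_simps)
    qed simp
    finally show ?thesis .
  qed
  have lim1: "(\<lambda>N. LINT \<omega>|lborel. fourier_transform f \<omega> * cis (\<omega> \<bullet> x) * of_real (g (1 / real N) \<omega>))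
      \<longlonglongrightarrow> (LINT \<omega>|lborel. fourier_transform f \<omega> * cis (\<omega> \<bullet> x))"
  proof (rule integral_dominated_convergence[where w = "\<lambda>\<omega>. norm (fourier_transform f \<omega>)"])
    have [measurable]: "fourier_transform f \<in> borel_measurable borel"
      using fint by (simp add: borel_measurable_integrable)
    have [measurable]: "(\<lambda>\<omega> :: real ^ 'd. cis (\<omega> \<bullet> x)) \<in> borel_measurable borel"
      by (intro borel_measurable_continuous_onI continuous_intros)
    show "(\<lambda>\<omega>. fourier_transform f \<omega> * cis (\<omega> \<bullet> x)) \<in> borel_measurable lborel"
      by simp
    show "(\<lambda>\<omega>. fourier_transform f \<omega> * cis (\<omega> \<bullet> x) * of_real (g (1 / real N) \<omega>)) \<in> borel_measurable lborel" for N
      unfolding g_def by simp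
    show "integrable lborel (\<lambda>\<omega>. norm (fourier_transform f \<omega>))"
      by (rule integrable_norm[OF fint])
    show "AE \<omega> in lborel. (\<lambda>N. fourier_transform f \<omega> * cis (\<omega> \<bullet> x) * of_real (g (1 / real N) \<omega>))
        \<longlonglongrightarrow> fourier_transform f \<omega> * cis (\<omega> \<bullet> x)"
    proof (rule AE_I2)
      fix \<omega> :: "real ^ 'd"
      have "(\<lambda>N. g (1 / real N) \<omega>) \<longlonglongrightarrow> exp (- 0 * (norm \<omega>)\<^sup>2)"
        unfolding g_def by (intro tendsto_intros lim_1_over_n)
      then have "(\<lambda>N. fourier_transform f \<omega> * cis (\<omega> \<bullet> x) * of_real (g (1 / real N) \<omega>))
        \<longlonglongrightarrow> fourier_transform f \<omega> * cis (\<omega> \<bullet> x) * of_real (exp (- 0 * (norm \<omega>)\<^sup>2))"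
        by (intro tendsto_intros)
      then show "(\<lambda>N. fourier_transform f \<omega> * cis (\<omega> \<bullet> x) * of_real (g (1 / real N) \<omega>))
        \<longlonglongrightarrow> fourier_transform f \<omega> * cis (\<omega> \<bullet> x)" by simp
    qed
    show "AE \<omega> in lborel. norm (fourier_transform f \<omega> * cis (\<omega> \<bullet> x) * of_real (g (1 / real N) \<omega>)) \<le> norm (fourier_transform f \<omega>)" for N
      by (rule AE_I2) (simp add: norm_mult g_def mult_left_le)
  qed
  have Gint: "integrable lborel (G N)" "(LINT y|lborel. G N y) = (2 * pi) ^ CARD('d)" if N: "N > 0" for N
  proof -
    have a: "real N / 4 > 0" using N by simp
    show "integrable lborel (G N)"
      unfolding G_def[abs_def] using integrable_lborel_add_right[OF g_int(1)[OF a], of "- x"] by simp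
    have "(LINT y|lborel. G N y) = S N * (LINT y|lborel. g (real N / 4) y)"
      unfolding G_def using lborel_integral_add_right[of "g (real N / 4)" "- x"] by simp
    also have "\<dots> = (sqrt (pi * real N) * sqrt (pi / (real N / 4))) ^ CARD('d)"
      unfolding g_int(2)[OF a] S_def by (simp only: power_mult_distrib)
    also have "sqrt (pi * real N) * sqrt (pi / (real N / 4)) = 2 * pi"
    proof -
      have "pi * real N * (pi / (real N / 4)) = (2 * pi)\<^sup>2"
        using N by (simp add: power2_eq_square)
      then show ?thesis
        by (simp only: real_sqrt_mult[symmetric] real_sqrt_abs) simp
    qed
    finally show "(LINT y|lborel. G N y) = (2 * pi) ^ CARD('d)" .
  qed
  have lim2: "(\<lambda>N. LINT y|lborel. f y * of_real (G N y)) \<longlonglongrightarrow> of_real ((2 * pi) ^ CARD('d)) * f x"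
  proof (rule LIMSEQ_I)
    fix r :: real assume r: "r > 0"
    \<comment> \<open>Multiplied by the mass (2 \<pi>)^d of \<open>G N\<close> this is r / 2, the
      share of the points near x.\<close>
    define \<eta> where "\<eta> = r / (2 * (2 * pi) ^ CARD('d))"
    have \<eta>: "\<eta> > 0" using r by (simp add: \<eta>_def)
    obtain \<delta> where \<delta>: "\<delta> > 0" "\<And>y. dist y x < \<delta> \<Longrightarrow> dist (f y) (f x) < \<eta>"
      using cont \<eta> unfolding continuous_on_iff by (metis UNIV_I)
    \<comment> \<open>For |y - x| \<ge> \<delta>, half of the exponent N |y - x|^2 / 4 is at least c
      N and makes \<open>\<kappa> N\<close> tend to 0; the other half leaves the integrable Gaussian
      \<open>g (real N / 8)\<close>.\<close>
    define c where "c = \<delta>\<^sup>2 / 8"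
    have c: "c > 0" using \<delta> by (simp add: c_def)
    define \<kappa> where "\<kappa> N = S N * exp (- c * real N)" for N
    \<comment> \<open>Bounds the far part up to the factor \<open>\<kappa> N\<close>, uniformly in N
      \<ge> 1, since \<open>g (real N / 8)\<close> has mass at most sqrt (8 \<pi>)^d.\<close>
    define D where "D = (LINT y|lborel. norm (f y)) + norm (f x) * sqrt (8 * pi) ^ CARD('d)"
    have S0: "S N \<ge> 0" for N by (simp add: S_def)
    have \<kappa>0: "\<kappa> N \<ge> 0" for N using S0 by (simp add: \<kappa>_def)
    have "\<kappa> \<longlonglongrightarrow> 0"
    proof (rule Lim_null_comparison)
      have "filterlim (\<lambda>N. c * real N) at_top sequentially"
        by (intro filterlim_tendsto_pos_mult_at_top[OF tendsto_const c] filterlim_real_sequentially)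
      from filterlim_compose[OF tendsto_power_div_exp_0[of "CARD('d)"] this]
      have "(\<lambda>N. (pi / c) ^ CARD('d) * ((c * real N) ^ CARD('d) / exp (c * real N))) \<longlonglongrightarrow> (pi / c) ^ CARD('d) * 0"
        by (intro tendsto_intros)
      then show "(\<lambda>N. (pi / c) ^ CARD('d) * ((c * real N) ^ CARD('d) / exp (c * real N))) \<longlonglongrightarrow> 0" by simp
      show "\<forall>\<^sub>F N in sequentially. norm (\<kappa> N) \<le> (pi / c) ^ CARD('d) * ((c * real N) ^ CARD('d) / exp (c * real N))"
      proof (rule eventually_sequentiallyI[of 1])
        fix N :: nat assume N: "1 \<le> N"
        have p1: "1 \<le> pi * real N"
          using N pi_gt3 mult_mono[of 1 pi 1 "real N"] by simp
        then have "sqrt (pi * real N) \<le> pi * real N"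
          using p1 by (intro real_le_lsqrt self_le_power) auto
        then have "S N \<le> (pi * real N) ^ CARD('d)"
          unfolding S_def by (intro power_mono) (use p1 in auto)
        also have "\<dots> = (pi / c) ^ CARD('d) * (c * real N) ^ CARD('d)"
          unfolding power_mult_distrib[symmetric] using c by simp
        finally have "S N * exp (- c * real N) \<le> (pi / c) ^ CARD('d) * (c * real N) ^ CARD('d) * exp (- c * real N)"
          by (intro mult_right_mono) auto
        then show "norm (\<kappa> N) \<le> (pi / c) ^ CARD('d) * ((c * real N) ^ CARD('d) / exp (c * real N))"
          using \<kappa>0[of N] by (simp add: \<kappa>_def exp_minus divide_inverse mult.assoc)
      qed
    qed
    then have "(\<lambda>N. \<kappa> N * D) \<longlonglongrightarrow> 0 * D"
      by (intro tendsto_intros)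
    then obtain N0 where N0: "\<And>N. N \<ge> N0 \<Longrightarrow> norm (\<kappa> N * D) < r / 2"
      using LIMSEQ_D[of "\<lambda>N. \<kappa> N * D" "0 * D" "r / 2"] r by auto
    have "norm ((LINT y|lborel. f y * of_real (G N y)) - of_real ((2 * pi) ^ CARD('d)) * f x) < r"
      if N: "N \<ge> max N0 1" for N
    proof -
      have N1: "N > 0" "real N \<ge> 1" using N by auto
      have G0: "G N y \<ge> 0" for y using S0 g_pos by (simp add: G_def)
      have G_far: "G N y \<le> \<kappa> N * g (real N / 8) (y - x)" if "\<delta> \<le> norm (y - x)" for y
      proof -
        have "c * real N \<le> (norm (y - x))\<^sup>2 / 8 * real N"
          unfolding c_def using that \<delta> N1 by (intro mult_right_mono divide_right_mono power_mono) auto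
        then have "- (real N / 4) * (norm (y - x))\<^sup>2 \<le> - c * real N + - (real N / 8) * (norm (y - x))\<^sup>2"
          by (simp add: algebra_simps)
        then have "g (real N / 4) (y - x) \<le> exp (- c * real N) * g (real N / 8) (y - x)"
          unfolding g_def exp_add[symmetric] by simp
        from mult_left_mono[OF this S0[of N]] show ?thesis
          by (simp add: G_def \<kappa>_def mult.assoc)
      qed
      have a: "real N / 8 > 0" using N1 by simp
      have gs: "integrable lborel (\<lambda>y. g (real N / 8) (y - x))"
        using integrable_lborel_add_right[OF g_int(1)[OF a], of "- x"] by simp
      have gsv: "(LINT y|lborel. g (real N / 8) (y - x)) \<le> sqrt (8 * pi) ^ CARD('d)"
      proof -
        have "(LINT y|lborel. g (real N / 8) (y - x)) = sqrt (pi / (real N / 8)) ^ CARD('d)"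
          using lborel_integral_add_right[of "g (real N / 8)" "- x"] g_int(2)[OF a] by simp
        also have "\<dots> \<le> sqrt (8 * pi) ^ CARD('d)"
          using N1 by (intro power_mono real_sqrt_le_mono) (auto simp: field_simps)
        finally show ?thesis .
      qed
      have fG: "integrable lborel (\<lambda>y. f y * of_real (G N y))"
      proof (rule Bochner_Integration.integrable_bound)
        show "integrable lborel (\<lambda>y. S N *\<^sub>R norm (f y))" using int by simp
        show "(\<lambda>y. f y * complex_of_real (G N y)) \<in> borel_measurable lborel"
          using borel_measurable_integrable[OF int] borel_measurable_integrable[OF Gint(1)[OF N1(1)]] by measurable
        have "G N y \<le> S N" for y
          using S0[of N] by (simp add: G_def g_def mult_left_le)
        then show "AE y in lborel. norm (f y * complex_of_real (G N y)) \<le> norm (S N *\<^sub>R norm (f y))"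
          using G0 S0[of N] by (auto simp: norm_mult mult.commute[of "S N"] intro!: AE_I2 mult_left_mono)
      qed
      have "(LINT y|lborel. f y * of_real (G N y)) - of_real ((2 * pi) ^ CARD('d)) * f x =
          (LINT y|lborel. f y * of_real (G N y)) - (LINT y|lborel. f x * of_real (G N y))"
        using Gint(2)[OF N1(1)] by (simp add: mult.commute)
      also have "\<dots> = (LINT y|lborel. f y * of_real (G N y) - f x * of_real (G N y))"
        using fG Gint(1)[OF N1(1)] by (intro Bochner_Integration.integral_diff[symmetric] integrable_mult_right integrable_of_real)
      also have "norm \<dots> \<le> (LINT y|lborel. \<eta> * G N y + \<kappa> N * (norm (f y) + norm (f x) * g (real N / 8) (y - x)))"
      proof (rule order_trans[OF integral_norm_bound integral_mono])
        show "integrable lborel (\<lambda>y. norm (f y * of_real (G N y) - f x * of_real (G N y)))"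
          using fG Gint(1)[OF N1(1)] by (intro integrable_norm Bochner_Integration.integrable_diff integrable_mult_right integrable_of_real)
        show "integrable lborel (\<lambda>y. \<eta> * G N y + \<kappa> N * (norm (f y) + norm (f x) * g (real N / 8) (y - x)))"
          using Gint(1)[OF N1(1)] gs int by (intro Bochner_Integration.integrable_add integrable_mult_right integrable_norm)
        fix y
        have "norm (f y * of_real (G N y) - f x * of_real (G N y)) = norm (f y - f x) * G N y"
          using G0 by (simp add: norm_mult flip: left_diff_distrib)
        also have "\<dots> \<le> \<eta> * G N y + \<kappa> N * (norm (f y) + norm (f x) * g (real N / 8) (y - x))"
        proof (cases "norm (y - x) < \<delta>")
          case True
          then have "norm (f y - f x) * G N y \<le> \<eta> * G N y"
            using \<delta>(2)[of y] G0 by (intro mult_right_mono) (auto simp: dist_norm)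
          moreover have "0 \<le> \<kappa> N * (norm (f y) + norm (f x) * g (real N / 8) (y - x))"
            using \<kappa>0 g_pos by (intro mult_nonneg_nonneg add_nonneg_nonneg) auto
          ultimately show ?thesis by linarith
        next
          case False
          then have far: "G N y \<le> \<kappa> N * g (real N / 8) (y - x)" by (intro G_far) simp
          have "norm (f y - f x) * G N y \<le> (norm (f y) + norm (f x)) * (\<kappa> N * g (real N / 8) (y - x))"
            using far G0 by (intro mult_mono norm_triangle_ineq4) auto
          also have "\<dots> = \<kappa> N * (norm (f y) * g (real N / 8) (y - x) + norm (f x) * g (real N / 8) (y - x))"
            by (simp add: algebra_simps)
          also have "\<dots> \<le> \<kappa> N * (norm (f y) + norm (f x) * g (real N / 8) (y - x))"
            using \<kappa>0 by (intro mult_left_mono add_right_mono mult_left_le) (auto simp: g_def)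
          also have "\<dots> \<le> \<eta> * G N y + \<dots>"
            using \<eta> G0[of y] by simp
          finally show ?thesis .
        qed
        finally show "norm (f y * of_real (G N y) - f x * of_real (G N y)) \<le> \<eta> * G N y + \<kappa> N * (norm (f y) + norm (f x) * g (real N / 8) (y - x))" .
      qed
      also have "\<dots> = \<eta> * (2 * pi) ^ CARD('d) + \<kappa> N * ((LINT y|lborel. norm (f y)) + norm (f x) * (LINT y|lborel. g (real N / 8) (y - x)))"
        using Gint[OF N1(1)] gs int by simp
      also have "\<dots> \<le> \<eta> * (2 * pi) ^ CARD('d) + \<kappa> N * D"
        unfolding D_def using \<kappa>0 gsv by (intro add_left_mono mult_left_mono) auto
      also have "\<dots> < r"
        using N0[of N] N by (simp add: \<eta>_def field_simps abs_less_iff)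
      finally show ?thesis .
    qed
    then show "\<exists>no. \<forall>N\<ge>no. norm ((LINT y|lborel. f y * of_real (G N y)) - of_real ((2 * pi) ^ CARD('d)) * f x) < r"
      by blast
  qed
  have "\<forall>\<^sub>F N in sequentially. (LINT \<omega>|lborel. fourier_transform f \<omega> * cis (\<omega> \<bullet> x) * of_real (g (1 / real N) \<omega>)) =
      (LINT y|lborel. f y * of_real (G N y))"
    using reg by (intro eventually_sequentiallyI[of 1]) auto
  from tendsto_cong[OF this] lim1 lim2 show ?thesis
    using LIMSEQ_unique by blast
qed

section \<open>Convolution inverses\<close>

definition conv :: "('g::ab_group_add \<Rightarrow> complex) \<Rightarrow> ('g \<Rightarrow> complex) \<Rightarrow> 'g \<Rightarrow> complex" where
  "conv f g k = (\<Sum>\<^sub>\<infinity>j. f j * g (k - j))"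

lemma summable_on_product_complex:
  fixes f :: "'a \<Rightarrow> complex" and g :: "'b \<Rightarrow> complex"
  assumes f: "(\<lambda>x. norm (f x)) summable_on UNIV" and g: "(\<lambda>y. norm (g y)) summable_on UNIV"
  shows "(\<lambda>(x, y). norm (f x * g y)) summable_on UNIV"
proof -
  have "(\<lambda>(x, y). norm (f x) * norm (g y)) summable_on (UNIV \<times> UNIV)"
  proof (rule summable_on_SigmaI)
    show "((\<lambda>y. case (x, y) of (x, y) \<Rightarrow> norm (f x) * norm (g y)) has_sum norm (f x) * (\<Sum>\<^sub>\<infinity>y. norm (g y))) UNIV" for x
      using has_sum_cmult_right[OF has_sum_infsum[OF g], of "norm (f x)"] by simp
    show "(\<lambda>x. norm (f x) * (\<Sum>\<^sub>\<infinity>y. norm (g y))) summable_on UNIV"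
      by (rule summable_on_cmult_left[OF f])
  qed auto
  then show ?thesis by (simp add: norm_mult)
qed

lemma bij_conv_shift: "bij (\<lambda>(k, j). (j, k - j :: 'g::ab_group_add))"
  by (rule bij_betwI[of _ _ _ "\<lambda>(j, l). (j + l, j)"]) auto

lemma summable_on_conv_kernel:
  fixes f g :: "'g::ab_group_add \<Rightarrow> complex"
  assumes f: "(\<lambda>x. norm (f x)) summable_on UNIV" and g: "(\<lambda>y. norm (g y)) summable_on UNIV"
  shows "(\<lambda>(k, j). norm (f j * g (k - j))) summable_on UNIV"
  using summable_on_product_complex[OF f g]
    summable_on_reindex_bij_betw[OF bij_conv_shift, of "\<lambda>(x, y). norm (f x * g y)"]
  by (simp add: case_prod_unfold)

text \<open>The substitution (k, j) -> (j, k - j) turns the convolution kernel into the product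
  family on pairs, whose absolute summability permits every rearrangement.\<close>

lemma
  fixes f g :: "'g::ab_group_add \<Rightarrow> complex"
  assumes f: "(\<lambda>x. norm (f x)) summable_on UNIV" and g: "(\<lambda>y. norm (g y)) summable_on UNIV"
  shows summable_conv: "(\<lambda>k. norm (conv f g k)) summable_on UNIV"
    and infsum_conv: "(\<Sum>\<^sub>\<infinity>k. conv f g k) = (\<Sum>\<^sub>\<infinity>k. f k) * (\<Sum>\<^sub>\<infinity>k. g k)"
proof -
  let ?K = "\<lambda>(k, j). f j * g (k - j)"
  have K: "?K summable_on (UNIV \<times> UNIV)"
    using summable_on_conv_kernel[OF f g] abs_summable_summable[of ?K UNIV] by (simp add: case_prod_unfold)
  have "(\<lambda>k. \<Sum>\<^sub>\<infinity>j. f j * g (k - j)) summable_on UNIV"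
    by (rule summable_on_Sigma_banach[OF K])
  then show "(\<lambda>k. norm (conv f g k)) summable_on UNIV"
    unfolding conv_def by (rule summable_on_iff_abs_summable_on_complex[THEN iffD1])
  let ?P = "\<lambda>(x, y). f x * g y"
  have P: "?P summable_on (UNIV \<times> UNIV)"
    using summable_on_product_complex[OF f g] abs_summable_summable[of ?P UNIV] by (simp add: case_prod_unfold)
  have "(\<Sum>\<^sub>\<infinity>k. conv f g k) = infsum ?K (UNIV \<times> UNIV)"
    unfolding conv_def by (rule infsum_Sigma'_banach[OF K])
  also have "\<dots> = infsum ?P (UNIV \<times> UNIV)"
    using infsum_reindex_bij_betw[OF bij_conv_shift, of ?P] by (simp add: case_prod_unfold)
  also have "\<dots> = (\<Sum>\<^sub>\<infinity>x. \<Sum>\<^sub>\<infinity>y. f x * g y)"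
    by (rule infsum_Sigma'_banach[OF P, symmetric])
  also have "\<dots> = (\<Sum>\<^sub>\<infinity>k. f k) * (\<Sum>\<^sub>\<infinity>k. g k)"
    by (simp only: infsum_cmult_right' infsum_cmult_left')
  finally show "(\<Sum>\<^sub>\<infinity>k. conv f g k) = (\<Sum>\<^sub>\<infinity>k. f k) * (\<Sum>\<^sub>\<infinity>k. g k)" .
qed

section \<open>Fourier series of summable sequences on the integer lattice\<close>

definition fseries :: "(int ^ 'd \<Rightarrow> complex) \<Rightarrow> real ^ 'd \<Rightarrow> complex" where
  "fseries f t = (\<Sum>\<^sub>\<infinity>k. f k * cis (t \<bullet> grid_point 1 k))"

text \<open>Characters are multiplicative, so modulating both factors modulates their convolution;
  what remains is the total sum of a convolution.\<close>

lemma fseries_conv: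
  assumes f: "(\<lambda>x. norm (f x)) summable_on UNIV" and g: "(\<lambda>y. norm (g y)) summable_on UNIV"
  shows "fseries (conv f g) t = fseries f t * fseries g t"
proof -
  let ?e = "\<lambda>k. cis (t \<bullet> grid_point 1 k)"
  have "conv (\<lambda>k. f k * ?e k) (\<lambda>k. g k * ?e k) k = conv f g k * ?e k" for k
  proof -
    have "?e j * ?e (k - j) = ?e k" for j
      by (simp add: grid_point_diff inner_diff_right cis_mult)
    then have "f j * ?e j * (g (k - j) * ?e (k - j)) = f j * g (k - j) * ?e k" for j
      by (simp add: mult_ac)
    then show ?thesis
      unfolding conv_def by (simp only: infsum_cmult_left')
  qed
  then show ?thesis
    unfolding fseries_def using infsum_conv[of "\<lambda>k. f k * ?e k" "\<lambda>k. g k * ?e k"] f g by (simp add: norm_mult)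
qed

text \<open>A coefficient is the mean of the series times the conjugate character over one period.
  With t = 2 \<pi> s the period becomes a cube of volume 1, so the bound carries no extra
  factor.\<close>

lemma norm_coeff_le_norm_fseries:
  fixes g :: "int ^ 'd \<Rightarrow> complex"
  assumes g: "(\<lambda>k. norm (g k)) summable_on UNIV" and B: "\<And>t. norm (fseries g t) \<le> B"
  shows "norm (g k) \<le> B"
proof -
  let ?S = "{-1/2..<1/2::real}"
  \<comment> \<open>The indicator of the cube is built into the factors, so the integral extends
    over the whole space and splits into one-dimensional orthogonality integrals.\<close>
  define e where "e l s = (\<Prod>i\<in>UNIV. indicator ?S (s $ i) *\<^sub>R cis (2 * pi * of_int (l $ i - k $ i) * s $ i))" for l :: "int ^ 'd" and s :: "real ^ 'd"
  define J where "J s = (\<Prod>i\<in>UNIV. indicator ?S (s $ i) :: real)" for s :: "real ^ 'd"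
  have SI: "integrable lborel (\<lambda>t. indicator ?S t *\<^sub>R G t)" if "continuous_on UNIV G" for G :: "real \<Rightarrow> complex"
    unfolding set_integrable_def[symmetric]
    by (rule set_integrable_subset[OF borel_integrable_atLeastAtMost'[of "-1/2" "1/2", OF continuous_on_subset[OF that]]]) auto
  have cint: "integrable lborel (\<lambda>t. indicator ?S t *\<^sub>R cis (2 * pi * of_int n * t))" for n :: int
    by (intro SI continuous_intros)
  have e_int: "integrable lborel (e l)" for l
    unfolding e_def by (intro integrable_prod_vec[of "\<lambda>i t. indicator ?S t *\<^sub>R cis (2 * pi * of_int (l $ i - k $ i) * t)"] cint)
  have e_val: "(LINT s|lborel. e l s) = (if l = k then 1 else 0)" for l
  proof -
    have "(LINT s|lborel. e l s) = (\<Prod>i\<in>UNIV. LINT t|lborel. indicator ?S t *\<^sub>R cis (2 * pi * of_int (l $ i - k $ i) * t))"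
      unfolding e_def by (intro integral_prod_vec[of "\<lambda>i t. indicator ?S t *\<^sub>R cis (2 * pi * of_int (l $ i - k $ i) * t)"] cint)
    also have "\<dots> = (\<Prod>i\<in>UNIV. if l $ i = k $ i then 1 else 0)"
      unfolding set_lebesgue_integral_def[symmetric] integral_cis_unit_interval by simp
    also have "\<dots> = (if l = k then 1 else 0)"
      by (auto simp: vec_eq_iff prod_zero_iff)
    finally show ?thesis .
  qed
  have e_norm: "norm (e l s) = J s" for l s
    by (simp add: e_def J_def flip: prod_norm)
  have J_eq: "complex_of_real (J s) = e k s" for s
    by (simp add: e_def J_def scaleR_conv_of_real)
  have J_int: "integrable lborel J"
    using e_int[of k] unfolding J_eq[symmetric, abs_def] by (simp add: complex_of_real_integrable_eq)
  have J_val: "(LINT s|lborel. J s) = 1"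
    using e_val[of k] unfolding J_eq[symmetric] by simp
  have J0: "J s \<ge> 0" for s by (simp add: J_def prod_nonneg)
  have sum: "(\<Sum>\<^sub>\<infinity>l. g l * e l s) = J s *\<^sub>R (cis (- (2 * pi) * (s \<bullet> grid_point 1 k)) * fseries g ((2 * pi) *\<^sub>R s))" for s
  proof -
    have "e l s = J s *\<^sub>R (cis (- (2 * pi) * (s \<bullet> grid_point 1 k)) * cis ((2 * pi) *\<^sub>R s \<bullet> grid_point 1 l))" for l
    proof -
      have "(\<Sum>i\<in>UNIV. 2 * pi * of_int (l $ i - k $ i) * s $ i) = - (2 * pi) * (s \<bullet> grid_point 1 k) + (2 * pi) *\<^sub>R s \<bullet> grid_point 1 l"
        by (simp add: inner_vec_def grid_point_def sum_distrib_left sum_subtractf sum_negf algebra_simps)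
      then have "cis (\<Sum>i\<in>UNIV. 2 * pi * of_int (l $ i - k $ i) * s $ i) =
          cis (- (2 * pi) * (s \<bullet> grid_point 1 k)) * cis ((2 * pi) *\<^sub>R s \<bullet> grid_point 1 l)"
        by (simp only: cis_mult)
      then show ?thesis
        by (simp only: e_def J_def scaleR_conv_of_real prod.distrib cis_sum of_real_prod)
    qed
    then have "g l * e l s = J s *\<^sub>R cis (- (2 * pi) * (s \<bullet> grid_point 1 k)) * (g l * cis ((2 * pi) *\<^sub>R s \<bullet> grid_point 1 l))" for l
      by (simp add: scaleR_conv_of_real mult_ac)
    then show ?thesis
      unfolding fseries_def by (simp only: infsum_cmult_right') simp
  qed
  have bound: "norm (\<Sum>\<^sub>\<infinity>l. g l * e l s) \<le> B * J s" for s
    unfolding sum using B[of "(2 * pi) *\<^sub>R s"] J0[of s] by (simp add: norm_mult abs_of_nonneg mult.commute[of B] mult_left_mono)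
  have gint: "integrable lborel (\<lambda>s. g l * e l s)" for l
    by (intro integrable_mult_right e_int)
  have gs: "(\<lambda>l. LINT s|lborel. norm (g l * e l s)) summable_on UNIV"
    using g by (simp add: norm_mult e_norm J_val)
  have "g k = (\<Sum>\<^sub>\<infinity>l. if l = k then g l else 0)"
    by (subst infsumI[OF has_sum_finite_neutralI[of "{k}"]]) auto
  also have "\<dots> = (\<Sum>\<^sub>\<infinity>l. LINT s|lborel. g l * e l s)"
    by (rule infsum_cong) (simp add: e_val)
  also have "\<dots> = (LINT s|lborel. (\<Sum>\<^sub>\<infinity>l. g l * e l s))"
    by (rule integral_infsum_swap[symmetric, OF sigma_finite_lborel gint gs])
  finally have gk: "g k = (LINT s|lborel. (\<Sum>\<^sub>\<infinity>l. g l * e l s))" .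
  have "norm (g k) \<le> (LINT s|lborel. norm (\<Sum>\<^sub>\<infinity>l. g l * e l s))"
    by (subst gk) (rule integral_norm_bound)
  also have "\<dots> \<le> (LINT s|lborel. B * J s)"
    using bound J_int integrable_infsum[OF sigma_finite_lborel gint gs]
    by (intro integral_mono integrable_norm integrable_mult_right) auto
  also have "\<dots> = B" using J_val by simp
  finally show ?thesis .
qed

definition delta :: "'g::ab_group_add \<Rightarrow> complex" where
  "delta k = (if k = 0 then 1 else 0)"

lemma summable_delta: "(\<lambda>k. norm (delta k)) summable_on UNIV"
proof -
  have "((\<lambda>k. norm (delta k)) has_sum (\<Sum>k\<in>{0::'a}. norm (delta k))) UNIV"
    by (rule has_sum_finite_neutralI[of "{0}"]) (auto simp: delta_def)
  then show ?thesis by (rule has_sum_imp_summable)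
qed

lemma infsum_delta: "(\<Sum>\<^sub>\<infinity>k. delta k * f k) = f 0"
  by (subst infsumI[OF has_sum_finite_neutralI[of "{0}"]]) (auto simp: delta_def)

lemma fseries_delta: "fseries delta t = 1"
  unfolding fseries_def by (subst infsum_delta) (simp add: grid_point_0)

lemma fseries_cmult: "fseries (\<lambda>k. c * f k) t = c * fseries f t"
  unfolding fseries_def mult.assoc by (rule infsum_cmult_right')

lemma
  assumes "(\<lambda>x. norm (f x)) summable_on UNIV" "(\<lambda>y. norm (g y)) summable_on UNIV"
  shows summable_norm_diff: "(\<lambda>k. norm (f k - g k)) summable_on UNIV"
    and fseries_diff: "fseries (\<lambda>k. f k - g k) t = fseries f t - fseries g t"
proof -
  show "(\<lambda>k. norm (f k - g k)) summable_on UNIV"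
    by (rule summable_on_comparison_test[OF summable_on_add[OF assms]]) (auto intro: norm_triangle_ineq4)
  have "((\<lambda>k. f k * cis (t \<bullet> grid_point 1 k)) has_sum fseries f t) UNIV" "((\<lambda>k. g k * cis (t \<bullet> grid_point 1 k)) has_sum fseries g t) UNIV"
    unfolding fseries_def by (rule has_sum_infsum, rule abs_summable_summable, use assms in \<open>simp add: norm_mult\<close>)+
  from infsumI[OF has_sum_add[OF this(1) has_sum_uminusI[OF this(2)]]]
  show "fseries (\<lambda>k. f k - g k) t = fseries f t - fseries g t"
    unfolding fseries_def[of "\<lambda>k. f k - g k"] by (simp add: left_diff_distrib)
qed

lemma summable_on_exp_bound:
  fixes f :: "int ^ 'd \<Rightarrow> complex"
  assumes "\<And>k. norm (f k) \<le> C * exp (- \<delta> * l1_length k)" "\<delta> > 0"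
  shows "(\<lambda>k. norm (f k)) summable_on UNIV"
  by (rule summable_on_comparison_test[OF summable_on_cmult_right[OF summable_exp_l1_length[OF assms(2)], of C]])
    (use assms(1) in auto)

text \<open>
  A quantitative form of Wiener's lemma. The convolution powers \<open>s n\<close> of \<open>\<delta> - \<phi> / \<beta>\<close> are bounded
  by \<open>q\<^sup>n\<close> with \<open>q < 1\<close>, since their Fourier series are, and by \<open>M\<^sup>n exp (- \<epsilon> |k|)\<close> for a
  possibly large \<open>M\<close>. The geometric mean of both bounds with a small weight on the second one is
  summable over \<open>n\<close> and \<open>k\<close>.
\<close>

theorem exists_fseries_inverse:
  fixes \<phi> :: "int ^ 'd \<Rightarrow> complex" and \<sigma> :: "real ^ 'd \<Rightarrow> real"
  assumes decay: "\<And>k. norm (\<phi> k) \<le> C * exp (- \<delta> * l1_length k)" and \<delta>: "\<delta> > 0"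
    and \<sigma>: "\<And>t. fseries \<phi> t = of_real (\<sigma> t)"
    and \<alpha>: "\<alpha> > 0" "\<And>t. \<alpha> \<le> \<sigma> t" and \<beta>: "\<And>t. \<sigma> t \<le> \<beta>"
  obtains a where "(\<lambda>k. norm (a k)) summable_on UNIV" "\<And>t. fseries a t * fseries \<phi> t = 1"
proof -
  have \<beta>0: "\<beta> > 0" "\<alpha> \<le> \<beta>" using \<alpha>(1) \<alpha>(2)[of 0] \<beta>[of 0] by linarith+
  have \<phi>s: "(\<lambda>k. norm (\<phi> k)) summable_on UNIV" by (rule summable_on_exp_bound[OF decay \<delta>])
  \<comment> \<open>Its Fourier series 1 - \<sigma> / \<beta> lies between 0 and 1 - \<alpha> /
    \<beta> < 1, so the Neumann series of convolution powers of \<open>b\<close> inverts \<phi> /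
    \<beta>.\<close>
  define b where "b k = delta k - of_real (1 / \<beta>) * \<phi> k" for k
  \<comment> \<open>Half of the decay rate is given up so that the weighted sum \<open>M\<close>
    converges.\<close>
  define \<epsilon> where "\<epsilon> = \<delta> / 2"
  have \<epsilon>: "\<epsilon> > 0" using \<delta> by (simp add: \<epsilon>_def)
  have bb: "norm (b k) \<le> (1 + C / \<beta>) * exp (- \<delta> * l1_length k)" for k
  proof -
    have "norm (b k) \<le> norm (delta k) + norm (of_real (1 / \<beta>) * \<phi> k)"
      unfolding b_def by (rule norm_triangle_ineq4)
    also have "norm (of_real (1 / \<beta>) * \<phi> k) = 1 / \<beta> * norm (\<phi> k)"
      using \<beta>0 by (simp add: norm_mult norm_divide)
    also have "\<dots> \<le> 1 / \<beta> * (C * exp (- \<delta> * l1_length k))"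
      using \<beta>0 by (intro mult_left_mono decay) auto
    also have "norm (delta k) \<le> exp (- \<delta> * l1_length k)"
      by (auto simp: delta_def l1_length_def)
    finally show ?thesis by (simp add: algebra_simps)
  qed
  have bs: "(\<lambda>k. norm (b k)) summable_on UNIV" by (rule summable_on_exp_bound[OF bb \<delta>])
  have bft: "fseries b t = of_real (1 - \<sigma> t / \<beta>)" for t
  proof -
    have "(\<lambda>k. norm (of_real (1 / \<beta>) * \<phi> k)) summable_on UNIV"
      unfolding norm_mult by (rule summable_on_cmult_right[OF \<phi>s])
    then show ?thesis
      unfolding b_def by (subst fseries_diff[OF summable_delta], assumption, subst fseries_cmult)
        (simp add: fseries_delta \<sigma>)
  qed
  define M where "M = (\<Sum>\<^sub>\<infinity>k. norm (b k) * exp (\<epsilon> * l1_length k))"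
  have Ms: "(\<lambda>k. norm (b k) * exp (\<epsilon> * l1_length k)) summable_on UNIV"
  proof (rule summable_on_comparison_test[OF summable_on_cmult_right[OF summable_exp_l1_length[OF \<epsilon>], of "1 + C / \<beta>"]])
    fix k :: "int ^ 'd"
    have "norm (b k) * exp (\<epsilon> * l1_length k) \<le> (1 + C / \<beta>) * exp (- \<delta> * l1_length k) * exp (\<epsilon> * l1_length k)"
      by (intro mult_right_mono bb) auto
    also have "\<dots> = (1 + C / \<beta>) * exp (- \<epsilon> * l1_length k)"
      by (simp add: \<epsilon>_def mult.assoc flip: exp_add)
    finally show "norm (b k) * exp (\<epsilon> * l1_length k) \<le> (1 + C / \<beta>) * exp (- \<epsilon> * l1_length k)" .
  qed auto
  have M0: "M \<ge> 0" unfolding M_def by (intro infsum_nonneg) auto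
  define s where "s = rec_nat delta (\<lambda>_. conv b)"
  have s0: "s 0 = delta" and sSuc: "s (Suc n) = conv b (s n)" for n
    by (simp_all add: s_def)
  have bnd1: "norm (s n k) \<le> M ^ n * exp (- \<epsilon> * l1_length k)" for n k
  proof (induction n arbitrary: k)
    case 0
    show ?case by (auto simp: s0 delta_def l1_length_def)
  next
    case (Suc n)
    \<comment> \<open>The weight exp (\<epsilon> |k|) is submultiplicative by the triangle
      inequality, so each convolution with \<open>b\<close> costs at most a factor
      \<open>M\<close>.\<close>
    have ptw: "norm (b j * s n (k - j)) \<le> M ^ n * exp (- \<epsilon> * l1_length k) * (norm (b j) * exp (\<epsilon> * l1_length j))" for j
    proof -
      have "exp (- \<epsilon> * l1_length (k - j)) \<le> exp (\<epsilon> * l1_length j + - \<epsilon> * l1_length k)"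
        using mult_left_mono[OF l1_length_triangle[of k j], of \<epsilon>] \<epsilon> by (simp add: algebra_simps)
      then have "norm (s n (k - j)) \<le> M ^ n * exp (\<epsilon> * l1_length j + - \<epsilon> * l1_length k)"
        using M0 by (intro order_trans[OF Suc.IH] mult_left_mono) auto
      from mult_left_mono[OF this norm_ge_zero[of "b j"]] show ?thesis
        unfolding norm_mult exp_add by (simp only: mult_ac)
    qed
    have dom: "(\<lambda>j. M ^ n * exp (- \<epsilon> * l1_length k) * (norm (b j) * exp (\<epsilon> * l1_length j))) summable_on UNIV"
      by (rule summable_on_cmult_right[OF Ms])
    have ns: "(\<lambda>j. norm (b j * s n (k - j))) summable_on UNIV"
      by (rule summable_on_comparison_test[OF dom ptw]) auto
    have "norm (s (Suc n) k) \<le> (\<Sum>\<^sub>\<infinity>j. norm (b j * s n (k - j)))"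
      unfolding sSuc conv_def by (rule norm_infsum_bound[OF ns])
    also have "\<dots> \<le> (\<Sum>\<^sub>\<infinity>j. M ^ n * exp (- \<epsilon> * l1_length k) * (norm (b j) * exp (\<epsilon> * l1_length j)))"
      by (rule infsum_mono[OF ns dom ptw])
    also have "\<dots> = M ^ n * exp (- \<epsilon> * l1_length k) * M"
      unfolding M_def by (rule infsum_cmult_right')
    finally show ?case by (simp add: mult_ac)
  qed
  have ss: "(\<lambda>k. norm (s n k)) summable_on UNIV" for n
    by (rule summable_on_exp_bound[OF bnd1 \<epsilon>])
  have sft: "fseries (s n) t = of_real ((1 - \<sigma> t / \<beta>) ^ n)" for n t
    by (induction n) (simp_all add: s0 sSuc fseries_delta fseries_conv[OF bs ss] bft)
  \<comment> \<open>The floor 1/2 keeps q positive, so that ln q makes sense even for \<alpha> =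
    \<beta>.\<close>
  define q where "q = max (1/2) (1 - \<alpha> / \<beta>)"
  have q: "0 < q" "q < 1" using \<alpha> \<beta>0 by (auto simp: q_def)
  have qt: "\<bar>1 - \<sigma> t / \<beta>\<bar> \<le> q" for t
  proof -
    have "\<alpha> / \<beta> \<le> \<sigma> t / \<beta>" "\<sigma> t / \<beta> \<le> 1"
      using \<alpha>(2)[of t] \<beta>[of t] \<beta>0 by (auto intro: divide_right_mono)
    then show ?thesis by (simp add: q_def abs_le_iff)
  qed
  have bnd2: "norm (s n k) \<le> q ^ n" for n k
  proof (rule norm_coeff_le_norm_fseries[OF ss])
    show "norm (fseries (s n) t) \<le> q ^ n" for t
      unfolding sft norm_of_real power_abs by (rule power_mono[OF qt]) simp
  qed
  define N where "N = max 1 M"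
  \<comment> \<open>The solution of N^\<theta> q^(1 - \<theta>) = sqrt q, the value named \<rho>
    below; N \<ge> 1 keeps \<theta> below 1.\<close>
  define \<theta> where "\<theta> = - ln q / (2 * (ln N - ln q))"
  have lnq: "ln q < 0" and lnN: "ln N \<ge> 0" using q by (auto simp: N_def)
  have \<theta>: "0 < \<theta>" "\<theta> < 1" using lnq lnN by (auto simp: \<theta>_def divide_simps)
  define \<rho> where "\<rho> = exp (ln q / 2)"
  have \<rho>: "0 < \<rho>" "\<rho> < 1" using lnq by (auto simp: \<rho>_def)
  have bnd3: "norm (s n k) \<le> \<rho> ^ n * exp (- (\<epsilon> * \<theta>) * l1_length k)" for n k
  proof (cases "s n k = 0")
    case False
    then have p: "norm (s n k) > 0" by simp
    have N1: "N \<ge> 1" "N > 0" by (auto simp: N_def)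
    have "norm (s n k) \<le> N ^ n * exp (- \<epsilon> * l1_length k)"
      using M0 by (intro order_trans[OF bnd1] mult_right_mono power_mono) (auto simp: N_def)
    then have "ln (norm (s n k)) \<le> ln (N ^ n * exp (- \<epsilon> * l1_length k))"
      using p N1 by (subst ln_le_cancel_iff) auto
    then have l1: "ln (norm (s n k)) \<le> real n * ln N - \<epsilon> * l1_length k"
      using N1 by (simp add: ln_mult ln_realpow)
    have "ln (norm (s n k)) \<le> ln (q ^ n)"
      using p q bnd2[of n k] by (subst ln_le_cancel_iff) auto
    then have l2: "ln (norm (s n k)) \<le> real n * ln q"
      using q by (simp add: ln_realpow)
    have "ln (norm (s n k)) = \<theta> * ln (norm (s n k)) + (1 - \<theta>) * ln (norm (s n k))"
      by (simp add: algebra_simps)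
    also have "\<dots> \<le> \<theta> * (real n * ln N - \<epsilon> * l1_length k) + (1 - \<theta>) * (real n * ln q)"
      using \<theta> l1 l2 by (intro add_mono mult_left_mono) auto
    also have "\<dots> = real n * (ln q + \<theta> * (ln N - ln q)) - \<epsilon> * \<theta> * l1_length k"
      by (simp add: algebra_simps)
    also have "ln q + \<theta> * (ln N - ln q) = ln q / 2"
    proof -
      have "- x / (2 * y) * y = - x / 2" if "y \<noteq> 0" for x y :: real
        using that by simp
      moreover have "ln N - ln q \<noteq> 0" using lnq lnN by linarith
      ultimately have "\<theta> * (ln N - ln q) = - ln q / 2"
        unfolding \<theta>_def by blast
      then show ?thesis by simp
    qed
    finally have "exp (ln (norm (s n k))) \<le> exp (real n * (ln q / 2) - \<epsilon> * \<theta> * l1_length k)"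
      by simp
    also have "\<dots> = \<rho> ^ n * exp (- (\<epsilon> * \<theta>) * l1_length k)"
      unfolding \<rho>_def exp_of_nat_mult[symmetric] exp_add[symmetric] by simp
    finally show ?thesis using p by simp
  qed (use \<rho> in simp)
  have dbl: "(\<lambda>(k, n). norm (s n k)) summable_on UNIV"
  proof (rule summable_on_comparison_test)
    have "(\<lambda>n. norm (complex_of_real (\<rho> ^ n))) summable_on UNIV"
      using \<rho> by (intro summable_nonneg_imp_summable_on) (auto simp: norm_power intro!: summable_geometric)
    moreover have "(\<lambda>k :: int ^ 'd. norm (complex_of_real (exp (- (\<epsilon> * \<theta>) * l1_length k)))) summable_on UNIV"
      using summable_exp_l1_length[of "\<epsilon> * \<theta>"] \<epsilon> \<theta> by simp
    ultimately show "(\<lambda>(k :: int ^ 'd, n). norm (complex_of_real (exp (- (\<epsilon> * \<theta>) * l1_length k)) * complex_of_real (\<rho> ^ n))) summable_on UNIV"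
      by (rule summable_on_product_complex[rotated])
  qed (use bnd3 \<rho> in \<open>auto simp: norm_mult norm_power mult.commute\<close>)
  define a where "a k = of_real (1 / \<beta>) * (\<Sum>\<^sub>\<infinity>n. s n k)" for k
  have dbl': "(\<lambda>(k, n). s n k * cis (t \<bullet> grid_point 1 k)) summable_on (UNIV \<times> UNIV)" for t
    by (rule abs_summable_summable) (use dbl in \<open>simp add: case_prod_unfold norm_mult\<close>)
  show thesis
  proof
    have "(\<lambda>k. \<Sum>\<^sub>\<infinity>n. s n k) summable_on UNIV"
      by (rule summable_on_Sigma_banach) (use abs_summable_summable[OF dbl[unfolded case_prod_unfold]] in \<open>simp add: case_prod_unfold\<close>)
    then have "a summable_on UNIV"
      unfolding a_def by (rule summable_on_cmult_right)
    then show "(\<lambda>k. norm (a k)) summable_on UNIV"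
      by (rule summable_on_iff_abs_summable_on_complex[THEN iffD1])
    fix t
    let ?r = "1 - \<sigma> t / \<beta>"
    have r: "norm (complex_of_real ?r) < 1"
      unfolding norm_of_real using qt[of t] q by linarith
    have "fseries a t = of_real (1 / \<beta>) * (\<Sum>\<^sub>\<infinity>k. \<Sum>\<^sub>\<infinity>n. s n k * cis (t \<bullet> grid_point 1 k))"
      unfolding a_def fseries_cmult unfolding fseries_def infsum_cmult_left' ..
    also have "(\<Sum>\<^sub>\<infinity>k. \<Sum>\<^sub>\<infinity>n. s n k * cis (t \<bullet> grid_point 1 k)) = (\<Sum>\<^sub>\<infinity>n. \<Sum>\<^sub>\<infinity>k. s n k * cis (t \<bullet> grid_point 1 k))"
      by (rule infsum_swap_banach[OF dbl'])
    also have "\<dots> = (\<Sum>\<^sub>\<infinity>n. complex_of_real ?r ^ n)"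
      using sft by (simp add: fseries_def)
    also have "\<dots> = 1 / (1 - complex_of_real ?r)"
    proof (rule infsumI)
      have "summable (\<lambda>n. norm (complex_of_real ?r ^ n))"
        unfolding norm_power by (rule summable_geometric) (use r in simp)
      then show "((\<lambda>n. complex_of_real ?r ^ n) has_sum 1 / (1 - complex_of_real ?r)) UNIV"
        by (rule norm_summable_imp_has_sum) (rule geometric_sums[OF r])
    qed
    finally have "fseries a t = of_real (1 / \<beta>) * (1 / of_real (\<sigma> t / \<beta>))"
      by simp
    then show "fseries a t * fseries \<phi> t = 1"
      using \<alpha>(1) \<alpha>(2)[of t] \<beta>0 by (simp add: \<sigma>)
  qed
qed

text \<open>With B = 0, \<open>norm_coeff_le_norm_fseries\<close> says that a summable sequence is
  determined by its Fourier series.\<close>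

lemma conv_eq_delta:
  assumes a: "(\<lambda>k. norm (a k)) summable_on UNIV" and f: "(\<lambda>k. norm (f k)) summable_on UNIV"
    and inv: "\<And>t. fseries a t * fseries f t = 1"
  shows "conv a f = delta"
proof
  fix k
  have s: "(\<lambda>k. norm (conv a f k)) summable_on UNIV" by (rule summable_conv[OF a f])
  have "norm (conv a f k - delta k) \<le> 0"
  proof (rule norm_coeff_le_norm_fseries)
    show "(\<lambda>k. norm (conv a f k - delta k)) summable_on UNIV"
      by (rule summable_norm_diff[OF s summable_delta])
    show "norm (fseries (\<lambda>k. conv a f k - delta k) t) \<le> 0" for t
      by (simp add: fseries_diff[OF s summable_delta] fseries_conv[OF a f] inv fseries_delta)
  qed
  then show "conv a f k = delta k" by simp
qed

section \<open>Algebra of convolution and uniqueness of inverses\<close>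

lemma conv_commute:
  fixes f g :: "'g::ab_group_add \<Rightarrow> complex"
  shows "conv f g = conv g f"
proof
  fix k :: 'g
  have "bij (\<lambda>j. k - j)" by (rule bij_betwI[of _ _ _ "\<lambda>j. k - j"]) (auto simp: algebra_simps)
  from infsum_reindex_bij_betw[OF this, of "\<lambda>j. g j * f (k - j)"]
  show "conv f g k = conv g f k" by (simp add: conv_def mult.commute)
qed

lemma conv_delta_right: "conv f delta = f"
proof
  fix k
  show "conv f delta k = f k"
    unfolding conv_commute[of f] conv_def by (subst infsum_delta) simp
qed

text \<open>The usual chain c = (a * f) * c = a * (f * c) = a. As c is merely bounded, associativity
  is proved by hand: the double family is dominated by the summable kernel of a and f times a bound
  for c.\<close>

lemma conv_inverse_unique:
  fixes a f c :: "'g::ab_group_add \<Rightarrow> complex"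
  assumes a: "(\<lambda>k. norm (a k)) summable_on UNIV" and f: "(\<lambda>k. norm (f k)) summable_on UNIV"
    and af: "conv a f = delta" and c: "bounded (range c)" and fc: "conv f c = delta"
  shows "c = a"
proof
  fix k :: 'g
  obtain B where B: "\<And>j. norm (c j) \<le> B"
    using c by (auto simp: bounded_iff)
  have "(\<lambda>(j, l). norm (a l * f (j - l)) * B) summable_on UNIV"
    using summable_on_cmult_left[OF summable_on_conv_kernel[OF a f], of B] by (simp add: case_prod_unfold)
  then have Kn: "(\<lambda>(j, l). norm (a l * f (j - l) * c (k - j))) summable_on UNIV"
  proof (rule summable_on_comparison_test)
    fix x :: "'g \<times> 'g"
    show "(case x of (j, l) \<Rightarrow> norm (a l * f (j - l) * c (k - j))) \<le> (case x of (j, l) \<Rightarrow> norm (a l * f (j - l)) * B)"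
      unfolding case_prod_unfold norm_mult[of "_ * _"] by (intro mult_left_mono B norm_ge_zero)
  qed (simp add: case_prod_unfold)
  have K: "(\<lambda>(j, l). a l * f (j - l) * c (k - j)) summable_on (UNIV \<times> UNIV)"
    by (rule abs_summable_summable) (use Kn in \<open>simp add: case_prod_unfold\<close>)
  have "c k = conv delta c k"
    by (simp only: conv_commute[of delta] conv_delta_right)
  also have "\<dots> = (\<Sum>\<^sub>\<infinity>j. \<Sum>\<^sub>\<infinity>l. a l * f (j - l) * c (k - j))"
    unfolding af[symmetric] by (simp only: conv_def infsum_cmult_left')
  also have "\<dots> = (\<Sum>\<^sub>\<infinity>l. \<Sum>\<^sub>\<infinity>j. a l * f (j - l) * c (k - j))"
    by (rule infsum_swap_banach[OF K])
  also have "\<dots> = (\<Sum>\<^sub>\<infinity>l. a l * conv f c (k - l))"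
  proof (rule infsum_cong)
    fix l :: 'g
    have "bij (\<lambda>j. j + l)" by (rule bij_betwI[of _ _ _ "\<lambda>j. j - l"]) auto
    from infsum_reindex_bij_betw[OF this, of "\<lambda>j. a l * f (j - l) * c (k - j)"]
    have "(\<Sum>\<^sub>\<infinity>j. a l * f (j - l) * c (k - j)) = (\<Sum>\<^sub>\<infinity>j. a l * (f j * c (k - l - j)))"
      by (simp add: algebra_simps)
    then show "(\<Sum>\<^sub>\<infinity>j. a l * f (j - l) * c (k - j)) = a l * conv f c (k - l)"
      by (simp only: conv_def infsum_cmult_right')
  qed
  also have "\<dots> = conv a delta k" by (simp add: fc conv_def)
  finally show "c k = a k" by (simp add: conv_delta_right)
qed

section \<open>The interpolation error\<close>

lemma matern_minus: "matern m (- x) = matern m x"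
  by (simp add: matern_def Let_def)

lemma infsum_ge_term:
  fixes f :: "'a \<Rightarrow> real"
  assumes "f summable_on UNIV" "\<And>x. f x \<ge> 0"
  shows "f k \<le> infsum f UNIV"
  using finite_sum_le_infsum[of f UNIV "{k}"] assms by auto

lemma infsum_complex_of_real:
  "f summable_on A \<Longrightarrow> (\<Sum>\<^sub>\<infinity>x\<in>A. complex_of_real (f x)) = of_real (infsum f A)"
  by (intro infsumI has_sum_of_real has_sum_infsum)

text \<open>
  Up to a constant factor, the Fourier transform of the Matern kernel.
\<close>

definition sobolev_symbol :: "nat \<Rightarrow> real ^ 'd \<Rightarrow> real" where
  "sobolev_symbol m \<xi> = 1 / (1 + (norm \<xi>)\<^sup>2) ^ m"

lemma sobolev_symbol_pos: "sobolev_symbol m \<xi> > 0"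
  unfolding sobolev_symbol_def by (intro divide_pos_pos zero_less_power add_pos_nonneg) auto

text \<open>By Poisson summation this is, up to a positive factor independent of \<omega>, the
  symbol \<sigma>_m(h \<omega>, h) of the samples \<Phi>(h k).\<close>

definition alias_sum :: "nat \<Rightarrow> real \<Rightarrow> real ^ 'd \<Rightarrow> real" where
  "alias_sum m h \<omega> = (\<Sum>\<^sub>\<infinity>k. sobolev_symbol m (\<omega> + grid_point (2 * pi / h) k))"

definition matern_samples :: "nat \<Rightarrow> real \<Rightarrow> real ^ 'd \<Rightarrow> int ^ 'd \<Rightarrow> complex" where
  "matern_samples m h x n = of_real (matern m (x - grid_point h n))"

context
  fixes m :: nat and h :: real
  assumes m: "real m > real CARD('d::finite) / 2" and h: "h > 0"
begin

lemma summable_alias: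
  fixes \<omega> :: "real ^ 'd"
  shows "(\<lambda>k. sobolev_symbol m (\<omega> + grid_point (2 * pi / h) k)) summable_on UNIV"
  unfolding sobolev_symbol_def by (rule summable_inverse_power_grid_shift[OF m]) (use h in simp)

lemma alias_sum_ge:
  fixes \<omega> :: "real ^ 'd"
  shows "sobolev_symbol m (\<omega> + grid_point (2 * pi / h) k) \<le> alias_sum m h \<omega>"
  unfolding alias_sum_def by (rule infsum_ge_term[OF summable_alias]) (simp add: sobolev_symbol_pos less_imp_le)

lemma alias_sum_pos: "alias_sum m h (\<omega> :: real ^ 'd) > 0"
  using alias_sum_ge[of \<omega> 0] sobolev_symbol_pos[of m "\<omega> + grid_point (2 * pi / h) 0"] by linarith

text \<open>Some alias of \<omega> lies in the cube |\<xi>_i| \<le> \<pi> / h, where g is at least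
  its value at a corner. The bound depends on h; it only has to make the samples invertible for each
  fixed h.\<close>

lemma alias_sum_lower_bound:
  obtains g where "g > 0" "\<And>\<omega> :: real ^ 'd. g \<le> alias_sum m h \<omega>"
proof
  let ?g = "1 / (1 + real CARD('d) * (pi / h)\<^sup>2) ^ m"
  show "?g > 0" by (intro divide_pos_pos zero_less_power add_pos_nonneg) auto
  fix \<omega> :: "real ^ 'd"
  define k :: "int ^ 'd" where "k = (\<chi> i. - round (\<omega> $ i * h / (2 * pi)))"
  let ?\<xi> = "\<omega> + grid_point (2 * pi / h) k"
  have "(?\<xi> $ i)\<^sup>2 \<le> (pi / h)\<^sup>2" for i
  proof -
    have "\<bar>of_int (round (\<omega> $ i * h / (2 * pi))) - \<omega> $ i * h / (2 * pi)\<bar> \<le> 1/2"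
      by (rule of_int_round_abs_le)
    then have "2 * pi / h * \<bar>of_int (round (\<omega> $ i * h / (2 * pi))) - \<omega> $ i * h / (2 * pi)\<bar> \<le> 2 * pi / h * (1/2)"
      using h by (intro mult_left_mono) auto
    also have "2 * pi / h * \<bar>of_int (round (\<omega> $ i * h / (2 * pi))) - \<omega> $ i * h / (2 * pi)\<bar> =
        \<bar>2 * pi / h * (of_int (round (\<omega> $ i * h / (2 * pi))) - \<omega> $ i * h / (2 * pi))\<bar>"
      using h by (simp add: abs_mult)
    also have "2 * pi / h * (of_int (round (\<omega> $ i * h / (2 * pi))) - \<omega> $ i * h / (2 * pi)) = - (?\<xi> $ i)"
      using h by (simp add: k_def grid_point_def right_diff_distrib)
    finally have "\<bar>?\<xi> $ i\<bar> \<le> pi / h" by simp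
    then show ?thesis
      using power_mono[of "\<bar>?\<xi> $ i\<bar>" "pi / h" 2] by simp
  qed
  then have "(norm ?\<xi>)\<^sup>2 \<le> real CARD('d) * (pi / h)\<^sup>2"
    unfolding norm_vec_power2 using sum_bounded_above[of UNIV "\<lambda>i. (?\<xi> $ i)\<^sup>2" "(pi / h)\<^sup>2"] by simp
  then have "?g \<le> sobolev_symbol m ?\<xi>"
    unfolding sobolev_symbol_def by (intro divide_left_mono power_mono mult_pos_pos zero_less_power add_pos_nonneg) auto
  also have "\<dots> \<le> alias_sum m h \<omega>" by (rule alias_sum_ge)
  finally show "?g \<le> alias_sum m h \<omega>" .
qed

section \<open>Kernel samples and the Lagrange function\<close>

lemma summable_matern_samples: "(\<lambda>n. norm (matern_samples m h (x :: real ^ 'd) n)) summable_on UNIV"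
  using summable_matern_grid[OF m h, of x] matern_nonneg[OF m] by (simp add: matern_samples_def)

lemma matern_samples_0_minus: "matern_samples m h (0 :: real ^ 'd) (- n) = matern_samples m h 0 n"
  by (simp add: matern_samples_def grid_point_minus matern_minus)

lemma matern_samples_grid: "matern_samples m h (grid_point h j :: real ^ 'd) n = matern_samples m h 0 (j - n)"
proof -
  have "grid_point h j - grid_point h n = - (0 - grid_point h (j - n) :: real ^ 'd)"
    by (simp add: grid_point_diff)
  then show ?thesis unfolding matern_samples_def by (simp only: matern_minus)
qed

text \<open>Sampling on the scaled grid rescales the frequency to h \<omega>. The factor
  \<open>A\<close>, common to all x and \<omega>, stays anonymous because it cancels in quotients of
  two such series.\<close>

lemma fseries_matern_samples:
  obtains A where "A > 0" "\<And>x \<omega> :: real ^ 'd. fseries (matern_samples m h x) (h *\<^sub>R \<omega>) =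
    of_real A * (\<Sum>\<^sub>\<infinity>k. of_real (sobolev_symbol m (\<omega> + grid_point (2 * pi / h) k)) * cis ((\<omega> + grid_point (2 * pi / h) k) \<bullet> x))"
proof
  let ?A = "2 powr (real m - real CARD('d) / 2 - 1) * (sqrt (4 * pi) / h) ^ CARD('d) * Gamma (real m)"
  have "real m > 0" using m by (rule le_less_trans[rotated]) simp
  then show "?A > 0" using h by (simp add: Gamma_real_pos)
  fix x \<omega> :: "real ^ 'd"
  have "(h *\<^sub>R \<omega>) \<bullet> grid_point 1 n = \<omega> \<bullet> grid_point h n" for n
    by (simp add: inner_vec_def grid_point_def mult_ac sum_distrib_left)
  then show "fseries (matern_samples m h x) (h *\<^sub>R \<omega>) =
    of_real ?A * (\<Sum>\<^sub>\<infinity>k. of_real (sobolev_symbol m (\<omega> + grid_point (2 * pi / h) k)) * cis ((\<omega> + grid_point (2 * pi / h) k) \<bullet> x))"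
    unfolding fseries_def matern_samples_def sobolev_symbol_def using poisson_matern[OF m h, of x \<omega>] by simp
qed

lemma fseries_matern_samples_0:
  obtains A where "A > 0" "\<And>\<omega> :: real ^ 'd. fseries (matern_samples m h 0) (h *\<^sub>R \<omega>) = of_real (A * alias_sum m h \<omega>)"
    "\<And>x \<omega> :: real ^ 'd. fseries (matern_samples m h x) (h *\<^sub>R \<omega>) =
    of_real A * (\<Sum>\<^sub>\<infinity>k. of_real (sobolev_symbol m (\<omega> + grid_point (2 * pi / h) k)) * cis ((\<omega> + grid_point (2 * pi / h) k) \<bullet> x))"
proof -
  obtain A where A: "A > 0" "\<And>x \<omega> :: real ^ 'd. fseries (matern_samples m h x) (h *\<^sub>R \<omega>) =
    of_real A * (\<Sum>\<^sub>\<infinity>k. of_real (sobolev_symbol m (\<omega> + grid_point (2 * pi / h) k)) * cis ((\<omega> + grid_point (2 * pi / h) k) \<bullet> x))"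
    by (rule fseries_matern_samples, erule that)
  show thesis
  proof (rule that[OF A(1) _ A(2)])
    fix \<omega> :: "real ^ 'd"
    have "(\<Sum>\<^sub>\<infinity>k. complex_of_real (sobolev_symbol m (\<omega> + grid_point (2 * pi / h) k))) = of_real (alias_sum m h \<omega>)"
      unfolding alias_sum_def by (rule infsum_complex_of_real[OF summable_alias])
    then show "fseries (matern_samples m h 0) (h *\<^sub>R \<omega>) = of_real (A * alias_sum m h \<omega>)"
      unfolding A(2) by simp
  qed
qed

lemma matern_samples_inverse:
  obtains a :: "int ^ 'd \<Rightarrow> complex"
  where "(\<lambda>k. norm (a k)) summable_on UNIV" "\<And>t. fseries a t * fseries (matern_samples m h 0) t = 1"
proof -
  let ?\<phi> = "matern_samples m h (0 :: real ^ 'd)"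
  obtain C \<delta> where C: "C \<ge> 0" "\<delta> > 0"
    "\<And>(x :: real ^ 'd) k. matern m (x - grid_point h k) \<le> C * exp (norm x / 2) * exp (- \<delta> * l1_length k)"
    by (rule matern_grid_decay[OF m h], erule that)
  obtain A where A: "A > 0" "\<And>\<omega> :: real ^ 'd. fseries ?\<phi> (h *\<^sub>R \<omega>) = of_real (A * alias_sum m h \<omega>)"
    "\<And>x \<omega> :: real ^ 'd. fseries (matern_samples m h x) (h *\<^sub>R \<omega>) =
    of_real A * (\<Sum>\<^sub>\<infinity>k. of_real (sobolev_symbol m (\<omega> + grid_point (2 * pi / h) k)) * cis ((\<omega> + grid_point (2 * pi / h) k) \<bullet> x))"
    by (rule fseries_matern_samples_0, erule that)
  obtain g where g: "g > 0" "\<And>\<omega> :: real ^ 'd. g \<le> alias_sum m h \<omega>"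
    by (rule alias_sum_lower_bound, erule that)
  \<comment> \<open>The symbol as a function of t = h \<omega>. Its lower bound comes from the alias
    sum and its upper bound from the l1 norm of the samples.\<close>
  define \<sigma> where "\<sigma> t = A * alias_sum m h ((1 / h) *\<^sub>R t)" for t :: "real ^ 'd"
  have \<sigma>: "fseries ?\<phi> t = of_real (\<sigma> t)" for t
    using A(2)[of "(1 / h) *\<^sub>R t"] h by (simp add: \<sigma>_def)
  show thesis
  proof (rule exists_fseries_inverse[where \<phi> = ?\<phi> and \<sigma> = \<sigma> and \<delta> = \<delta> and C = C and \<alpha> = "A * g" and \<beta> = "\<Sum>\<^sub>\<infinity>k. norm (?\<phi> k)"])
    show "norm (?\<phi> k) \<le> C * exp (- \<delta> * l1_length k)" for k
      using C(3)[of 0 k] matern_nonneg[OF m, of "0 - grid_point h k"] by (simp add: matern_samples_def)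
    show "A * g \<le> \<sigma> t" for t
      unfolding \<sigma>_def using A(1) g(2) by (intro mult_left_mono) auto
    show "\<sigma> t \<le> (\<Sum>\<^sub>\<infinity>k. norm (?\<phi> k))" for t
    proof -
      have "norm (fseries ?\<phi> t) \<le> (\<Sum>\<^sub>\<infinity>k. norm (?\<phi> k * cis (t \<bullet> grid_point 1 k)))"
        unfolding fseries_def by (rule norm_infsum_bound) (simp add: norm_mult summable_matern_samples)
      then show ?thesis unfolding \<sigma> by (simp add: norm_mult)
    qed
  qed (use C A g \<sigma> that in auto)
qed

text \<open>On the grid a kernel series takes the values of its coefficients convolved with the
  samples, so the interpolation conditions ask for a convolution inverse. Its uniqueness among
  bounded sequences makes the definite description denote.\<close>

lemma lagrange_fun_eq:
  fixes a :: "int ^ 'd \<Rightarrow> complex"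
  assumes a: "(\<lambda>k. norm (a k)) summable_on UNIV" "\<And>t. fseries a t * fseries (matern_samples m h 0) t = 1"
  shows "lagrange_fun m h = (\<lambda>x :: real ^ 'd. \<Sum>\<^sub>\<infinity>k. a k * of_real (matern m (x - grid_point h k)))"
proof -
  let ?\<phi> = "matern_samples m h (0 :: real ^ 'd)"
  have a\<phi>: "conv a ?\<phi> = delta"
    by (rule conv_eq_delta[OF a(1) summable_matern_samples a(2)])
  have val: "(\<Sum>\<^sub>\<infinity>k. c k * of_real (matern m (grid_point h j - grid_point h k))) = conv c ?\<phi> j" for c j
    unfolding conv_def matern_samples_grid[symmetric] unfolding matern_samples_def ..
  have ab: "bounded (range a)"
  proof -
    have "norm (a k) \<le> (\<Sum>\<^sub>\<infinity>k. norm (a k))" for k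
      by (rule infsum_ge_term[OF a(1)]) simp
    then show ?thesis by (auto simp: bounded_iff)
  qed
  show ?thesis
    unfolding lagrange_fun_def
  proof (rule the_equality)
    let ?L = "\<lambda>x :: real ^ 'd. \<Sum>\<^sub>\<infinity>k. a k * of_real (matern m (x - grid_point h k))"
    show "?L \<in> matern_space m h \<and> (\<forall>j. ?L (grid_point h j) = (if j = 0 then 1 else 0))"
      unfolding val a\<phi> using ab by (auto simp: matern_space_def delta_def)
    fix L :: "real ^ 'd \<Rightarrow> complex"
    assume L: "L \<in> matern_space m h \<and> (\<forall>j. L (grid_point h j) = (if j = 0 then 1 else 0))"
    then obtain c where c: "L = (\<lambda>x. \<Sum>\<^sub>\<infinity>j. c j * of_real (matern m (x - grid_point h j)))" "bounded (range c)"
      by (auto simp: matern_space_def)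
    have "conv ?\<phi> c = delta"
    proof
      fix j
      show "conv ?\<phi> c j = delta j"
        using L val[of c j] by (simp add: c(1) delta_def conv_commute[of ?\<phi>])
    qed
    from conv_inverse_unique[OF a(1) summable_matern_samples a\<phi> c(2) this]
    show "L = ?L" by (simp add: c(1))
  qed
qed

text \<open>As a sequence in j, the values of the Lagrange function at x - h j are the convolution
  of the reflected coefficients with the samples at x. Its Fourier series is therefore a product, in
  which the inverse of the series at x = 0 becomes the denominator.\<close>

lemma
  fixes x :: "real ^ 'd"
  shows summable_lagrange_fun: "(\<lambda>j. norm (lagrange_fun m h (x - grid_point h j))) summable_on UNIV"
    and infsum_cis_lagrange_fun: "(\<Sum>\<^sub>\<infinity>j. cis (\<omega> \<bullet> grid_point h j) * lagrange_fun m h (x - grid_point h j)) =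
      (\<Sum>\<^sub>\<infinity>k. of_real (sobolev_symbol m (\<omega> + grid_point (2 * pi / h) k)) * cis ((\<omega> + grid_point (2 * pi / h) k) \<bullet> x)) /
      of_real (alias_sum m h \<omega>)"
proof -
  let ?\<phi> = "matern_samples m h (0 :: real ^ 'd)"
  obtain a :: "int ^ 'd \<Rightarrow> complex" where a: "(\<lambda>k. norm (a k)) summable_on UNIV" "\<And>t. fseries a t * fseries ?\<phi> t = 1"
    by (rule matern_samples_inverse, erule that)
  obtain A where A: "A > 0" "\<And>\<omega> :: real ^ 'd. fseries ?\<phi> (h *\<^sub>R \<omega>) = of_real (A * alias_sum m h \<omega>)"
    "\<And>x \<omega> :: real ^ 'd. fseries (matern_samples m h x) (h *\<^sub>R \<omega>) =
    of_real A * (\<Sum>\<^sub>\<infinity>k. of_real (sobolev_symbol m (\<omega> + grid_point (2 * pi / h) k)) * cis ((\<omega> + grid_point (2 * pi / h) k) \<bullet> x))"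
    by (rule fseries_matern_samples_0, erule that)
  have neg: "(\<Sum>\<^sub>\<infinity>k. H (- k)) = (\<Sum>\<^sub>\<infinity>k. H k)" for H :: "int ^ 'd \<Rightarrow> complex"
    by (rule infsum_reindex_bij_betw) (rule bij_uminus)
  have as: "(\<lambda>k. norm (a (- k))) summable_on UNIV"
    using a(1) summable_on_reindex_bij_betw[OF bij_uminus, of "\<lambda>k. norm (a k)"] by simp
  have L: "lagrange_fun m h (x - grid_point h j) = conv (\<lambda>k. a (- k)) (matern_samples m h x) j" for j
  proof -
    have "x - grid_point h j - grid_point h k = x - grid_point h (j - (- k))" for k
      by (simp add: grid_point_add)
    then have "lagrange_fun m h (x - grid_point h j) = (\<Sum>\<^sub>\<infinity>k. a (- (- k)) * matern_samples m h x (j - (- k)))"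
      unfolding lagrange_fun_eq[OF a] matern_samples_def by (simp only: minus_minus)
    also have "\<dots> = conv (\<lambda>k. a (- k)) (matern_samples m h x) j"
      unfolding conv_def by (rule neg[of "\<lambda>k. a (- k) * matern_samples m h x (j - k)"])
    finally show ?thesis .
  qed
  show "(\<lambda>j. norm (lagrange_fun m h (x - grid_point h j))) summable_on UNIV"
    unfolding L by (rule summable_conv[OF as summable_matern_samples])
  have ft_neg: "fseries (\<lambda>k. H (- k)) t = fseries H (- t)" for H :: "int ^ 'd \<Rightarrow> complex" and t
    unfolding fseries_def using neg[of "\<lambda>k. H k * cis ((- t) \<bullet> grid_point 1 k)"] by (simp add: grid_point_minus)
  \<comment> \<open>Reflecting the coefficients replaces h \<omega> by - h \<omega>, a change that
    the even kernel does not see.\<close>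
  have "fseries ?\<phi> (- (h *\<^sub>R \<omega>)) = fseries ?\<phi> (h *\<^sub>R \<omega>)"
    using ft_neg[of ?\<phi> "h *\<^sub>R \<omega>"] by (simp add: matern_samples_0_minus)
  then have inv: "fseries (\<lambda>k. a (- k)) (h *\<^sub>R \<omega>) * of_real (A * alias_sum m h \<omega>) = 1"
    using a(2)[of "- (h *\<^sub>R \<omega>)"] by (simp add: ft_neg A(2))
  have "(h *\<^sub>R \<omega>) \<bullet> grid_point 1 n = \<omega> \<bullet> grid_point h n" for n
    by (simp add: inner_vec_def grid_point_def mult_ac sum_distrib_left)
  then have "(\<Sum>\<^sub>\<infinity>j. cis (\<omega> \<bullet> grid_point h j) * lagrange_fun m h (x - grid_point h j)) =
      fseries (conv (\<lambda>k. a (- k)) (matern_samples m h x)) (h *\<^sub>R \<omega>)"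
    unfolding L fseries_def by (simp add: mult.commute)
  also have "\<dots> = fseries (\<lambda>k. a (- k)) (h *\<^sub>R \<omega>) * fseries (matern_samples m h x) (h *\<^sub>R \<omega>)"
    by (rule fseries_conv[OF as summable_matern_samples])
  also have "fseries (\<lambda>k. a (- k)) (h *\<^sub>R \<omega>) = 1 / of_real (A * alias_sum m h \<omega>)"
    using inv by (metis eq_divide_eq_1 mult_eq_0_iff nonzero_eq_divide_eq zero_neq_one)
  finally show "(\<Sum>\<^sub>\<infinity>j. cis (\<omega> \<bullet> grid_point h j) * lagrange_fun m h (x - grid_point h j)) =
      (\<Sum>\<^sub>\<infinity>k. of_real (sobolev_symbol m (\<omega> + grid_point (2 * pi / h) k)) * cis ((\<omega> + grid_point (2 * pi / h) k) \<bullet> x)) /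
      of_real (alias_sum m h \<omega>)"
    unfolding A(3) using A(1) by simp
qed

lemma measurable_lagrange_fun: "(lagrange_fun m h :: real ^ 'd \<Rightarrow> complex) \<in> borel_measurable borel"
proof -
  obtain a :: "int ^ 'd \<Rightarrow> complex" where a: "(\<lambda>k. norm (a k)) summable_on UNIV" "\<And>t. fseries a t * fseries (matern_samples m h 0) t = 1"
    by (rule matern_samples_inverse, erule that)
  have [measurable]: "(matern m :: real ^ 'd \<Rightarrow> real) \<in> borel_measurable borel"
    by (rule measurable_matern[OF m])
  show ?thesis
    unfolding lagrange_fun_eq[OF a] by (rule borel_measurable_infsum) measurable
qed

text \<open>\<open>Linf_norm\<close> is infinite when the modulus is not measurable, so the final
  bound depends on this.\<close>

lemma measurable_interpolant: "interpolant m h (f :: real ^ 'd \<Rightarrow> complex) \<in> borel_measurable borel"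
proof -
  note measurable_lagrange_fun[measurable]
  show ?thesis
    unfolding interpolant_def[abs_def] by (rule borel_measurable_infsum) measurable
qed

text \<open>In the box, an alias \<xi> with k_i nonzero has |\<xi>_i| \<ge> 2 \<pi> |k_i| / h -
  \<pi> / h \<ge> |k_i| / h, so |\<xi>|^2 \<ge> |k|^2 / h^2, which is at least (1 + |k|^2) / (2 h^2)
  as |k| \<ge> 1. Hence the factor 2^m h^(2m), with a remaining sum free of h and \<omega>.\<close>

lemma alias_tail_le:
  fixes \<omega> :: "real ^ 'd"
  defines "C \<equiv> (\<Sum>\<^sub>\<infinity>k :: int ^ 'd. 2 ^ m * sobolev_symbol m (grid_point 1 k :: real ^ 'd))"
  assumes box: "\<And>i. \<bar>\<omega> $ i\<bar> \<le> pi / h"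
  shows "(\<Sum>\<^sub>\<infinity>k. if k = 0 then 0 else sobolev_symbol m (\<omega> + grid_point (2 * pi / h) k)) \<le> C * h ^ (2 * m)"
proof -
  let ?t = "\<lambda>k. if k = 0 then 0 else sobolev_symbol m (\<omega> + grid_point (2 * pi / h) k)"
  let ?b = "\<lambda>k. 2 ^ m * sobolev_symbol m (grid_point 1 k :: real ^ 'd) * h ^ (2 * m)"
  have bs: "?b summable_on UNIV"
    unfolding sobolev_symbol_def by (intro summable_on_cmult_left summable_on_cmult_right summable_inverse_power_grid[OF m])
  have tb: "?t k \<le> ?b k" for k
  proof (cases "k = 0")
    case False
    let ?\<xi> = "\<omega> + grid_point (2 * pi / h) k" and ?K = "grid_point 1 k :: real ^ 'd"
    have "(?K $ i)\<^sup>2 / h\<^sup>2 \<le> (?\<xi> $ i)\<^sup>2" for i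
    proof -
      have "\<bar>of_int (k $ i)\<bar> / h \<le> \<bar>?\<xi> $ i\<bar>"
      proof (cases "k $ i = 0")
        case False
        then have k1: "1 \<le> \<bar>real_of_int (k $ i)\<bar>" by linarith
        have "\<bar>real_of_int (k $ i)\<bar> + pi \<le> 2 * pi * \<bar>real_of_int (k $ i)\<bar>"
        proof -
          have "\<bar>real_of_int (k $ i)\<bar> \<le> pi * \<bar>real_of_int (k $ i)\<bar>"
            using pi_ge_two k1 by (intro mult_right_mono[of 1 pi, simplified]) auto
          moreover have "pi \<le> pi * \<bar>real_of_int (k $ i)\<bar>"
            using k1 by simp
          ultimately show ?thesis by linarith
        qed
        then have "\<bar>of_int (k $ i)\<bar> / h + pi / h \<le> 2 * pi * \<bar>real_of_int (k $ i)\<bar> / h"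
          using h unfolding add_divide_distrib[symmetric] by (intro divide_right_mono) auto
        also have "\<dots> = \<bar>2 * pi / h * of_int (k $ i)\<bar>"
          using h by (simp add: abs_mult)
        also have "\<dots> \<le> \<bar>?\<xi> $ i\<bar> + \<bar>\<omega> $ i\<bar>"
          by (simp add: grid_point_def)
        finally show ?thesis using box[of i] by linarith
      qed simp
      then have "(\<bar>of_int (k $ i)\<bar> / h)\<^sup>2 \<le> \<bar>?\<xi> $ i\<bar>\<^sup>2"
        using h by (intro power_mono) auto
      then show ?thesis by (simp add: grid_point_def power_divide)
    qed
    then have 1: "(norm ?K)\<^sup>2 / h\<^sup>2 \<le> (norm ?\<xi>)\<^sup>2"
      unfolding norm_vec_power2 sum_divide_distrib by (rule sum_mono)
    obtain i where i: "k $ i \<noteq> 0" using False by (auto simp: vec_eq_iff)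
    have "1 \<le> (?K $ i)\<^sup>2"
    proof -
      have "1 \<le> \<bar>real_of_int (k $ i)\<bar>" using i by linarith
      then show ?thesis using power_mono[of 1 "\<bar>real_of_int (k $ i)\<bar>" 2] by (simp add: grid_point_def)
    qed
    also have "\<dots> \<le> (norm ?K)\<^sup>2"
      using power_mono[OF component_le_norm_cart[of ?K i], of 2] by simp
    finally have K1: "1 \<le> (norm ?K)\<^sup>2" .
    have "(1 + (norm ?K)\<^sup>2) / (2 * h\<^sup>2) \<le> (norm ?K)\<^sup>2 / h\<^sup>2"
      using K1 h by (simp add: field_simps)
    then have 2: "(1 + (norm ?K)\<^sup>2) / (2 * h\<^sup>2) \<le> 1 + (norm ?\<xi>)\<^sup>2"
      using 1 by linarith
    have "((1 + (norm ?K)\<^sup>2) / (2 * h\<^sup>2)) ^ m \<le> (1 + (norm ?\<xi>)\<^sup>2) ^ m"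
      using h by (intro power_mono 2) auto
    then have "sobolev_symbol m ?\<xi> \<le> 1 / ((1 + (norm ?K)\<^sup>2) / (2 * h\<^sup>2)) ^ m"
      unfolding sobolev_symbol_def using h
      by (intro divide_left_mono mult_pos_pos zero_less_power divide_pos_pos add_pos_nonneg) auto
    also have "\<dots> = ?b k"
      by (simp add: sobolev_symbol_def power_divide power_mult_distrib power_mult)
    finally show ?thesis using False by simp
  qed (use sobolev_symbol_pos[of m "grid_point 1 k :: real ^ 'd"] h in simp)
  have "?t summable_on UNIV"
    by (rule summable_on_comparison_test[OF bs tb]) (simp add: sobolev_symbol_pos less_imp_le)
  then have "infsum ?t UNIV \<le> infsum ?b UNIV"
    by (rule infsum_mono[OF _ bs tb])
  also have "\<dots> = C * h ^ (2 * m)"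
    unfolding C_def by (rule infsum_cmult_left')
  finally show ?thesis .
qed

text \<open>The interpolant is the average of the aliased exponentials at x with weights
  g(\<omega>_k) / G, and cis (\<omega> \<bullet> x) is the same average of itself. The terms with k
  = 0 cancel, and every other one contributes at most twice its weight.\<close>

lemma exponential_interpolation_error:
  fixes \<omega> x :: "real ^ 'd"
  defines "C \<equiv> (\<Sum>\<^sub>\<infinity>k :: int ^ 'd. 2 ^ m * sobolev_symbol m (grid_point 1 k :: real ^ 'd))"
  shows "norm (cis (\<omega> \<bullet> x) - (\<Sum>\<^sub>\<infinity>j. cis (\<omega> \<bullet> grid_point h j) * lagrange_fun m h (x - grid_point h j)))
    \<le> (2 * C + 2) * (h ^ (2 * m) * (1 + (norm \<omega>)\<^sup>2) ^ m)"
proof -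
  let ?\<xi> = "\<lambda>k. \<omega> + grid_point (2 * pi / h) k"
  let ?g = "\<lambda>k. sobolev_symbol m (?\<xi> k)"
  let ?t = "\<lambda>k. if k = 0 then 0 else ?g k"
  define G where "G = alias_sum m h \<omega>"
  define T where "T = infsum ?t UNIV"
  have g0: "?g k \<ge> 0" for k using sobolev_symbol_pos[of m "?\<xi> k"] by simp
  have G: "G > 0" by (simp add: G_def alias_sum_pos)
  have ts: "?t summable_on UNIV"
    by (rule summable_on_comparison_test[OF summable_alias[of \<omega>]]) (use g0 in auto)
  have TG: "T \<le> G"
    unfolding T_def G_def alias_sum_def by (rule infsum_mono[OF ts summable_alias]) (use g0 in auto)
  have C0: "C \<ge> 0"
    unfolding C_def by (intro infsum_nonneg mult_nonneg_nonneg) (simp_all add: sobolev_symbol_pos less_imp_le)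
  have gs1: "(\<lambda>k. of_real (?g k) * cis (\<omega> \<bullet> x)) summable_on UNIV" and gs2: "(\<lambda>k. of_real (?g k) * cis (?\<xi> k \<bullet> x)) summable_on UNIV"
    by (rule abs_summable_summable, use summable_alias[of \<omega>] g0 in \<open>simp add: norm_mult\<close>)+
  have "cis (\<omega> \<bullet> x) = (\<Sum>\<^sub>\<infinity>k. of_real (?g k) * cis (\<omega> \<bullet> x)) / of_real G"
    using G by (simp add: infsum_cmult_left' infsum_complex_of_real[OF summable_alias] alias_sum_def[symmetric] G_def[symmetric])
  then have "cis (\<omega> \<bullet> x) - (\<Sum>\<^sub>\<infinity>j. cis (\<omega> \<bullet> grid_point h j) * lagrange_fun m h (x - grid_point h j)) =
      ((\<Sum>\<^sub>\<infinity>k. of_real (?g k) * cis (\<omega> \<bullet> x)) - (\<Sum>\<^sub>\<infinity>k. of_real (?g k) * cis (?\<xi> k \<bullet> x))) / of_real G"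
    unfolding infsum_cis_lagrange_fun G_def diff_divide_distrib by simp
  also have "(\<Sum>\<^sub>\<infinity>k. of_real (?g k) * cis (\<omega> \<bullet> x)) - (\<Sum>\<^sub>\<infinity>k. of_real (?g k) * cis (?\<xi> k \<bullet> x)) =
      (\<Sum>\<^sub>\<infinity>k. of_real (?g k) * cis (\<omega> \<bullet> x) - of_real (?g k) * cis (?\<xi> k \<bullet> x))"
    using infsumI[OF has_sum_add[OF has_sum_infsum[OF gs1] has_sum_uminusI[OF has_sum_infsum[OF gs2]]]] by simp
  also have "norm (\<dots> / of_real G) \<le> 2 * T / G"
  proof -
    have ptw: "norm (of_real (?g k) * cis (\<omega> \<bullet> x) - of_real (?g k) * cis (?\<xi> k \<bullet> x)) \<le> 2 * ?t k" for k
    proof (cases "k = 0")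
      case True
      then show ?thesis by (simp add: grid_point_0)
    next
      case False
      have "norm (of_real (?g k) * cis (\<omega> \<bullet> x) - of_real (?g k) * cis (?\<xi> k \<bullet> x)) = ?g k * norm (cis (\<omega> \<bullet> x) - cis (?\<xi> k \<bullet> x))"
        using g0 by (simp add: norm_mult flip: right_diff_distrib)
      also have "\<dots> \<le> ?g k * 2"
        using norm_triangle_ineq4[of "cis (\<omega> \<bullet> x)" "cis (?\<xi> k \<bullet> x)"] g0 by (intro mult_left_mono) auto
      finally show ?thesis using False by simp
    qed
    have ts2: "(\<lambda>k. 2 * ?t k) summable_on UNIV" by (rule summable_on_cmult_right[OF ts])
    have ns: "(\<lambda>k. norm (of_real (?g k) * cis (\<omega> \<bullet> x) - of_real (?g k) * cis (?\<xi> k \<bullet> x))) summable_on UNIV"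
      by (rule summable_on_comparison_test[OF ts2 ptw]) simp
    have "norm (\<Sum>\<^sub>\<infinity>k. of_real (?g k) * cis (\<omega> \<bullet> x) - of_real (?g k) * cis (?\<xi> k \<bullet> x)) \<le>
        (\<Sum>\<^sub>\<infinity>k. norm (of_real (?g k) * cis (\<omega> \<bullet> x) - of_real (?g k) * cis (?\<xi> k \<bullet> x)))"
      by (rule norm_infsum_bound[OF ns])
    also have "\<dots> \<le> (\<Sum>\<^sub>\<infinity>k. 2 * ?t k)"
      by (rule infsum_mono[OF ns ts2 ptw])
    also have "\<dots> = 2 * T"
      unfolding T_def by (rule infsum_cmult_right')
    finally show ?thesis
      using G by (simp add: norm_divide divide_right_mono)
  qed
  \<comment> \<open>The part 2 C serves frequencies in the box, where \<open>alias_tail_le\<close>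
    applies; the + 2 covers the rest through T \<le> G.\<close>
  also have "2 * T / G \<le> (2 * C + 2) * (h ^ (2 * m) * (1 + (norm \<omega>)\<^sup>2) ^ m)"
  proof (cases "\<forall>i. \<bar>\<omega> $ i\<bar> \<le> pi / h")
    case True
    have W: "(1 + (norm \<omega>)\<^sup>2) ^ m > 0" by (intro zero_less_power add_pos_nonneg) auto
    have "T \<le> C * h ^ (2 * m)"
      unfolding T_def C_def by (rule alias_tail_le) (use True in blast)
    moreover have "1 / G \<le> (1 + (norm \<omega>)\<^sup>2) ^ m"
    proof -
      have "1 / (1 + (norm \<omega>)\<^sup>2) ^ m \<le> G"
        using alias_sum_ge[of \<omega> 0] by (simp add: G_def sobolev_symbol_def grid_point_0)
      then show ?thesis using G W by (simp add: field_simps)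
    qed
    ultimately have "2 * T * (1 / G) \<le> 2 * (C * h ^ (2 * m)) * (1 + (norm \<omega>)\<^sup>2) ^ m"
      using C0 h G by (intro mult_mono[of "2 * T" _ "1 / G"]) auto
    also have "\<dots> \<le> (2 * C + 2) * (h ^ (2 * m) * (1 + (norm \<omega>)\<^sup>2) ^ m)"
      using h W by (simp add: algebra_simps)
    finally show ?thesis by simp
  next
    case False
    then obtain i where i: "pi / h < \<bar>\<omega> $ i\<bar>" by (auto simp: not_le)
    also have "\<bar>\<omega> $ i\<bar> \<le> norm \<omega>" by (rule component_le_norm_cart)
    finally have "pi < h * norm \<omega>" using h by (simp add: field_simps)
    then have "1 \<le> h * norm \<omega>" using pi_ge_two by linarith
    then have "1 \<le> (h * norm \<omega>) ^ (2 * m)" by (rule one_le_power)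
    also have "\<dots> = h ^ (2 * m) * ((norm \<omega>)\<^sup>2) ^ m"
      by (simp add: power_mult_distrib power_mult)
    also have "\<dots> \<le> h ^ (2 * m) * (1 + (norm \<omega>)\<^sup>2) ^ m"
      using h by (intro mult_left_mono power_mono) auto
    finally have 1: "1 \<le> h ^ (2 * m) * (1 + (norm \<omega>)\<^sup>2) ^ m" .
    have "2 * T / G \<le> 2" using TG G by (simp add: field_simps)
    also have "\<dots> \<le> (2 * C + 2) * 1" using C0 by simp
    also have "\<dots> \<le> (2 * C + 2) * (h ^ (2 * m) * (1 + (norm \<omega>)\<^sup>2) ^ m)"
      using C0 by (intro mult_left_mono 1) auto
    finally show ?thesis .
  qed
  finally show ?thesis .
qed

text \<open>Inversion represents every grid value of f, and the sum over the grid passes under the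
  integral because the translates of the Lagrange function are absolutely summable. What remains is
  the transform integrated against the error for single exponentials, with the inversion factor (2
  \<pi>)^(-d).\<close>

lemma interpolation_error:
  fixes f :: "real ^ 'd \<Rightarrow> complex" and x :: "real ^ 'd"
  defines "C \<equiv> (\<Sum>\<^sub>\<infinity>k :: int ^ 'd. 2 ^ m * sobolev_symbol m (grid_point 1 k :: real ^ 'd))"
  assumes f: "f \<in> L2m1 m"
  shows "norm (f x - interpolant m h f x) \<le> 1 / (2 * pi) ^ CARD('d) * (2 * C + 2) *
    (LINT \<omega>|lborel. norm (of_real ((1 + (norm \<omega>)\<^sup>2) ^ m) * fourier_transform f \<omega>)) * h ^ (2 * m)"
proof -
  define F where "F = fourier_transform f"
  define W where "W \<omega> = (1 + (norm \<omega>)\<^sup>2) ^ m" for \<omega> :: "real ^ 'd"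
  define c where "c = complex_of_real (1 / (2 * pi) ^ CARD('d))"
  define L where "L j = lagrange_fun m h (x - grid_point h j)" for j :: "int ^ 'd"
  have cont: "continuous_on UNIV f" and fint: "integrable lborel f"
    and WF: "integrable lborel (\<lambda>\<omega>. of_real (W \<omega>) * F \<omega>)"
    using f by (auto simp: L2m1_def F_def W_def)
  have W1: "W \<omega> \<ge> 1" for \<omega> unfolding W_def by (rule one_le_power) simp
  \<comment> \<open>\<open>L2m1\<close> controls the weighted transform; dividing by the weight W
    \<ge> 1 recovers measurability and integrability of the transform itself.\<close>
  have Fint: "integrable lborel F"
  proof (rule Bochner_Integration.integrable_bound[OF WF])
    have "(\<lambda>\<omega>. complex_of_real (W \<omega>)) \<in> borel_measurable borel"
      unfolding W_def by measurable
    moreover have "(\<lambda>\<omega>. of_real (W \<omega>) * F \<omega>) \<in> borel_measurable borel"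
      using WF by (simp add: borel_measurable_integrable)
    ultimately have "(\<lambda>\<omega>. (of_real (W \<omega>) * F \<omega>) / of_real (W \<omega>)) \<in> borel_measurable borel"
      by (rule borel_measurable_divide[rotated])
    moreover have "(of_real (W \<omega>) * F \<omega>) / of_real (W \<omega>) = F \<omega>" for \<omega>
      using W1[of \<omega>] by simp
    ultimately show "F \<in> borel_measurable lborel" by simp
    have "norm (F \<omega>) \<le> norm (of_real (W \<omega>) * F \<omega>)" for \<omega>
      using W1[of \<omega>] mult_right_mono[OF W1[of \<omega>] norm_ge_zero[of "F \<omega>"]] by (simp add: norm_mult)
    then show "AE \<omega> in lborel. norm (F \<omega>) \<le> norm (of_real (W \<omega>) * F \<omega>)" by simp
  qed
  have inv: "f y = c * (LINT \<omega>|lborel. F \<omega> * cis (\<omega> \<bullet> y))" for y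
    using fourier_inversion[OF cont fint Fint[unfolded F_def], of y] by (simp add: F_def c_def)
  have cm: "(\<lambda>\<omega> :: real ^ 'd. cis (\<omega> \<bullet> y)) \<in> borel_measurable borel" for y
    by (intro borel_measurable_continuous_onI continuous_intros)
  have Fc: "integrable lborel (\<lambda>\<omega>. F \<omega> * cis (\<omega> \<bullet> y))" for y
    by (rule Bochner_Integration.integrable_bound[OF Fint])
      (use borel_measurable_integrable[OF Fint] cm in \<open>auto simp: norm_mult intro!: borel_measurable_times\<close>)
  have Ls: "(\<lambda>j. norm (L j)) summable_on UNIV"
    unfolding L_def by (rule summable_lagrange_fun)
  let ?k = "\<lambda>j \<omega>. F \<omega> * (cis (\<omega> \<bullet> grid_point h j) * L j)"
  have kint: "integrable lborel (?k j)" for j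
    using integrable_mult_left[OF Fc[of "grid_point h j"], of "L j"] by (simp add: mult.assoc)
  have ks: "(\<lambda>j. LINT \<omega>|lborel. norm (?k j \<omega>)) summable_on UNIV"
    using summable_on_cmult_right[OF Ls, of "LINT \<omega>|lborel. norm (F \<omega>)"] by (simp add: norm_mult)
  have "interpolant m h f x = (\<Sum>\<^sub>\<infinity>j. c * (LINT \<omega>|lborel. ?k j \<omega>))"
    unfolding interpolant_def L_def[symmetric]
    by (rule infsum_cong) (subst inv, simp flip: mult.assoc integral_mult_left_zero)
  also have "\<dots> = c * (\<Sum>\<^sub>\<infinity>j. LINT \<omega>|lborel. ?k j \<omega>)"
    by (rule infsum_cmult_right')
  also have "(\<Sum>\<^sub>\<infinity>j. LINT \<omega>|lborel. ?k j \<omega>) = (LINT \<omega>|lborel. (\<Sum>\<^sub>\<infinity>j. ?k j \<omega>))"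
    by (rule integral_infsum_swap[OF sigma_finite_lborel kint ks, symmetric])
  also have "(\<lambda>\<omega>. \<Sum>\<^sub>\<infinity>j. ?k j \<omega>) = (\<lambda>\<omega>. F \<omega> * (\<Sum>\<^sub>\<infinity>j. cis (\<omega> \<bullet> grid_point h j) * L j))"
    by (simp only: infsum_cmult_right')
  finally have I: "interpolant m h f x = c * (LINT \<omega>|lborel. F \<omega> * (\<Sum>\<^sub>\<infinity>j. cis (\<omega> \<bullet> grid_point h j) * L j))" .
  have Sint: "integrable lborel (\<lambda>\<omega>. F \<omega> * (\<Sum>\<^sub>\<infinity>j. cis (\<omega> \<bullet> grid_point h j) * L j))"
    using integrable_infsum[OF sigma_finite_lborel kint ks] by (simp only: infsum_cmult_right')
  define D where "D = (2 * C + 2) * h ^ (2 * m)"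
  have "f x - interpolant m h f x = c * ((LINT \<omega>|lborel. F \<omega> * cis (\<omega> \<bullet> x)) - (LINT \<omega>|lborel. F \<omega> * (\<Sum>\<^sub>\<infinity>j. cis (\<omega> \<bullet> grid_point h j) * L j)))"
    unfolding I inv[of x] by (simp only: right_diff_distrib)
  also have "(LINT \<omega>|lborel. F \<omega> * cis (\<omega> \<bullet> x)) - (LINT \<omega>|lborel. F \<omega> * (\<Sum>\<^sub>\<infinity>j. cis (\<omega> \<bullet> grid_point h j) * L j)) =
      (LINT \<omega>|lborel. F \<omega> * cis (\<omega> \<bullet> x) - F \<omega> * (\<Sum>\<^sub>\<infinity>j. cis (\<omega> \<bullet> grid_point h j) * L j))"
    by (rule Bochner_Integration.integral_diff[symmetric, OF Fc Sint])
  finally have eq: "norm (f x - interpolant m h f x) =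
      1 / (2 * pi) ^ CARD('d) * norm (LINT \<omega>|lborel. F \<omega> * cis (\<omega> \<bullet> x) - F \<omega> * (\<Sum>\<^sub>\<infinity>j. cis (\<omega> \<bullet> grid_point h j) * L j))"
    by (simp only: norm_mult c_def norm_of_real) simp
  have "norm (LINT \<omega>|lborel. F \<omega> * cis (\<omega> \<bullet> x) - F \<omega> * (\<Sum>\<^sub>\<infinity>j. cis (\<omega> \<bullet> grid_point h j) * L j))
      \<le> (LINT \<omega>|lborel. D * norm (of_real (W \<omega>) * F \<omega>))"
  proof (rule order_trans[OF integral_norm_bound integral_mono])
    show "integrable lborel (\<lambda>\<omega>. norm (F \<omega> * cis (\<omega> \<bullet> x) - F \<omega> * (\<Sum>\<^sub>\<infinity>j. cis (\<omega> \<bullet> grid_point h j) * L j)))"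
      by (intro integrable_norm Bochner_Integration.integrable_diff Fc Sint)
    show "integrable lborel (\<lambda>\<omega>. D * norm (of_real (W \<omega>) * F \<omega>))"
      by (intro integrable_mult_right integrable_norm WF)
    fix \<omega> :: "real ^ 'd"
    have "norm (F \<omega> * cis (\<omega> \<bullet> x) - F \<omega> * (\<Sum>\<^sub>\<infinity>j. cis (\<omega> \<bullet> grid_point h j) * L j)) =
        norm (F \<omega>) * norm (cis (\<omega> \<bullet> x) - (\<Sum>\<^sub>\<infinity>j. cis (\<omega> \<bullet> grid_point h j) * L j))"
      by (simp only: norm_mult right_diff_distrib[symmetric])
    also have "\<dots> \<le> norm (F \<omega>) * ((2 * C + 2) * (h ^ (2 * m) * (1 + (norm \<omega>)\<^sup>2) ^ m))"
      unfolding L_def C_def by (intro mult_left_mono exponential_interpolation_error) simp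
    also have "\<dots> = D * norm (of_real (W \<omega>) * F \<omega>)"
      using W1[of \<omega>] unfolding norm_mult norm_of_real D_def W_def by simp
    finally show "norm (F \<omega> * cis (\<omega> \<bullet> x) - F \<omega> * (\<Sum>\<^sub>\<infinity>j. cis (\<omega> \<bullet> grid_point h j) * L j)) \<le> D * norm (of_real (W \<omega>) * F \<omega>)" .
  qed
  also have "\<dots> = D * (LINT \<omega>|lborel. norm (of_real (W \<omega>) * F \<omega>))"
    by simp
  finally have "1 / (2 * pi) ^ CARD('d) * norm (LINT \<omega>|lborel. F \<omega> * cis (\<omega> \<bullet> x) - F \<omega> * (\<Sum>\<^sub>\<infinity>j. cis (\<omega> \<bullet> grid_point h j) * L j))
      \<le> 1 / (2 * pi) ^ CARD('d) * (D * (LINT \<omega>|lborel. norm (of_real (W \<omega>) * F \<omega>)))"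
    by (intro mult_left_mono) auto
  then show ?thesis
    unfolding eq by (simp only: D_def W_def F_def mult_ac)
qed

end

theorem corollary4p3:
  fixes m :: nat and f :: "real ^ 'd \<Rightarrow> complex"
  assumes "real m > real CARD('d) / 2"
    and "f \<in> L2m1 m"
  shows "\<exists>C::real. \<forall>h\<in>{0<..1}.
    Linf_norm (\<lambda>x. f x - interpolant m h f x) \<le> ereal (C * h ^ (2 * m))"
proof -
  \<comment> \<open>No h occurs here, and f enters only through the weighted L1 norm of its
    transform.\<close>
  let ?C = "1 / (2 * pi) ^ CARD('d) * (2 * (\<Sum>\<^sub>\<infinity>k :: int ^ 'd. 2 ^ m * sobolev_symbol m (grid_point 1 k :: real ^ 'd)) + 2) *
    (LINT \<omega>|lborel. norm (of_real ((1 + (norm \<omega>)\<^sup>2) ^ m) * fourier_transform f \<omega>))"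
  have "Linf_norm (\<lambda>x. f x - interpolant m h f x) \<le> ereal (?C * h ^ (2 * m))" if "h > 0" for h
    unfolding Linf_norm_def
  proof (rule esssup_I)
    have [measurable]: "f \<in> borel_measurable borel"
      using assms(2) by (auto simp: L2m1_def intro: borel_measurable_continuous_onI)
    have [measurable]: "interpolant m h f \<in> borel_measurable borel"
      by (rule measurable_interpolant[OF assms(1) that])
    show "(\<lambda>x. ereal (norm (f x - interpolant m h f x))) \<in> borel_measurable lborel"
      by simp
    show "AE x in lborel. ereal (norm (f x - interpolant m h f x)) \<le> ereal (?C * h ^ (2 * m))"
      using interpolation_error[OF assms(1) that assms(2)] by simp
  qed
  then show ?thesis
    by (intro exI[of _ ?C]) auto
qed

end
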